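(* Let $k$ be a field, let $V, V'$ be $k$-vector spaces, and let $W : V\otimes V\to V\otimes V$, $Z : V'\otimes V'\to V'\otimes V'$, $X : V\otimes V'\to V\otimes V'$ be linear maps forming a WXZ-system (Yang-Baxter system), i.e. $[W,W,W]=0$, $[Z,Z,Z]=0$, $[W,X,X]=0$ and $[X,X,Z]=0$. Put $R = W\circ\tau_{V,V}$, $R' = Z\circ\tau_{V',V'}$ and $U = X\circ\tau_{V',V} : V'\otimes V\to V\otimes V'$. Then: a) $(T(V),\mu,1_k)$ and $(T(V'),\mu',1_k)$ are $k$-algebras (associative, with unit $1_k$), where $\mu$ is the braid product on the tensor algebra $T(V)$ determined by $R$ and $\mu'$ is the braid product on $T(V')$ determined by $R'$. b) The linear map $\psi : T(V')\otimes T(V)\to T(V)\otimes T(V')$ whose components $\psi_{n,m}: T^n(V')\otimes T^m(V)\to T^m(V)\otimes T^n(V')$ are given, for $n,m\ge 1$, by $$\psi_{n,m}(x\otimes y) = (U_{m,m+1}\cdots U_{n+m-1,n+m})\cdots(U_{12}\cdots U_{n,n+1})(x\otimes y),$$ and by $\psi(x\otimes 1_k)=1_k\otimes x$ for $x\in T(V')$ and $\psi(1_k\otimes y)=y\otimes 1_k$ for $y\in T(V)$, is an algebra factorisation map between the algebras $A=(T(V),\mu,1_k)$ and $B=(T(V'),\mu',1_k)$.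
   Context: All tensor products are over the field $k$; all algebras are associative $k$-algebras with unit. $I_V$ is the identity map of $V$. For vector spaces $P,Q$, $\tau_{P,Q}:P\otimes Q\to Q\otimes P$ is the flip $p\otimes q\mapsto q\otimes p$. **Yang-Baxter commutator.** For vector spaces $V_1,V_2,V_3$ and linear maps $P: V_1\otimes V_2\to V_1\otimes V_2$, $S: V_1\otimes V_3\to V_1\otimes V_3$, $T: V_2\otimes V_3\to V_2\otimes V_3$, the map $[P,S,T]: V_1\otimes V_2\otimes V_3\to V_1\otimes V_2\otimes V_3$ is $[P,S,T] = P_{12}\circ S_{13}\circ T_{23} - T_{23}\circ S_{13}\circ P_{12}$, where the subscripts indicate the tensor factors on which a map acts (the remaining factor being acted on by the identity). In $[W,W,W]$ one takes $(V_1,V_2,V_3)=(V,V,V)$; in $[Z,Z,Z]$, $(V',V',V')$; in $[W,X,X]$, $(V,V,V')$; in $[X,X,Z]$, $(V,V',V')$. **Braid product.** $T(V)=\bigoplus_{n\ge0}T^n(V)$, with $T^n(V)=V^{\otimes n}$ and $T^0(V)=k$, whose identity is denoted $1_k$. Given a linear map $R: V\otimes V\to V\otimes V$, write $\sigma_i=R_{i,i+1}$ for $R$ acting on the adjacent tensor factors $i,i+1$ of a tensor power of $V$. The braid product $\mu: T(V)\otimes T(V)\to T(V)$ determined by $R$ has components $\mu_{n,p}: T^n(V)\otimes T^p(V)\to T^{n+p}(V)$, given for $n,p\ge1$, $x\in T^n(V)$, $y\in T^p(V)$ by $$xy=\mu_{n,p}(x\otimes y)=(\sigma_p\cdots\sigma_{n+p-1})(\sigma_{p-1}\cdots\sigma_{n+p-2})\cdots(\sigma_1\cdots\sigma_n)(x\otimes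 y),$$ where each block has increasing indices, juxtaposition is composition of maps (the rightmost is applied first), and $x\otimes y$ is viewed in $V^{\otimes(n+p)}$. Products with elements of $T^0(V)=k$ are given by scalar multiplication. The braid product $\mu'$ on $T(V')$ is defined in the same way from $R'$. **Notation $U_{i,i+1}$.** This denotes $U: V'\otimes V\to V\otimes V'$ applied to the $i$-th and $(i+1)$-st tensor factors (which are in $V'$ and $V$ respectively at the moment of application) and the identity on the other factors. In the formula for $\psi_{n,m}$, the product consists of $m$ blocks of $n$ factors each: the $j$-th block to be applied ($j=1,\dots,m$) is $U_{j,j+1}U_{j+1,j+2}\cdots U_{n+j-1,n+j}$, with composition read from right to left. **Algebra factorisation.** For algebras $A,B$ with multiplications $\mu_A,\mu_B$ and unit maps $\iota_A:k\to A$, $\iota_B:k\to B$, an algebra factorisation map is a linear map $\phi: B\otimes A\to A\otimes B$ satisfying (1) $\phi\circ(I_B\otimes\mu_A)=(\mu_A\otimes I_B)\circ(I_A\otimes\phi)\circ(\phi\otimes I_A)$; (2) $\phi\circ(\mu_B\otimes I_A)=(I_A\otimes\mu_B)\circ(\phi\otimes I_B)\circ(I_B\otimes\phi)$; (3) $\phi\circ(I_B\otimes\iota_A)=\iota_A\otimes I_B$; (4) $\phi\circ(\iota_B\otimes I_A)=I_A\otimes\iota_B$ (with the canonical identifications $B\otimes k\cong B\cong k\otimes B$ and $k\otimes A\cong A\cong A\otimes k$). The triple $(A,B)_\phi$ is then called an algebra factorisation. *)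

theory Defs
  imports "HOL-Algebra.AbelCoset" "HOL-Algebra.Module"
begin

text \<open>
  A vector space over the field \<open>K\<close> is a \<^locale>\<open>module\<close> over \<open>K\<close> in the sense of HOL-Algebra; the
  fields \<^const>\<open>mult\<close> and \<^const>\<open>one\<close> of a module record are irrelevant unless the record is used
  as an algebra.  Spaces that are to be tensored together have carriers in a common type; this is
  no restriction, since two arbitrary spaces can be copied into the sum of their types.
\<close>

subsection \<open>Linear maps, quotients, direct sums\<close>

definition linear_map ::
  "('k, 'r) ring_scheme \<Rightarrow> ('k, 'a) module \<Rightarrow> ('k, 'b) module \<Rightarrow> ('a \<Rightarrow> 'b) \<Rightarrow> bool"
  where "linear_map K M N \<phi> \<longleftrightarrow>
    \<phi> \<in> carrier M \<rightarrow> carrier N \<and>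
    (\<forall>x\<in>carrier M. \<forall>y\<in>carrier M. \<phi> (x \<oplus>\<^bsub>M\<^esub> y) = \<phi> x \<oplus>\<^bsub>N\<^esub> \<phi> y) \<and>
    (\<forall>c\<in>carrier K. \<forall>x\<in>carrier M. \<phi> (c \<odot>\<^bsub>M\<^esub> x) = c \<odot>\<^bsub>N\<^esub> \<phi> x)"

definition free_module :: "('k, 'r) ring_scheme \<Rightarrow> 'x set \<Rightarrow> ('k, 'x \<Rightarrow> 'k) module"
  where "free_module K S =
    \<lparr>carrier = {f. (\<forall>x. f x \<in> carrier K) \<and> (\<forall>x. x \<notin> S \<longrightarrow> f x = \<zero>\<^bsub>K\<^esub>) \<and> finite {x. f x \<noteq> \<zero>\<^bsub>K\<^esub>}},
     mult = undefined, one = undefined,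
     zero = (\<lambda>x. \<zero>\<^bsub>K\<^esub>), add = (\<lambda>f g x. f x \<oplus>\<^bsub>K\<^esub> g x),
     smult = (\<lambda>c f x. c \<otimes>\<^bsub>K\<^esub> f x)\<rparr>"

definition free_gen :: "('k, 'r) ring_scheme \<Rightarrow> 'x \<Rightarrow> 'x \<Rightarrow> 'k"
  where "free_gen K x = (\<lambda>y. if y = x then \<one>\<^bsub>K\<^esub> else \<zero>\<^bsub>K\<^esub>)"

definition submodule_span :: "('k, 'r) ring_scheme \<Rightarrow> ('k, 'a) module \<Rightarrow> 'a set \<Rightarrow> 'a set"
  where "submodule_span K M S = \<Inter> {H. submodule H K M \<and> S \<subseteq> H}"

definition quot_module :: "('k, 'a) module \<Rightarrow> 'a set \<Rightarrow> ('k, 'a set) module"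
  where "quot_module M H =
    \<lparr>carrier = a_rcosets\<^bsub>M\<^esub> H, mult = undefined, one = undefined,
     zero = H, add = set_add M,
     smult = (\<lambda>c X. \<Union>x\<in>X. H +>\<^bsub>M\<^esub> (c \<odot>\<^bsub>M\<^esub> x))\<rparr>"

definition direct_sum :: "('i \<Rightarrow> ('k, 'a) module) \<Rightarrow> ('k, 'i \<Rightarrow> 'a) module"
  where "direct_sum M =
    \<lparr>carrier = {x. (\<forall>i. x i \<in> carrier (M i)) \<and> finite {i. x i \<noteq> \<zero>\<^bsub>M i\<^esub>}},
     mult = undefined, one = undefined,
     zero = (\<lambda>i. \<zero>\<^bsub>M i\<^esub>), add = (\<lambda>x y i. x i \<oplus>\<^bsub>M i\<^esub> y i),
     smult = (\<lambda>c x i. c \<odot>\<^bsub>M i\<^esub> x i)\<rparr>"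

definition summand :: "('i \<Rightarrow> ('k, 'a) module) \<Rightarrow> 'i \<Rightarrow> 'a \<Rightarrow> 'i \<Rightarrow> 'a"
  where "summand M i x = (\<lambda>j. if j = i then x else \<zero>\<^bsub>M j\<^esub>)"

subsection \<open>Tensor products of finite lists of spaces\<close>

definition tuples :: "('k, 'a) module list \<Rightarrow> 'a list set"
  where "tuples Ms = {xs. list_all2 (\<lambda>x M. x \<in> carrier M) xs Ms}"

definition tensor_relations ::
  "('k, 'r) ring_scheme \<Rightarrow> ('k, 'a) module list \<Rightarrow> ('a list \<Rightarrow> 'k) set"
  where "tensor_relations K Ms =
    (let F = free_module K (tuples Ms); e = free_gen K in
      {e (xs[i := a \<oplus>\<^bsub>Ms!i\<^esub> b]) \<ominus>\<^bsub>F\<^esub> (e (xs[i := a]) \<oplus>\<^bsub>F\<^esub> e (xs[i := b])) | xs i a b.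
         xs \<in> tuples Ms \<and> i < length Ms \<and> a \<in> carrier (Ms!i) \<and> b \<in> carrier (Ms!i)} \<union>
      {e (xs[i := c \<odot>\<^bsub>Ms!i\<^esub> a]) \<ominus>\<^bsub>F\<^esub> (c \<odot>\<^bsub>F\<^esub> e (xs[i := a])) | xs i c a.
         xs \<in> tuples Ms \<and> i < length Ms \<and> c \<in> carrier K \<and> a \<in> carrier (Ms!i)})"

text \<open>
  \<open>tensor K [M\<^sub>1, \<dots>, M\<^sub>n]\<close> is \<open>M\<^sub>1 \<otimes> \<dots> \<otimes> M\<^sub>n\<close>.  For the empty list it is a copy of
  \<open>K\<close>, spanned by \<open>pure K [] []\<close>, and for a one-element list it is a copy of the space itself.
\<close>
definition tensor ::
  "('k, 'r) ring_scheme \<Rightarrow> ('k, 'a) module list \<Rightarrow> ('k, ('a list \<Rightarrow> 'k) set) module"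
  where "tensor K Ms =
    (let F = free_module K (tuples Ms) in
      quot_module F (submodule_span K F (tensor_relations K Ms)))"

definition pure ::
  "('k, 'r) ring_scheme \<Rightarrow> ('k, 'a) module list \<Rightarrow> 'a list \<Rightarrow> ('a list \<Rightarrow> 'k) set"
  where "pure K Ms xs =
    (let F = free_module K (tuples Ms) in
      submodule_span K F (tensor_relations K Ms) +>\<^bsub>F\<^esub> free_gen K xs)"

text \<open>
  The linear map on \<open>tensor K Ms\<close> with \<open>x\<^sub>1 \<otimes> \<dots> \<otimes> x\<^sub>n \<mapsto> f [x\<^sub>1, \<dots>, x\<^sub>n]\<close>; it
  exists and is unique (universal property) for every multilinear \<open>f\<close>.
\<close>
definition lift ::
  "('k, 'r) ring_scheme \<Rightarrow> ('k, 'a) module list \<Rightarrow> ('k, 'b) module \<Rightarrow> ('a list \<Rightarrow> 'b)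
    \<Rightarrow> ('a list \<Rightarrow> 'k) set \<Rightarrow> 'b"
  where "lift K Ms N f =
    (THE \<phi>. \<phi> \<in> extensional (carrier (tensor K Ms)) \<and> linear_map K (tensor K Ms) N \<phi> \<and>
      (\<forall>xs\<in>tuples Ms. \<phi> (pure K Ms xs) = f xs))"

text \<open>The canonical bilinear map \<open>(M\<^sub>1 \<otimes> \<dots>) \<times> (N\<^sub>1 \<otimes> \<dots>) \<rightarrow> M\<^sub>1 \<otimes> \<dots> \<otimes> N\<^sub>1 \<otimes> \<dots>\<close>.\<close>
definition tcat ::
  "('k, 'r) ring_scheme \<Rightarrow> ('k, 'a) module list \<Rightarrow> ('k, 'a) module list
    \<Rightarrow> ('a list \<Rightarrow> 'k) set \<Rightarrow> ('a list \<Rightarrow> 'k) set \<Rightarrow> ('a list \<Rightarrow> 'k) set"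
  where "tcat K Ms Ns s t =
    lift K Ms (tensor K (Ms @ Ns))
      (\<lambda>xs. lift K Ns (tensor K (Ms @ Ns)) (\<lambda>ys. pure K (Ms @ Ns) (xs @ ys)) t) s"

text \<open>
  \<open>leg K Ms Ns Ps Qs \<phi>\<close> is \<open>I \<otimes> \<phi> \<otimes> I\<close> from \<open>tensor K (Ms @ Ps @ Ns)\<close> to
  \<open>tensor K (Ms @ Qs @ Ns)\<close>, for a linear map \<open>\<phi>\<close> from \<open>tensor K Ps\<close> to \<open>tensor K Qs\<close>.
\<close>
definition leg ::
  "('k, 'r) ring_scheme \<Rightarrow> ('k, 'a) module list \<Rightarrow> ('k, 'a) module list
    \<Rightarrow> ('k, 'a) module list \<Rightarrow> ('k, 'a) module list
    \<Rightarrow> (('a list \<Rightarrow> 'k) set \<Rightarrow> ('a list \<Rightarrow> 'k) set)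
    \<Rightarrow> ('a list \<Rightarrow> 'k) set \<Rightarrow> ('a list \<Rightarrow> 'k) set"
  where "leg K Ms Ns Ps Qs \<phi> =
    lift K (Ms @ Ps @ Ns) (tensor K (Ms @ Qs @ Ns))
      (\<lambda>zs.
        let xs = take (length Ms) zs;
            ps = take (length Ps) (drop (length Ms) zs);
            ys = drop (length Ms + length Ps) zs
        in tcat K Ms (Qs @ Ns) (pure K Ms xs) (tcat K Qs Ns (\<phi> (pure K Ps ps)) (pure K Ns ys)))"

definition flip ::
  "('k, 'r) ring_scheme \<Rightarrow> ('k, 'a) module \<Rightarrow> ('k, 'a) module
    \<Rightarrow> ('a list \<Rightarrow> 'k) set \<Rightarrow> ('a list \<Rightarrow> 'k) set"
  where "flip K P Q = lift K [P, Q] (tensor K [Q, P]) (\<lambda>xs. pure K [Q, P] (rev xs))"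

subsection \<open>Yang-Baxter systems\<close>

definition yb_commutator ::
  "('k, 'r) ring_scheme \<Rightarrow> ('k, 'a) module \<Rightarrow> ('k, 'a) module \<Rightarrow> ('k, 'a) module
    \<Rightarrow> (('a list \<Rightarrow> 'k) set \<Rightarrow> ('a list \<Rightarrow> 'k) set)
    \<Rightarrow> (('a list \<Rightarrow> 'k) set \<Rightarrow> ('a list \<Rightarrow> 'k) set)
    \<Rightarrow> (('a list \<Rightarrow> 'k) set \<Rightarrow> ('a list \<Rightarrow> 'k) set)
    \<Rightarrow> ('a list \<Rightarrow> 'k) set \<Rightarrow> ('a list \<Rightarrow> 'k) set"
  where "yb_commutator K V1 V2 V3 P S T t =
    (let P12 = leg K [] [V3] [V1, V2] [V1, V2] P;
         T23 = leg K [V1] [] [V2, V3] [V2, V3] T;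
         S13 = leg K [V1] [] [V3, V2] [V2, V3] (flip K V3 V2)
               \<circ> leg K [] [V2] [V1, V3] [V1, V3] S
               \<circ> leg K [V1] [] [V2, V3] [V3, V2] (flip K V2 V3)
     in (P12 \<circ> S13 \<circ> T23) t \<ominus>\<^bsub>tensor K [V1, V2, V3]\<^esub> (T23 \<circ> S13 \<circ> P12) t)"

definition yb_commute ::
  "('k, 'r) ring_scheme \<Rightarrow> ('k, 'a) module \<Rightarrow> ('k, 'a) module \<Rightarrow> ('k, 'a) module
    \<Rightarrow> (('a list \<Rightarrow> 'k) set \<Rightarrow> ('a list \<Rightarrow> 'k) set)
    \<Rightarrow> (('a list \<Rightarrow> 'k) set \<Rightarrow> ('a list \<Rightarrow> 'k) set)
    \<Rightarrow> (('a list \<Rightarrow> 'k) set \<Rightarrow> ('a list \<Rightarrow> 'k) set) \<Rightarrow> bool"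
  where "yb_commute K V1 V2 V3 P S T \<longleftrightarrow>
    (\<forall>t\<in>carrier (tensor K [V1, V2, V3]).
      yb_commutator K V1 V2 V3 P S T t = \<zero>\<^bsub>tensor K [V1, V2, V3]\<^esub>)"

definition WXZ_system ::
  "('k, 'r) ring_scheme \<Rightarrow> ('k, 'a) module \<Rightarrow> ('k, 'a) module
    \<Rightarrow> (('a list \<Rightarrow> 'k) set \<Rightarrow> ('a list \<Rightarrow> 'k) set)
    \<Rightarrow> (('a list \<Rightarrow> 'k) set \<Rightarrow> ('a list \<Rightarrow> 'k) set)
    \<Rightarrow> (('a list \<Rightarrow> 'k) set \<Rightarrow> ('a list \<Rightarrow> 'k) set) \<Rightarrow> bool"
  where "WXZ_system K V V' W X Z \<longleftrightarrow>
    linear_map K (tensor K [V, V]) (tensor K [V, V]) W \<and>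
    linear_map K (tensor K [V, V']) (tensor K [V, V']) X \<and>
    linear_map K (tensor K [V', V']) (tensor K [V', V']) Z \<and>
    yb_commute K V V V W W W \<and>
    yb_commute K V' V' V' Z Z Z \<and>
    yb_commute K V V V' W X X \<and>
    yb_commute K V V' V' X X Z"

subsection \<open>Braid product and the map \<open>\<psi>\<close>\<close>

text \<open>
  \<open>cross_at K \<phi> i Ms\<close> is \<open>\<phi>\<^bsub>i,i+1\<^esub>\<close> on \<open>tensor K Ms\<close> (positions counted from 1), for \<open>\<phi>\<close>
  mapping \<open>M\<^sub>i \<otimes> M\<^sub>i\<^sub>+\<^sub>1\<close> to \<open>M\<^sub>i\<^sub>+\<^sub>1 \<otimes> M\<^sub>i\<close>; its values lie in \<open>tensor K (swap_at i Ms)\<close>.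
\<close>
definition swap_at :: "nat \<Rightarrow> 'b list \<Rightarrow> 'b list"
  where "swap_at i Ms = take (i - 1) Ms @ [Ms ! i, Ms ! (i - 1)] @ drop (i + 1) Ms"

definition cross_at ::
  "('k, 'r) ring_scheme \<Rightarrow> (('a list \<Rightarrow> 'k) set \<Rightarrow> ('a list \<Rightarrow> 'k) set) \<Rightarrow> nat
    \<Rightarrow> ('k, 'a) module list \<Rightarrow> ('a list \<Rightarrow> 'k) set \<Rightarrow> ('a list \<Rightarrow> 'k) set"
  where "cross_at K \<phi> i Ms =
    leg K (take (i - 1) Ms) (drop (i + 1) Ms)
      [Ms ! (i - 1), Ms ! i] [Ms ! i, Ms ! (i - 1)] \<phi>"

text \<open>The head of the index list is the crossing applied first.\<close>
fun cross_seq ::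
  "('k, 'r) ring_scheme \<Rightarrow> (('a list \<Rightarrow> 'k) set \<Rightarrow> ('a list \<Rightarrow> 'k) set) \<Rightarrow> nat list
    \<Rightarrow> ('k, 'a) module list \<Rightarrow> ('a list \<Rightarrow> 'k) set \<Rightarrow> ('a list \<Rightarrow> 'k) set"
  where
    "cross_seq K \<phi> [] Ms t = t"
  | "cross_seq K \<phi> (i # is) Ms t = cross_seq K \<phi> is (swap_at i Ms) (cross_at K \<phi> i Ms t)"

text \<open>
  The indices of \<open>(\<sigma>\<^sub>p \<cdots> \<sigma>\<^bsub>n+p-1\<^esub>) \<cdots> (\<sigma>\<^sub>1 \<cdots> \<sigma>\<^sub>n)\<close> in order of application,
  that is, read from right to left: \<open>n, \<dots>, 1, n+1, \<dots>, 2, \<dots>, n+p-1, \<dots>, p\<close>.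
\<close>
definition block_crossing :: "nat \<Rightarrow> nat \<Rightarrow> nat list"
  where "block_crossing n p = concat (map (\<lambda>j. rev [j..<n + j]) [1..<p + 1])"

definition tpower ::
  "('k, 'r) ring_scheme \<Rightarrow> ('k, 'a) module \<Rightarrow> nat \<Rightarrow> ('k, ('a list \<Rightarrow> 'k) set) module"
  where "tpower K V n = tensor K (replicate n V)"

definition tensor_space ::
  "('k, 'r) ring_scheme \<Rightarrow> ('k, 'a) module \<Rightarrow> ('k, nat \<Rightarrow> ('a list \<Rightarrow> 'k) set) module"
  where "tensor_space K V = direct_sum (tpower K V)"

definition tensor_one ::
  "('k, 'r) ring_scheme \<Rightarrow> ('k, 'a) module \<Rightarrow> nat \<Rightarrow> ('a list \<Rightarrow> 'k) set"
  where "tensor_one K V = summand (tpower K V) 0 (pure K [] [])"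

text \<open>
  For \<open>n = 0\<close> or \<open>p = 0\<close> there are no crossings, and \<open>braid_component\<close> is \<^const>\<open>tcat\<close>, i.e.
  scalar multiplication.
\<close>
definition braid_component ::
  "('k, 'r) ring_scheme \<Rightarrow> ('k, 'a) module \<Rightarrow> (('a list \<Rightarrow> 'k) set \<Rightarrow> ('a list \<Rightarrow> 'k) set)
    \<Rightarrow> nat \<Rightarrow> nat \<Rightarrow> ('a list \<Rightarrow> 'k) set \<Rightarrow> ('a list \<Rightarrow> 'k) set \<Rightarrow> ('a list \<Rightarrow> 'k) set"
  where "braid_component K V R n p x y =
    cross_seq K R (block_crossing n p) (replicate n V @ replicate p V)
      (tcat K (replicate n V) (replicate p V) x y)"

definition braid_algebra ::
  "('k, 'r) ring_scheme \<Rightarrow> ('k, 'a) module \<Rightarrow> (('a list \<Rightarrow> 'k) set \<Rightarrow> ('a list \<Rightarrow> 'k) set)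
    \<Rightarrow> ('k, nat \<Rightarrow> ('a list \<Rightarrow> 'k) set) module"
  where "braid_algebra K V R = (tensor_space K V)
    \<lparr>mult := \<lambda>x y q. \<Oplus>\<^bsub>tpower K V q\<^esub>n\<in>{..q}. braid_component K V R n (q - n) (x n) (y (q - n)),
     one := tensor_one K V\<rparr>"

definition psi_component ::
  "('k, 'r) ring_scheme \<Rightarrow> ('k, 'a) module \<Rightarrow> ('k, 'a) module
    \<Rightarrow> (('a list \<Rightarrow> 'k) set \<Rightarrow> ('a list \<Rightarrow> 'k) set)
    \<Rightarrow> nat \<Rightarrow> nat \<Rightarrow> ('a list \<Rightarrow> 'k) set \<Rightarrow> ('a list \<Rightarrow> 'k) set \<Rightarrow> ('a list \<Rightarrow> 'k) set"
  where "psi_component K V V' U n m x y =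
    cross_seq K U (block_crossing n m) (replicate n V' @ replicate m V)
      (tcat K (replicate n V') (replicate m V) x y)"

text \<open>The canonical inclusion of \<open>T\<^sup>m(V) \<otimes> T\<^sup>n(V')\<close> into \<open>T(V) \<otimes> T(V')\<close>.\<close>
definition bidegree_incl ::
  "('k, 'r) ring_scheme \<Rightarrow> ('k, 'a) module \<Rightarrow> ('k, 'a) module \<Rightarrow> nat \<Rightarrow> nat
    \<Rightarrow> ('a list \<Rightarrow> 'k) set \<Rightarrow> ((nat \<Rightarrow> ('a list \<Rightarrow> 'k) set) list \<Rightarrow> 'k) set"
  where "bidegree_incl K V V' m n =
    lift K (replicate m V @ replicate n V') (tensor K [tensor_space K V, tensor_space K V'])
      (\<lambda>zs. pure K [tensor_space K V, tensor_space K V']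
        [summand (tpower K V) m (pure K (replicate m V) (take m zs)),
         summand (tpower K V') n (pure K (replicate n V') (drop m zs))])"

text \<open>
  Stated on the underlying spaces; \<^const>\<open>tensor\<close> does not depend on \<^const>\<open>mult\<close> and
  \<^const>\<open>one\<close>, so source and target are \<open>B \<otimes> A\<close> and \<open>A \<otimes> B\<close> for the braid algebras \<open>A\<close>, \<open>B\<close> on
  \<open>T(V)\<close>, \<open>T(V')\<close>.  The components for \<open>n = 0\<close> or \<open>m = 0\<close> are those given by the last two clauses.
\<close>
definition psi ::
  "('k, 'r) ring_scheme \<Rightarrow> ('k, 'a) module \<Rightarrow> ('k, 'a) module
    \<Rightarrow> (('a list \<Rightarrow> 'k) set \<Rightarrow> ('a list \<Rightarrow> 'k) set)
    \<Rightarrow> ((nat \<Rightarrow> ('a list \<Rightarrow> 'k) set) list \<Rightarrow> 'k) set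
    \<Rightarrow> ((nat \<Rightarrow> ('a list \<Rightarrow> 'k) set) list \<Rightarrow> 'k) set"
  where "psi K V V' U =
    (let TV = tensor_space K V; TV' = tensor_space K V' in
     THE \<psi>. \<psi> \<in> extensional (carrier (tensor K [TV', TV])) \<and>
       linear_map K (tensor K [TV', TV]) (tensor K [TV, TV']) \<psi> \<and>
       (\<forall>n\<ge>1. \<forall>m\<ge>1. \<forall>x\<in>carrier (tpower K V' n). \<forall>y\<in>carrier (tpower K V m).
         \<psi> (pure K [TV', TV] [summand (tpower K V') n x, summand (tpower K V) m y])
           = bidegree_incl K V V' m n (psi_component K V V' U n m x y)) \<and>
       (\<forall>x\<in>carrier TV'. \<psi> (pure K [TV', TV] [x, tensor_one K V])
           = pure K [TV, TV'] [tensor_one K V, x]) \<and>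
       (\<forall>y\<in>carrier TV. \<psi> (pure K [TV', TV] [tensor_one K V', y])
           = pure K [TV, TV'] [y, tensor_one K V']))"

subsection \<open>Algebras and algebra factorisations\<close>

text \<open>The library's locale \<^locale>\<open>algebra\<close> covers commutative algebras only.\<close>
definition assoc_algebra :: "('k, 'r) ring_scheme \<Rightarrow> ('k, 'a) module \<Rightarrow> bool"
  where "assoc_algebra K A \<longleftrightarrow>
    module K A \<and> ring A \<and>
    (\<forall>c\<in>carrier K. \<forall>x\<in>carrier A. \<forall>y\<in>carrier A.
      (c \<odot>\<^bsub>A\<^esub> x) \<otimes>\<^bsub>A\<^esub> y = c \<odot>\<^bsub>A\<^esub> (x \<otimes>\<^bsub>A\<^esub> y) \<and>
      x \<otimes>\<^bsub>A\<^esub> (c \<odot>\<^bsub>A\<^esub> y) = c \<odot>\<^bsub>A\<^esub> (x \<otimes>\<^bsub>A\<^esub> y))"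

text \<open>\<open>\<mu>\<^sub>A : A \<otimes> A \<rightarrow> A\<close> and \<open>\<iota>\<^sub>A : k \<rightarrow> A\<close>, with \<open>A\<close> and \<open>k\<close> as \<open>tensor K [A]\<close> and
  \<open>tensor K []\<close>.\<close>
definition mult_map ::
  "('k, 'r) ring_scheme \<Rightarrow> ('k, 'a) module \<Rightarrow> ('a list \<Rightarrow> 'k) set \<Rightarrow> ('a list \<Rightarrow> 'k) set"
  where "mult_map K A = lift K [A, A] (tensor K [A]) (\<lambda>xs. pure K [A] [xs ! 0 \<otimes>\<^bsub>A\<^esub> xs ! 1])"

definition unit_map ::
  "('k, 'r) ring_scheme \<Rightarrow> ('k, 'a) module \<Rightarrow> ('a list \<Rightarrow> 'k) set \<Rightarrow> ('a list \<Rightarrow> 'k) set"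
  where "unit_map K A = lift K [] (tensor K [A]) (\<lambda>xs. pure K [A] [\<one>\<^bsub>A\<^esub>])"

definition algebra_factorisation ::
  "('k, 'r) ring_scheme \<Rightarrow> ('k, 'a) module \<Rightarrow> ('k, 'a) module
    \<Rightarrow> (('a list \<Rightarrow> 'k) set \<Rightarrow> ('a list \<Rightarrow> 'k) set) \<Rightarrow> bool"
  where "algebra_factorisation K A B \<phi> \<longleftrightarrow>
    assoc_algebra K A \<and> assoc_algebra K B \<and>
    linear_map K (tensor K [B, A]) (tensor K [A, B]) \<phi> \<and>
    (\<forall>t\<in>carrier (tensor K [B, A, A]).
      \<phi> (leg K [B] [] [A, A] [A] (mult_map K A) t) =
      leg K [] [B] [A, A] [A] (mult_map K A)
        (leg K [A] [] [B, A] [A, B] \<phi> (leg K [] [A] [B, A] [A, B] \<phi> t))) \<and>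
    (\<forall>t\<in>carrier (tensor K [B, B, A]).
      \<phi> (leg K [] [A] [B, B] [B] (mult_map K B) t) =
      leg K [A] [] [B, B] [B] (mult_map K B)
        (leg K [] [B] [B, A] [A, B] \<phi> (leg K [B] [] [B, A] [A, B] \<phi> t))) \<and>
    (\<forall>t\<in>carrier (tensor K [B]).
      \<phi> (leg K [B] [] [] [A] (unit_map K A) t) = leg K [] [B] [] [A] (unit_map K A) t) \<and>
    (\<forall>t\<in>carrier (tensor K [A]).
      \<phi> (leg K [] [A] [] [B] (unit_map K B) t) = leg K [A] [] [] [B] (unit_map K B) t)"

end

theory Submission
  imports Defs
begin

text \<open>
  With \<open>R = W \<tau>\<close>, \<open>R' = Z \<tau>\<close>, \<open>U = X \<tau>\<close> the four conditions of a WXZ-system become the braid relations for \<open>R\<close>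
  and \<open>R'\<close> together with the mixed relations \<open>R\<^sub>1\<^sub>2 U\<^sub>2\<^sub>3 U\<^sub>1\<^sub>2 = U\<^sub>2\<^sub>3 U\<^sub>1\<^sub>2 R\<^sub>2\<^sub>3\<close> and
  \<open>U\<^sub>1\<^sub>2 U\<^sub>2\<^sub>3 R'\<^sub>1\<^sub>2 = R'\<^sub>2\<^sub>3 U\<^sub>1\<^sub>2 U\<^sub>2\<^sub>3\<close>.  The map \<open>\<psi>\<^sub>n\<^sub>,\<^sub>m\<close> is a block crossing built from \<open>U\<close>, and the braid
  product is the special case \<open>V' = V\<close>, \<open>U = R\<close> of it.  Block crossings are multiplicative in both block sizes,
  \<open>\<psi>\<^sub>n\<^sub>,\<^sub>m\<^sub>+\<^sub>p = (1 \<otimes> \<psi>\<^sub>n\<^sub>,\<^sub>p)(\<psi>\<^sub>n\<^sub>,\<^sub>m \<otimes> 1)\<close> and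
  \<open>\<psi>\<^sub>n\<^sub>+\<^sub>k\<^sub>,\<^sub>m = (\<psi>\<^sub>n\<^sub>,\<^sub>m \<otimes> 1)(1 \<otimes> \<psi>\<^sub>k\<^sub>,\<^sub>m)\<close>, and the mixed relations say that \<open>\<psi>\<close> is natural with respect to
  \<open>R\<close> and \<open>R'\<close>, hence with respect to the products.  Multiplicativity and naturality together are the
  factorisation identities, and in the special case they give associativity.
\<close>

section \<open>Closure properties of linear maps\<close>

section \<open>Linear maps\<close>

text \<open>Append of lists is strictly associative, so tensor powers are written over flat lists of
  factors and no associativity isomorphisms occur; \<open>tcat\<close> and \<open>leg\<close> stand
  for the tensor product of elements and of maps. The nested product of \<open>T(V)\<close> and
  \<open>T(V')\<close> does not flatten in this way, so \<open>bidegree_incl\<close> transports the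
  identities between block crossings to it, one bidegree at a time. Naturality concerns arbitrarily
  many strands, but multiplicativity reduces it to one strand against two, where it is literally one
  of the relations obtained from the system. Multiplicativity in the second block size can be read
  off from the order of the crossings. In the first it cannot: the crossings of the two parts
  interleave, and crossings of distant strands have to be interchanged. The values of
  \<open>W\<close>, \<open>X\<close> and \<open>Z\<close> are not pure tensors. Intermediate
  equations are therefore stated for general tensors and tested on pure ones by linearity. The
  description of \<open>psi\<close> prescribes only the units in degree zero; it determines a map
  because these units span degree zero.\<close>

lemma linear_mapI:
  assumes "\<And>x. x \<in> carrier M \<Longrightarrow> f x \<in> carrier N"
    and "\<And>x y. x \<in> carrier M \<Longrightarrow> y \<in> carrier M \<Longrightarrow> f (x \<oplus>\<^bsub>M\<^esub> y) = f x \<oplus>\<^bsub>N\<^esub> f y"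
    and "\<And>c x. c \<in> carrier K \<Longrightarrow> x \<in> carrier M \<Longrightarrow> f (c \<odot>\<^bsub>M\<^esub> x) = c \<odot>\<^bsub>N\<^esub> f x"
  shows "linear_map K M N f"
  using assms by (auto simp: linear_map_def)

lemma linear_map_closed [intro]: "linear_map K M N f \<Longrightarrow> x \<in> carrier M \<Longrightarrow> f x \<in> carrier N"
  by (auto simp: linear_map_def)

lemma linear_map_add:
  "linear_map K M N f \<Longrightarrow> x \<in> carrier M \<Longrightarrow> y \<in> carrier M \<Longrightarrow> f (x \<oplus>\<^bsub>M\<^esub> y) = f x \<oplus>\<^bsub>N\<^esub> f y"
  by (auto simp: linear_map_def)

lemma linear_map_smult:
  "linear_map K M N f \<Longrightarrow> c \<in> carrier K \<Longrightarrow> x \<in> carrier M \<Longrightarrow> f (c \<odot>\<^bsub>M\<^esub> x) = c \<odot>\<^bsub>N\<^esub> f x"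
  by (auto simp: linear_map_def)

lemma linear_map_compose:
  assumes f: "linear_map K M N f" and g: "linear_map K N P g"
  shows "linear_map K M P (\<lambda>x. g (f x))"
  using linear_map_closed[OF f] linear_map_closed[OF g] linear_map_add[OF f] linear_map_add[OF g]
    linear_map_smult[OF f] linear_map_smult[OF g]
  by (intro linear_mapI) auto

lemma linear_map_cong:
  assumes M: "module K M" and eq: "\<And>x. x \<in> carrier M \<Longrightarrow> f x = g x" and f: "linear_map K M N f"
  shows "linear_map K M N g"
proof -
  interpret M: module K M by fact
  show ?thesis
    by (rule linear_mapI)
      (simp_all add: eq[symmetric] linear_map_closed[OF f] linear_map_add[OF f] linear_map_smult[OF f])
qed

lemma linear_map_ident: "linear_map K M M (\<lambda>x. x)"
  by (auto simp: linear_map_def)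

lemma module_add_closed:
  "module K M \<Longrightarrow> x \<in> carrier M \<Longrightarrow> y \<in> carrier M \<Longrightarrow> x \<oplus>\<^bsub>M\<^esub> y \<in> carrier M"
  by (meson abelian_groupE(1) module_def)

lemma module_zero_closed: "module K M \<Longrightarrow> \<zero>\<^bsub>M\<^esub> \<in> carrier M"
  by (meson abelian_groupE(2) module_def)

lemmas module_smult_closed = module.smult_closed

lemma linear_map_zero:
  assumes "module K M" "module K N" "linear_map K M N f"
  shows "f \<zero>\<^bsub>M\<^esub> = \<zero>\<^bsub>N\<^esub>"
proof -
  interpret M: module K M by fact
  interpret N: module K N by fact
  have "f \<zero>\<^bsub>M\<^esub> = f (\<zero>\<^bsub>K\<^esub> \<odot>\<^bsub>M\<^esub> \<zero>\<^bsub>M\<^esub>)" by simp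
  also have "\<dots> = \<zero>\<^bsub>K\<^esub> \<odot>\<^bsub>N\<^esub> f \<zero>\<^bsub>M\<^esub>" by (rule linear_map_smult[OF assms(3)]) auto
  also have "\<dots> = \<zero>\<^bsub>N\<^esub>" using linear_map_closed[OF assms(3)] by simp
  finally show ?thesis .
qed

lemma linear_map_minus:
  assumes "module K M" "module K N" "linear_map K M N f" "x \<in> carrier M" "y \<in> carrier M"
  shows "f (x \<ominus>\<^bsub>M\<^esub> y) = f x \<ominus>\<^bsub>N\<^esub> f y"
proof -
  interpret M: module K M by fact
  interpret N: module K N by fact
  have cl: "f x \<in> carrier N" "f y \<in> carrier N"
    using linear_map_closed[OF assms(3)] assms by auto
  \<comment> \<open>Negation is scaling by \<open>\<ominus> \<one>\<close>, so compatibility with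
    scalars already covers it.\<close>
  have neg: "\<ominus>\<^bsub>M\<^esub> y = (\<ominus>\<^bsub>K\<^esub> \<one>\<^bsub>K\<^esub>) \<odot>\<^bsub>M\<^esub> y" using assms by (simp add: M.smult_l_minus)
  have "f (\<ominus>\<^bsub>M\<^esub> y) = \<ominus>\<^bsub>N\<^esub> f y"
    unfolding neg using linear_map_smult[OF assms(3), of "\<ominus>\<^bsub>K\<^esub> \<one>\<^bsub>K\<^esub>" y] cl assms
    by (simp add: N.smult_l_minus)
  then show ?thesis
    using assms by (simp add: a_minus_def linear_map_add[OF assms(3)])
qed

lemma linear_map_add_fun:
  assumes "module K N" "linear_map K M N f" "linear_map K M N g"
  shows "linear_map K M N (\<lambda>x. f x \<oplus>\<^bsub>N\<^esub> g x)"
proof -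
  interpret N: module K N by fact
  show ?thesis
    by (rule linear_mapI)
      (auto simp: linear_map_add[OF assms(2)] linear_map_add[OF assms(3)]
        linear_map_smult[OF assms(2)] linear_map_smult[OF assms(3)] N.smult_r_distr
        linear_map_closed[OF assms(2)] linear_map_closed[OF assms(3)] N.M.a_ac)
qed

lemma linear_map_smult_fun:
  assumes "module K N" "linear_map K M N f" "c \<in> carrier K"
  shows "linear_map K M N (\<lambda>x. c \<odot>\<^bsub>N\<^esub> f x)"
proof -
  interpret N: module K N by fact
  show ?thesis
    using assms(3)
    by (intro linear_mapI)
      (auto simp: linear_map_add[OF assms(2)] linear_map_smult[OF assms(2)] N.smult_r_distr
        linear_map_closed[OF assms(2)] N.smult_assoc1[symmetric] N.R.m_comm)
qed

section \<open>Finitely supported functions and linear extension from generators\<close>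

section \<open>Free modules\<close>

locale scalar_ring = cring K for K :: "('k, 'r) ring_scheme" (structure)
begin

lemma free_module_sel [simp]:
  "zero (free_module K S) = (\<lambda>x. \<zero>)"
  "add (free_module K S) f g = (\<lambda>x. f x \<oplus> g x)"
  "smult (free_module K S) c f = (\<lambda>x. c \<otimes> f x)"
  by (simp_all add: free_module_def)

lemma free_module_carrier:
  "f \<in> carrier (free_module K S) \<longleftrightarrow>
    (\<forall>x. f x \<in> carrier K) \<and> (\<forall>x. x \<notin> S \<longrightarrow> f x = \<zero>) \<and> finite {x. f x \<noteq> \<zero>}"
  by (simp add: free_module_def)

lemma free_module_module: "module K (free_module K S)"
proof (rule moduleI)
  let ?F = "free_module K S"
  show "cring K" by (rule is_cring)
  have add: "(\<lambda>x. f x \<oplus> g x) \<in> carrier ?F"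
    if "f \<in> carrier ?F" "g \<in> carrier ?F" for f g
  proof -
    have "{x. f x \<oplus> g x \<noteq> \<zero>} \<subseteq> {x. f x \<noteq> \<zero>} \<union> {x. g x \<noteq> \<zero>}" by auto
    then show ?thesis
      using that unfolding free_module_carrier by (auto intro: finite_subset)
  qed
  have smult: "(\<lambda>x. c \<otimes> f x) \<in> carrier ?F" if "c \<in> carrier K" "f \<in> carrier ?F" for c f
  proof -
    have "{x. c \<otimes> f x \<noteq> \<zero>} \<subseteq> {x. f x \<noteq> \<zero>}" using that by auto
    then show ?thesis
      using that unfolding free_module_carrier by (auto intro: finite_subset)
  qed
  have cl: "f x \<in> carrier K" if "f \<in> carrier ?F" for f x
    using that by (simp add: free_module_carrier)
  have zero: "(\<lambda>x. \<zero>) \<in> carrier ?F" by (simp add: free_module_carrier)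
  show "abelian_group ?F"
  proof (rule abelian_groupI)
    fix f assume f: "f \<in> carrier ?F"
    \<comment> \<open>The additive inverse is taken as a scalar multiple, so that closure under
      scaling also supplies its finite support.\<close>
    have "(\<lambda>x. \<ominus> \<one> \<otimes> f x) \<in> carrier ?F" by (rule smult) (use f in auto)
    moreover have "(\<lambda>x. \<ominus> \<one> \<otimes> f x \<oplus> f x) = (\<lambda>x. \<zero>)"
      using f by (auto simp: free_module_carrier l_minus l_neg)
    ultimately show "\<exists>g\<in>carrier ?F. g \<oplus>\<^bsub>?F\<^esub> f = \<zero>\<^bsub>?F\<^esub>" by auto
  qed (auto intro!: add simp: zero cl a_ac)
  show "c \<odot>\<^bsub>?F\<^esub> f \<in> carrier ?F" if "c \<in> carrier K" "f \<in> carrier ?F" for c f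
    using smult[OF that] by simp
qed (auto simp: free_module_carrier l_distr r_distr m_assoc)

lemma free_gen_closed: "x \<in> S \<Longrightarrow> free_gen K x \<in> carrier (free_module K S)"
  by (auto simp: free_module_carrier free_gen_def)

text \<open>Setting one value of \<open>f\<close> to zero removes exactly one point of the support
  and subtracts one multiple of a generator, so induction on the finite support applies. The
  spanning property of pure tensors rests on this rule.\<close>

lemma free_module_induct [consumes 1, case_names zero add]:
  assumes f: "f \<in> carrier (free_module K S)"
    and zero: "P (\<lambda>x. \<zero>)"
    and add: "\<And>f c x. f \<in> carrier (free_module K S) \<Longrightarrow> P f \<Longrightarrow> c \<in> carrier K \<Longrightarrow> x \<in> S \<Longrightarrow>
      P (f \<oplus>\<^bsub>free_module K S\<^esub> c \<odot>\<^bsub>free_module K S\<^esub> free_gen K x)"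
  shows "P f"
proof -
  have "finite {x. f x \<noteq> \<zero>}" using f by (simp add: free_module_carrier)
  then show ?thesis using f
  proof (induction "{x. f x \<noteq> \<zero>}" arbitrary: f rule: finite_induct)
    case empty
    then have "f = (\<lambda>x. \<zero>)" by auto
    then show ?case using zero by simp
  next
    case (insert x A)
    define g where "g = f(x := \<zero>)"
    have A: "A = {y. g y \<noteq> \<zero>}" using insert(2,4) by (auto simp: g_def)
    have g: "g \<in> carrier (free_module K S)"
      using insert(5) A insert(1) by (auto simp: free_module_carrier g_def)
    have x: "x \<in> S" "f x \<in> carrier K" using insert(4,5) by (auto simp: free_module_carrier)
    have cl: "f y \<in> carrier K" for y using insert(5) by (auto simp: free_module_carrier)
    have "f = g \<oplus>\<^bsub>free_module K S\<^esub> f x \<odot>\<^bsub>free_module K S\<^esub> free_gen K x"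
      using cl by (auto simp: g_def free_gen_def fun_eq_iff)
    then show ?case using add[OF g insert(3)[OF A g] x(2,1)] by simp
  qed
qed

definition free_extend :: "('k, 'b) module \<Rightarrow> ('x \<Rightarrow> 'b) \<Rightarrow> ('x \<Rightarrow> 'k) \<Rightarrow> 'b"
  where "free_extend N h f = (\<Oplus>\<^bsub>N\<^esub>x\<in>{x. f x \<noteq> \<zero>}. f x \<odot>\<^bsub>N\<^esub> h x)"

text \<open>The support of a sum depends on cancellation. Letting the sum run over any finite set
  around the support gives two functions a common index set; the extra terms have coefficient
  zero.\<close>

lemma free_extend_superset:
  assumes N: "module K N" and h: "\<And>x. x \<in> S \<Longrightarrow> h x \<in> carrier N"
    and f: "f \<in> carrier (free_module K S)" and A: "finite A" "{x. f x \<noteq> \<zero>} \<subseteq> A" "A \<subseteq> S"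
  shows "free_extend N h f = (\<Oplus>\<^bsub>N\<^esub>x\<in>A. f x \<odot>\<^bsub>N\<^esub> h x)"
proof -
  interpret N: module K N by fact
  have cl: "f x \<in> carrier K" for x using f by (auto simp: free_module_carrier)
  have "(\<Oplus>\<^bsub>N\<^esub>x\<in>A. f x \<odot>\<^bsub>N\<^esub> h x) = (\<Oplus>\<^bsub>N\<^esub>x\<in>{x. f x \<noteq> \<zero>}. f x \<odot>\<^bsub>N\<^esub> h x)"
    by (rule N.M.add.finprod_mono_neutral_cong_right) (use A cl h in \<open>auto simp: Pi_def\<close>)
  then show ?thesis by (simp add: free_extend_def)
qed

lemma free_extend_linear:
  fixes S :: "'x set"
  assumes N: "module K N" and h: "\<And>x. x \<in> S \<Longrightarrow> h x \<in> carrier N"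
  shows "linear_map K (free_module K S) N (free_extend N h)"
proof (rule linear_mapI)
  interpret N: module K N by fact
  let ?F = "free_module K S"
  interpret F: module K ?F by (rule free_module_module)
  let ?s = "\<lambda>f::'x \<Rightarrow> 'k. {x. f x \<noteq> \<zero>}"
  have fin: "finite (?s f)" "?s f \<subseteq> S" and cl: "f x \<in> carrier K" if "f \<in> carrier ?F" for f x
    using that by (auto simp: free_module_carrier)
  show "free_extend N h f \<in> carrier N" if f: "f \<in> carrier ?F" for f
    unfolding free_extend_def
    by (rule N.M.finsum_closed) (use fin[OF f] cl[OF f] h in \<open>auto simp: Pi_def\<close>)
  show "free_extend N h (f \<oplus>\<^bsub>?F\<^esub> g) = free_extend N h f \<oplus>\<^bsub>N\<^esub> free_extend N h g"
    if f: "f \<in> carrier ?F" and g: "g \<in> carrier ?F" for f g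
  proof -
    have fg: "f \<oplus>\<^bsub>?F\<^esub> g \<in> carrier ?F" using f g by (rule F.M.a_closed)
    let ?A = "?s f \<union> ?s g"
    have A: "finite ?A" "?A \<subseteq> S" using fin[OF f] fin[OF g] by auto
    have *: "free_extend N h q = (\<Oplus>\<^bsub>N\<^esub>x\<in>?A. q x \<odot>\<^bsub>N\<^esub> h x)"
      if "q \<in> carrier ?F" "?s q \<subseteq> ?A" for q
      by (rule free_extend_superset[OF N h that(1) A(1) that(2) A(2)])
    have hA: "h x \<in> carrier N" if "x \<in> ?A" for x using h A(2) that by auto
    have "free_extend N h (f \<oplus>\<^bsub>?F\<^esub> g) = (\<Oplus>\<^bsub>N\<^esub>x\<in>?A. (f \<oplus>\<^bsub>?F\<^esub> g) x \<odot>\<^bsub>N\<^esub> h x)"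
      by (rule *[OF fg]) auto
    also have "\<dots> = (\<Oplus>\<^bsub>N\<^esub>x\<in>?A. f x \<odot>\<^bsub>N\<^esub> h x \<oplus>\<^bsub>N\<^esub> g x \<odot>\<^bsub>N\<^esub> h x)"
      by (rule N.M.finsum_cong') (use hA cl[OF f] cl[OF g] in \<open>auto simp: Pi_def N.smult_l_distr\<close>)
    also have "\<dots> = (\<Oplus>\<^bsub>N\<^esub>x\<in>?A. f x \<odot>\<^bsub>N\<^esub> h x) \<oplus>\<^bsub>N\<^esub> (\<Oplus>\<^bsub>N\<^esub>x\<in>?A. g x \<odot>\<^bsub>N\<^esub> h x)"
      by (rule N.M.finsum_addf) (use hA cl[OF f] cl[OF g] in \<open>auto simp: Pi_def\<close>)
    also have "\<dots> = free_extend N h f \<oplus>\<^bsub>N\<^esub> free_extend N h g"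
      using *[OF f] *[OF g] by auto
    finally show ?thesis .
  qed
  show "free_extend N h (c \<odot>\<^bsub>?F\<^esub> f) = c \<odot>\<^bsub>N\<^esub> free_extend N h f"
    if c: "c \<in> carrier K" and f: "f \<in> carrier ?F" for c f
  proof -
    have cf: "c \<odot>\<^bsub>?F\<^esub> f \<in> carrier ?F" using c f by (rule F.smult_closed)
    have hA: "h x \<in> carrier N" if "x \<in> ?s f" for x using h fin[OF f] that by auto
    have "free_extend N h (c \<odot>\<^bsub>?F\<^esub> f) = (\<Oplus>\<^bsub>N\<^esub>x\<in>?s f. (c \<odot>\<^bsub>?F\<^esub> f) x \<odot>\<^bsub>N\<^esub> h x)"
      by (rule free_extend_superset[OF N h cf fin(1)[OF f] _ fin(2)[OF f]]) (use c in auto)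
    also have "\<dots> = (\<Oplus>\<^bsub>N\<^esub>x\<in>?s f. c \<odot>\<^bsub>N\<^esub> (f x \<odot>\<^bsub>N\<^esub> h x))"
      by (rule N.M.finsum_cong') (use hA cl[OF f] c in \<open>auto simp: Pi_def N.smult_assoc1\<close>)
    also have "\<dots> = c \<odot>\<^bsub>N\<^esub> free_extend N h f"
      unfolding free_extend_def
      by (rule N.finsum_smult_ldistr[symmetric]) (use fin[OF f] c hA cl[OF f] in \<open>auto simp: Pi_def\<close>)
    finally show ?thesis .
  qed
qed

lemma free_extend_gen:
  assumes N: "module K N" and h: "h x \<in> carrier N"
  shows "free_extend N h (free_gen K x) = h x"
\<comment> \<open>If \<open>\<one> = \<zero>\<close>, the generator is the zero function and the sum
  is empty, but then every element of \<open>N\<close> is zero as well.\<close>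
proof (cases "\<one> = \<zero>")
  case True
  interpret N: module K N by fact
  have "h x = \<zero>\<^bsub>N\<^esub>" using N.smult_one[OF h] N.smult_l_null[OF h] True by simp
  with True show ?thesis by (simp add: free_extend_def free_gen_def)
next
  case False
  interpret N: module K N by fact
  have "{y. free_gen K x y \<noteq> \<zero>} = {x}" using False by (auto simp: free_gen_def)
  then show ?thesis using h
    by (simp add: free_extend_def) (simp add: free_gen_def)
qed

section \<open>Spans of submodules and the universal property of quotients\<close>

section \<open>Quotient modules\<close>

text \<open>The containment of \<open>S\<close> in the carrier makes \<open>carrier F\<close> a
  member of the family that is intersected, which keeps the intersection inside the carrier.\<close>

lemma submodule_span_submodule:
  assumes F: "module K F" and S: "S \<subseteq> carrier F"
  shows "submodule (submodule_span K F S) K F"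
proof -
  interpret F: module K F by fact
  let ?H = "{H. submodule H K F \<and> S \<subseteq> H}"
  note E = F.submoduleE
  show ?thesis unfolding submodule_span_def
  proof (rule F.submoduleI)
    show "\<Inter> ?H \<subseteq> carrier F" using F.carrier_is_submodule S by auto
    show "\<zero>\<^bsub>F\<^esub> \<in> \<Inter> ?H"
      by (auto simp: submodule_def dest: subgroup.one_closed)
  qed (auto dest: E)
qed

lemma submodule_span_subset: "S \<subseteq> submodule_span K F S"
  by (auto simp: submodule_span_def)

lemma submodule_span_least: "submodule H K F \<Longrightarrow> S \<subseteq> H \<Longrightarrow> submodule_span K F S \<subseteq> H"
  by (auto simp: submodule_span_def)

text \<open>A span is the least submodule around its generators, so a linear map that kills the
  generators kills the span. The kernel is the submodule to which this minimality is
  applied.\<close>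

lemma submodule_kernel:
  assumes F: "module K F" and N: "module K N" and f: "linear_map K F N f"
  shows "submodule {x \<in> carrier F. f x = \<zero>\<^bsub>N\<^esub>} K F"
proof -
  interpret F: module K F by fact
  interpret N: module K N by fact
  show ?thesis
  proof (rule F.submoduleI)
    fix a assume a: "a \<in> {x \<in> carrier F. f x = \<zero>\<^bsub>N\<^esub>}"
    then have "f (\<zero>\<^bsub>F\<^esub> \<ominus>\<^bsub>F\<^esub> a) = \<zero>\<^bsub>N\<^esub> \<ominus>\<^bsub>N\<^esub> \<zero>\<^bsub>N\<^esub>"
      using linear_map_minus[OF F N f] linear_map_zero[OF F N f] by simp
    then show "\<ominus>\<^bsub>F\<^esub> a \<in> {x \<in> carrier F. f x = \<zero>\<^bsub>N\<^esub>}"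
      using a by (simp add: a_minus_def)
  qed (auto simp: linear_map_add[OF f] linear_map_smult[OF f] linear_map_zero[OF F N f])
qed

lemma submodule_abelian_subgroup:
  assumes F: "module K F" and H: "submodule H K F"
  shows "abelian_subgroup H F"
  using assms abelian_subgroupI3[of H F] additive_subgroupI[of H F]
  by (simp add: module_def submodule_def)

lemma quot_module_sel:
  assumes F: "module K F" and H: "submodule H K F"
  shows "carrier (quot_module F H) = (\<lambda>x. H +>\<^bsub>F\<^esub> x) ` carrier F"
    and "\<And>x y. x \<in> carrier F \<Longrightarrow> y \<in> carrier F \<Longrightarrow>
      (H +>\<^bsub>F\<^esub> x) \<oplus>\<^bsub>quot_module F H\<^esub> (H +>\<^bsub>F\<^esub> y) = H +>\<^bsub>F\<^esub> (x \<oplus>\<^bsub>F\<^esub> y)"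
    and "\<And>c x. c \<in> carrier K \<Longrightarrow> x \<in> carrier F \<Longrightarrow>
      c \<odot>\<^bsub>quot_module F H\<^esub> (H +>\<^bsub>F\<^esub> x) = H +>\<^bsub>F\<^esub> (c \<odot>\<^bsub>F\<^esub> x)"
    and "\<zero>\<^bsub>quot_module F H\<^esub> = H +>\<^bsub>F\<^esub> \<zero>\<^bsub>F\<^esub>"
proof -
  interpret F: module K F by fact
  interpret H: abelian_subgroup H F by (rule submodule_abelian_subgroup[OF F H])
  show "carrier (quot_module F H) = (\<lambda>x. H +>\<^bsub>F\<^esub> x) ` carrier F"
    by (auto simp: quot_module_def A_RCOSETS_def')
  show "(H +>\<^bsub>F\<^esub> x) \<oplus>\<^bsub>quot_module F H\<^esub> (H +>\<^bsub>F\<^esub> y) = H +>\<^bsub>F\<^esub> (x \<oplus>\<^bsub>F\<^esub> y)"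
    if "x \<in> carrier F" "y \<in> carrier F" for x y
    using that by (simp add: quot_module_def H.a_rcos_sum)
  show "\<zero>\<^bsub>quot_module F H\<^esub> = H +>\<^bsub>F\<^esub> \<zero>\<^bsub>F\<^esub>"
    by (simp add: quot_module_def H.a_subset)
  show "c \<odot>\<^bsub>quot_module F H\<^esub> (H +>\<^bsub>F\<^esub> x) = H +>\<^bsub>F\<^esub> (c \<odot>\<^bsub>F\<^esub> x)"
    if c: "c \<in> carrier K" and x: "x \<in> carrier F" for c x
  proof -
    \<comment> \<open>Two representatives differ by some \<open>h\<close> in \<open>H\<close>, and
      their multiples by the multiple of \<open>h\<close>, which stays in \<open>H\<close>. So the
      union that defines scaling is taken over one repeated coset.\<close>
    have *: "H +>\<^bsub>F\<^esub> (c \<odot>\<^bsub>F\<^esub> y) = H +>\<^bsub>F\<^esub> (c \<odot>\<^bsub>F\<^esub> x)" if y: "y \<in> H +>\<^bsub>F\<^esub> x" for y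
    proof -
      obtain h where h: "h \<in> H" "y = h \<oplus>\<^bsub>F\<^esub> x" using y by (auto simp: a_r_coset_def')
      then have hF: "h \<in> carrier F" using H.a_subset by auto
      have "c \<odot>\<^bsub>F\<^esub> h \<in> H" using F.submoduleE(4)[OF H c h(1)] .
      moreover have "c \<odot>\<^bsub>F\<^esub> y = c \<odot>\<^bsub>F\<^esub> h \<oplus>\<^bsub>F\<^esub> c \<odot>\<^bsub>F\<^esub> x"
        using h hF c x by (simp add: F.smult_r_distr)
      ultimately have "c \<odot>\<^bsub>F\<^esub> y \<in> H +>\<^bsub>F\<^esub> (c \<odot>\<^bsub>F\<^esub> x)" by (auto simp: a_r_coset_def')
      then show ?thesis
        using F.a_repr_independence[OF _ _ H.a_subgroup] c x by auto
    qed
    have "(\<Union>y\<in>H +>\<^bsub>F\<^esub> x. H +>\<^bsub>F\<^esub> (c \<odot>\<^bsub>F\<^esub> y))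
        = (\<Union>y\<in>H +>\<^bsub>F\<^esub> x. H +>\<^bsub>F\<^esub> (c \<odot>\<^bsub>F\<^esub> x))"
      by (rule SUP_cong[OF refl *])
    \<comment> \<open>A union over a constant family equals its member only if the index set is
      non-empty.\<close>
    moreover have "H +>\<^bsub>F\<^esub> x \<noteq> {}" using H.a_rcos_self[OF x] by blast
    ultimately show ?thesis
      by (simp add: quot_module_def)
  qed
qed

lemma quot_module_module:
  assumes F: "module K F" and H: "submodule H K F"
  shows "module K (quot_module F H)"
proof (rule moduleI)
  interpret F: module K F by fact
  note [simp] = quot_module_sel[OF F H]
  show "cring K" by (rule is_cring)
  show "abelian_group (quot_module F H)"
  proof (rule abelian_groupI)
    fix X assume "X \<in> carrier (quot_module F H)"
    then obtain x where "x \<in> carrier F" "X = H +>\<^bsub>F\<^esub> x" by auto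
    then show "\<exists>Y\<in>carrier (quot_module F H). Y \<oplus>\<^bsub>quot_module F H\<^esub> X = \<zero>\<^bsub>quot_module F H\<^esub>"
      by (auto simp: F.M.l_neg intro!: bexI[of _ "\<ominus>\<^bsub>F\<^esub> x"])
  qed (auto simp: F.M.a_ac)
qed (auto simp: quot_module_sel[OF F H]
    module.smult_closed[OF F] module_add_closed[OF F] module.smult_l_distr[OF F]
    module.smult_r_distr[OF F] module.smult_assoc1[OF F] module.smult_one[OF F])

lemma quot_module_eqI:
  assumes F: "module K F" and H: "submodule H K F" and "x \<in> carrier F" "y \<in> carrier F"
    and "x \<ominus>\<^bsub>F\<^esub> y \<in> H"
  shows "H +>\<^bsub>F\<^esub> x = H +>\<^bsub>F\<^esub> y"
proof -
  interpret F: module K F by fact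
  interpret H: abelian_subgroup H F by (rule submodule_abelian_subgroup[OF F H])
  have "x = (x \<ominus>\<^bsub>F\<^esub> y) \<oplus>\<^bsub>F\<^esub> y" using assms by (simp add: a_minus_def F.M.a_assoc F.M.l_neg)
  then have "x \<in> H +>\<^bsub>F\<^esub> y" using assms(5) by (auto simp: a_r_coset_def')
  then show ?thesis using F.a_repr_independence[OF _ assms(4) H.a_subgroup] by auto
qed

lemma quot_module_lift:
  assumes F: "module K F" and H: "submodule H K F" and N: "module K N"
    and f: "linear_map K F N f" and 0: "\<And>x. x \<in> H \<Longrightarrow> f x = \<zero>\<^bsub>N\<^esub>"
  obtains g where "linear_map K (quot_module F H) N g"
    and "\<And>x. x \<in> carrier F \<Longrightarrow> g (H +>\<^bsub>F\<^esub> x) = f x"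
proof -
  interpret F: module K F by fact
  interpret N: module K N by fact
  interpret H: abelian_subgroup H F by (rule submodule_abelian_subgroup[OF F H])
  \<comment> \<open>A representative is picked by choice. Any other differs from it by an element of
    \<open>H\<close>, which \<open>f\<close> sends to zero, so the value does not depend on the
    choice.\<close>
  define g where "g X = f (SOME x. x \<in> X)" for X
  have g: "g (H +>\<^bsub>F\<^esub> x) = f x" if x: "x \<in> carrier F" for x
  proof -
    have "x \<in> H +>\<^bsub>F\<^esub> x" using H.a_rcos_self[OF x] .
    then have "(SOME y. y \<in> H +>\<^bsub>F\<^esub> x) \<in> H +>\<^bsub>F\<^esub> x" by (rule someI)
    then obtain h where h: "h \<in> H" "(SOME y. y \<in> H +>\<^bsub>F\<^esub> x) = h \<oplus>\<^bsub>F\<^esub> x" by (auto simp: a_r_coset_def')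
    then have "h \<in> carrier F" using H.a_subset by auto
    then show ?thesis using h x 0[OF h(1)] linear_map_closed[OF f x]
      by (simp add: g_def linear_map_add[OF f])
  qed
  note [simp] = quot_module_sel[OF F H]
  have "linear_map K (quot_module F H) N g"
    by (rule linear_mapI)
      (auto simp: g linear_map_closed[OF f] linear_map_add[OF f] linear_map_smult[OF f])
  with g show thesis by (rule that[rotated])
qed

end

section \<open>Multilinear maps and the universal property of tensor products\<close>

section \<open>Tensor products\<close>

lemma tuples_length: "xs \<in> tuples Ms \<Longrightarrow> length xs = length Ms"
  by (auto simp: tuples_def dest: list_all2_lengthD)

lemma tuples_update: "xs \<in> tuples Ms \<Longrightarrow> a \<in> carrier (Ms ! i) \<Longrightarrow> xs[i := a] \<in> tuples Ms"
  by (cases "i < length xs") (auto simp: tuples_def list_all2_conv_all_nth nth_list_update list_update_beyond)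

lemma tuples_Nil [simp]: "tuples [] = {[]}"
  by (auto simp: tuples_def)

lemma tuples_Cons_iff [simp]: "x # xs \<in> tuples (M # Ms) \<longleftrightarrow> x \<in> carrier M \<and> xs \<in> tuples Ms"
  by (simp add: tuples_def)

lemma tuples_append: "xs \<in> tuples Ms \<Longrightarrow> ys \<in> tuples Ns \<Longrightarrow> xs @ ys \<in> tuples (Ms @ Ns)"
  by (auto simp: tuples_def intro: list_all2_appendI)

lemma tuples_appendE:
  assumes "zs \<in> tuples (Ms @ Ns)"
  obtains xs ys where "zs = xs @ ys" "xs \<in> tuples Ms" "ys \<in> tuples Ns"
  using assms by (auto simp: tuples_def list_all2_append2)

lemma tuples_singleE:
  assumes "zs \<in> tuples [M]"
  obtains x where "zs = [x]" "x \<in> carrier M"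
  using assms by (cases zs) (auto simp: tuples_def)

lemma tuples_single: "tuples [M] = (\<lambda>x. [x]) ` carrier M"
  by (auto elim: tuples_singleE)

lemma tuples_pairE:
  assumes "zs \<in> tuples [M, N]"
  obtains x y where "zs = [x, y]" "x \<in> carrier M" "y \<in> carrier N"
  using assms by (auto simp: tuples_def list_all2_Cons2)

lemma tuples_tripleE:
  assumes "zs \<in> tuples [M, N, P]"
  obtains x y z where "zs = [x, y, z]" "x \<in> carrier M" "y \<in> carrier N" "z \<in> carrier P"
  using assms by (auto simp: tuples_def list_all2_Cons2)

context scalar_ring
begin

abbreviation modules :: "('k, 'a) module list \<Rightarrow> bool"
  where "modules \<equiv> list_all (module K)"

abbreviation tensors :: "('k, 'a) module list \<Rightarrow> ('a list \<Rightarrow> 'k) set set"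
  where "tensors Ms \<equiv> carrier (tensor K Ms)"

abbreviation tlinear
  where "tlinear Ms Ns \<equiv> linear_map K (tensor K Ms) (tensor K Ns)"

text \<open>Linearity in slot \<open>i\<close> is expressed by overwriting entry \<open>i\<close> of
  a complete tuple. The old entry is a mere placeholder, which is why later instances put a zero
  vector into the slot that varies. For the empty list only membership in \<open>N\<close>
  remains.\<close>

definition multilinear :: "('k, 'a) module list \<Rightarrow> ('k, 'b) module \<Rightarrow> ('a list \<Rightarrow> 'b) \<Rightarrow> bool"
  where "multilinear Ms N f \<longleftrightarrow>
    (\<forall>xs\<in>tuples Ms. f xs \<in> carrier N \<and>
      (\<forall>i<length Ms. linear_map K (Ms ! i) N (\<lambda>a. f (xs[i := a]))))"

lemma multilinear_closed: "multilinear Ms N f \<Longrightarrow> xs \<in> tuples Ms \<Longrightarrow> f xs \<in> carrier N"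
  by (simp add: multilinear_def)

lemma multilinear_linear:
  "multilinear Ms N f \<Longrightarrow> xs \<in> tuples Ms \<Longrightarrow> i < length Ms \<Longrightarrow>
    linear_map K (Ms ! i) N (\<lambda>a. f (xs[i := a]))"
  by (simp add: multilinear_def)

lemma multilinear_compose:
  assumes f: "multilinear Ms N f" and g: "linear_map K N P g"
  shows "multilinear Ms P (\<lambda>xs. g (f xs))"
  unfolding multilinear_def
  using linear_map_closed[OF g multilinear_closed[OF f]] linear_map_compose[OF multilinear_linear[OF f] g]
  by simp

text \<open>Maps that cut a list by \<open>take\<close> and \<open>drop\<close> follow their
  intended formula only on tuples of the right length. Multilinearity is proved for the formula and
  transferred by this lemma.\<close>

lemma multilinear_cong:
  assumes Ms: "modules Ms" and eq: "\<And>xs. xs \<in> tuples Ms \<Longrightarrow> f xs = g xs"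
    and f: "multilinear Ms N f"
  shows "multilinear Ms N g"
proof -
  have "linear_map K (Ms ! i) N (\<lambda>a. g (xs[i := a]))" if "xs \<in> tuples Ms" "i < length Ms" for xs i
  proof (rule linear_map_cong)
    show "module K (Ms ! i)" using Ms that by (simp add: list_all_length)
    show "linear_map K (Ms ! i) N (\<lambda>a. f (xs[i := a]))" using multilinear_linear[OF f that] .
    show "f (xs[i := a]) = g (xs[i := a])" if "a \<in> carrier (Ms ! i)" for a
      using eq[OF tuples_update[OF _ that]] \<open>xs \<in> tuples Ms\<close> by blast
  qed
  then show ?thesis
    using multilinear_closed[OF f] eq unfolding multilinear_def by auto
qed

lemma multilinear_Nil: "f [] \<in> carrier N \<Longrightarrow> multilinear [] N f"
  by (auto simp: multilinear_def)

lemma multilinear_single: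
  assumes "linear_map K M N (\<lambda>x. f [x])"
  shows "multilinear [M] N f"
  using linear_map_closed[OF assms] assms by (simp add: multilinear_def tuples_single)

text \<open>A position of the concatenated list lies in one of the two parts, and updating it leaves
  the other part fixed.\<close>

lemma multilinear_append:
  assumes 1: "\<And>ys. ys \<in> tuples Ns \<Longrightarrow> multilinear Ms N (\<lambda>xs. f (xs @ ys))"
    and 2: "\<And>xs. xs \<in> tuples Ms \<Longrightarrow> multilinear Ns N (\<lambda>ys. f (xs @ ys))"
  shows "multilinear (Ms @ Ns) N f"
  unfolding multilinear_def
proof (intro ballI conjI allI impI)
  fix zs assume "zs \<in> tuples (Ms @ Ns)"
  then obtain xs ys where zs: "zs = xs @ ys" "xs \<in> tuples Ms" "ys \<in> tuples Ns"
    by (rule tuples_appendE)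
  show "f zs \<in> carrier N" using multilinear_closed[OF 1] zs by simp
  fix i assume i: "i < length (Ms @ Ns)"
  show "linear_map K ((Ms @ Ns) ! i) N (\<lambda>a. f (zs[i := a]))"
  proof (cases "i < length Ms")
    case True
    then show ?thesis
      using multilinear_linear[OF 1[OF zs(3)] zs(2) True] zs tuples_length[OF zs(2)]
      by (simp add: list_update_append nth_append)
  next
    case False
    then have j: "i - length Ms < length Ns" using i by simp
    show ?thesis
      using multilinear_linear[OF 2[OF zs(2)] zs(3) j] zs False tuples_length[OF zs(2)]
      by (simp add: list_update_append nth_append)
  qed
qed

lemma multilinear_pair:
  assumes 1: "\<And>y. y \<in> carrier Q \<Longrightarrow> linear_map K P N (\<lambda>x. f [x, y])"
    and 2: "\<And>x. x \<in> carrier P \<Longrightarrow> linear_map K Q N (\<lambda>y. f [x, y])"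
  shows "multilinear [P, Q] N f"
proof -
  have "multilinear ([P] @ [Q]) N f"
    by (rule multilinear_append) (auto simp: tuples_single intro!: multilinear_single 1 2)
  then show ?thesis by simp
qed

lemma tensor_relations_subset:
  assumes "modules Ms"
  shows "tensor_relations K Ms \<subseteq> carrier (free_module K (tuples Ms))"
proof -
  interpret F: module K "free_module K (tuples Ms)" by (rule free_module_module)
  note g = free_gen_closed[OF tuples_update]
  have m: "module K (Ms ! i)" if "i < length Ms" for i
    using assms that by (simp add: list_all_length)
  show ?thesis
    unfolding tensor_relations_def Let_def
    by (auto intro!: F.M.minus_closed F.M.a_closed F.smult_closed g
        module_add_closed[OF m] module_smult_closed[OF m] simp del: free_module_sel)
qed

abbreviation rel_span :: "('k, 'a) module list \<Rightarrow> ('a list \<Rightarrow> 'k) set"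
  where "rel_span Ms \<equiv> submodule_span K (free_module K (tuples Ms)) (tensor_relations K Ms)"

lemma rel_span_submodule:
  "modules Ms \<Longrightarrow> submodule (rel_span Ms) K (free_module K (tuples Ms))"
  by (rule submodule_span_submodule[OF free_module_module tensor_relations_subset])

lemma tensor_module: "modules Ms \<Longrightarrow> module K (tensor K Ms)"
  unfolding tensor_def Let_def
  by (rule quot_module_module[OF free_module_module rel_span_submodule])

lemma tensor_sel:
  assumes Ms: "modules Ms"
  shows "tensors Ms
      = (\<lambda>x. rel_span Ms +>\<^bsub>free_module K (tuples Ms)\<^esub> x) ` carrier (free_module K (tuples Ms))"
  unfolding tensor_def Let_def using quot_module_sel(1)[OF free_module_module rel_span_submodule[OF Ms]] .

lemma tensor_class_linear:
  assumes Ms: "modules Ms"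
  shows "linear_map K (free_module K (tuples Ms)) (tensor K Ms)
    (\<lambda>x. rel_span Ms +>\<^bsub>free_module K (tuples Ms)\<^esub> x)"
proof -
  note q = quot_module_sel[OF free_module_module rel_span_submodule[OF Ms]]
  show ?thesis
    unfolding tensor_def Let_def
    by (rule linear_mapI) (auto simp only: q)
qed

lemma pure_eq: "pure K Ms xs = rel_span Ms +>\<^bsub>free_module K (tuples Ms)\<^esub> free_gen K xs"
  by (simp add: pure_def Let_def)

lemma pure_closed:
  "modules Ms \<Longrightarrow> xs \<in> tuples Ms \<Longrightarrow> pure K Ms xs \<in> tensors Ms"
  unfolding pure_eq by (rule linear_map_closed[OF tensor_class_linear free_gen_closed])

text \<open>The generators of \<open>rel_span Ms\<close> are exactly the failures of
  \<open>free_gen\<close> to be additive and homogeneous in one slot, so the two sides have the same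
  coset.\<close>

lemma pure_multilinear:
  assumes Ms: "modules Ms"
  shows "multilinear Ms (tensor K Ms) (pure K Ms)"
  unfolding multilinear_def
proof (intro ballI conjI allI impI)
  fix xs assume xs: "xs \<in> tuples Ms"
  then show "pure K Ms xs \<in> tensors Ms" using pure_closed[OF Ms] by blast
  fix i assume i: "i < length Ms"
  let ?F = "free_module K (tuples Ms)"
  interpret F: module K ?F by (rule free_module_module)
  have m: "module K (Ms ! i)" using Ms i by (simp add: list_all_length)
  note L = tensor_class_linear[OF Ms]
  note gen = free_gen_closed[OF tuples_update[OF xs], of _ i]
  note eqI = quot_module_eqI[OF free_module_module rel_span_submodule[OF Ms]]
  show "linear_map K (Ms ! i) (tensor K Ms) (\<lambda>a. pure K Ms (xs[i := a]))"
  proof (rule linear_mapI)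
    fix a assume a: "a \<in> carrier (Ms ! i)"
    show "pure K Ms (xs[i := a]) \<in> tensors Ms"
      using pure_closed[OF Ms tuples_update[OF xs a]] .
    fix b assume b: "b \<in> carrier (Ms ! i)"
    have "free_gen K (xs[i := a \<oplus>\<^bsub>Ms!i\<^esub> b]) \<ominus>\<^bsub>?F\<^esub>
        (free_gen K (xs[i := a]) \<oplus>\<^bsub>?F\<^esub> free_gen K (xs[i := b])) \<in> rel_span Ms"
      by (rule subsetD[OF submodule_span_subset])
        (use xs i a b in \<open>simp only: tensor_relations_def Let_def, blast\<close>)
    then show "pure K Ms (xs[i := a \<oplus>\<^bsub>Ms ! i\<^esub> b])
        = pure K Ms (xs[i := a]) \<oplus>\<^bsub>tensor K Ms\<^esub> pure K Ms (xs[i := b])"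
      unfolding pure_eq linear_map_add[OF L gen[OF a] gen[OF b], symmetric]
      by (rule eqI[OF gen[OF module_add_closed[OF m a b]] F.M.a_closed[OF gen[OF a] gen[OF b]]])
  next
    fix c a assume c: "c \<in> carrier K" and a: "a \<in> carrier (Ms ! i)"
    have "free_gen K (xs[i := c \<odot>\<^bsub>Ms!i\<^esub> a]) \<ominus>\<^bsub>?F\<^esub>
        (c \<odot>\<^bsub>?F\<^esub> free_gen K (xs[i := a])) \<in> rel_span Ms"
      by (rule subsetD[OF submodule_span_subset])
        (use xs i a c in \<open>simp only: tensor_relations_def Let_def, blast\<close>)
    then show "pure K Ms (xs[i := c \<odot>\<^bsub>Ms ! i\<^esub> a]) = c \<odot>\<^bsub>tensor K Ms\<^esub> pure K Ms (xs[i := a])"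
      unfolding pure_eq linear_map_smult[OF L c gen[OF a], symmetric]
      by (rule eqI[OF gen[OF module_smult_closed[OF m c a]] F.smult_closed[OF c gen[OF a]]])
  qed
qed

text \<open>Pulled back to the free module, both maps are determined by their values on generators.
  This is the uniqueness half of the universal property, and most later equations between linear
  maps are checked by it, one argument after another.\<close>

lemma tensor_eqI:
  assumes Ms: "modules Ms" and N: "module K N"
    and f: "linear_map K (tensor K Ms) N f" and g: "linear_map K (tensor K Ms) N g"
    and eq: "\<And>xs. xs \<in> tuples Ms \<Longrightarrow> f (pure K Ms xs) = g (pure K Ms xs)"
    and t: "t \<in> tensors Ms"
  shows "f t = g t"
proof -
  let ?F = "free_module K (tuples Ms)"
  let ?q = "\<lambda>x. rel_span Ms +>\<^bsub>?F\<^esub> x"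
  note L = tensor_class_linear[OF Ms]
  note F = free_module_module[of "tuples Ms"]
  obtain x where x: "x \<in> carrier ?F" "t = ?q x" using t unfolding tensor_sel[OF Ms] by auto
  from x(1) have "f (?q x) = g (?q x)"
  proof (induction rule: free_module_induct)
    case zero
    show ?case
      using linear_map_zero[OF F N linear_map_compose[OF L f]]
        linear_map_zero[OF F N linear_map_compose[OF L g]] by simp
  next
    case (add y c xs)
    note gen = free_gen_closed[OF add(3)]
    have cg: "c \<odot>\<^bsub>?F\<^esub> free_gen K xs \<in> carrier ?F"
      by (rule module_smult_closed[OF F add(2) gen])
    have e: "f (?q (free_gen K xs)) = g (?q (free_gen K xs))"
      using eq[OF add(3)] unfolding pure_eq .
    show ?case
      unfolding linear_map_add[OF linear_map_compose[OF L f] add(1) cg]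
        linear_map_add[OF linear_map_compose[OF L g] add(1) cg]
        linear_map_smult[OF linear_map_compose[OF L f] add(2) gen]
        linear_map_smult[OF linear_map_compose[OF L g] add(2) gen]
      using add(4) e by simp
  qed
  then show ?thesis using x by simp
qed

text \<open>The existence half: the linear extension of \<open>h\<close> to the free module kills
  every relation because \<open>h\<close> is multilinear, hence kills their span and descends to the
  quotient.\<close>

lemma tensor_lift_exists:
  assumes Ms: "modules Ms" and N: "module K N" and h: "multilinear Ms N h"
  obtains g where "linear_map K (tensor K Ms) N g"
    and "\<And>xs. xs \<in> tuples Ms \<Longrightarrow> g (pure K Ms xs) = h xs"
proof -
  let ?F = "free_module K (tuples Ms)"
  interpret N: module K N by (rule N)
  interpret F: module K ?F by (rule free_module_module)
  note F = free_module_module[of "tuples Ms"]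
  note hc = multilinear_closed[OF h]
  define e where "e = free_extend N h"
  have el: "linear_map K ?F N e" unfolding e_def by (rule free_extend_linear[OF N hc])
  have eg: "e (free_gen K xs) = h xs" if "xs \<in> tuples Ms" for xs
    unfolding e_def by (rule free_extend_gen[of N h, OF N hc[OF that]])
  have rel: "e r = \<zero>\<^bsub>N\<^esub>" if r: "r \<in> tensor_relations K Ms" for r
  proof -
    consider (add) xs i a b where "xs \<in> tuples Ms" "i < length Ms" "a \<in> carrier (Ms!i)" "b \<in> carrier (Ms!i)"
        "r = free_gen K (xs[i := a \<oplus>\<^bsub>Ms!i\<^esub> b]) \<ominus>\<^bsub>?F\<^esub>
          (free_gen K (xs[i := a]) \<oplus>\<^bsub>?F\<^esub> free_gen K (xs[i := b]))"
      | (smult) xs i c a where "xs \<in> tuples Ms" "i < length Ms" "c \<in> carrier K" "a \<in> carrier (Ms!i)"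
        "r = free_gen K (xs[i := c \<odot>\<^bsub>Ms!i\<^esub> a]) \<ominus>\<^bsub>?F\<^esub> (c \<odot>\<^bsub>?F\<^esub> free_gen K (xs[i := a]))"
      using r unfolding tensor_relations_def Let_def by blast
    then show ?thesis
    proof cases
      case add
      have m: "module K (Ms ! i)" using Ms add by (simp add: list_all_length)
      note up = tuples_update[OF add(1), of _ i]
      note u = up[OF add(3)] up[OF add(4)] up[OF module_add_closed[OF m add(3,4)]]
      note g = u[THEN free_gen_closed]
      show ?thesis
        unfolding add(5) linear_map_minus[OF F N el g(3) F.M.a_closed[OF g(1,2)]]
          linear_map_add[OF el g(1,2)] eg[OF u(1)] eg[OF u(2)] eg[OF u(3)]
        using linear_map_add[OF multilinear_linear[OF h add(1,2)] add(3,4)] hc[OF u(1)] hc[OF u(2)]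
        by (simp add: a_minus_def N.M.r_neg)
    next
      case smult
      have m: "module K (Ms ! i)" using Ms smult by (simp add: list_all_length)
      note up = tuples_update[OF smult(1), of _ i]
      note u = up[OF smult(4)] up[OF module_smult_closed[OF m smult(3,4)]]
      note g = u[THEN free_gen_closed]
      show ?thesis
        unfolding smult(5) linear_map_minus[OF F N el g(2) F.smult_closed[OF smult(3) g(1)]]
          linear_map_smult[OF el smult(3) g(1)] eg[OF u(1)] eg[OF u(2)]
        using linear_map_smult[OF multilinear_linear[OF h smult(1,2)] smult(3,4)] hc[OF u(1)] smult(3)
        by (simp add: a_minus_def N.M.r_neg)
    qed
  qed
  have "rel_span Ms \<subseteq> {x \<in> carrier ?F. e x = \<zero>\<^bsub>N\<^esub>}"
    by (rule submodule_span_least[OF submodule_kernel[OF F N el]])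
      (use rel tensor_relations_subset[OF Ms] in auto)
  then have "e x = \<zero>\<^bsub>N\<^esub>" if "x \<in> rel_span Ms" for x using that by auto
  from quot_module_lift[OF F rel_span_submodule[OF Ms] N el this]
  obtain g where g: "linear_map K (tensor K Ms) N g"
    and ge: "\<And>x. x \<in> carrier ?F \<Longrightarrow> g (rel_span Ms +>\<^bsub>?F\<^esub> x) = e x"
    unfolding tensor_def Let_def by blast
  show thesis
    by (rule that[OF g]) (simp add: pure_eq ge free_gen_closed eg)
qed

text \<open>Linearity and the values on pure tensors determine a map only on the carrier;
  extensionality fixes it elsewhere. So the definite description in \<open>lift\<close> has exactly
  one solution as a function.\<close>

lemma lift_properties:
  assumes Ms: "modules Ms" and N: "module K N" and h: "multilinear Ms N h"
  shows lift_extensional: "lift K Ms N h \<in> extensional (tensors Ms)"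
    and lift_linear: "linear_map K (tensor K Ms) N (lift K Ms N h)"
    and lift_pure: "xs \<in> tuples Ms \<Longrightarrow> lift K Ms N h (pure K Ms xs) = h xs"
proof -
  let ?P = "\<lambda>\<phi>. \<phi> \<in> extensional (tensors Ms) \<and> linear_map K (tensor K Ms) N \<phi> \<and>
      (\<forall>xs\<in>tuples Ms. \<phi> (pure K Ms xs) = h xs)"
  obtain g where g: "linear_map K (tensor K Ms) N g" "\<And>xs. xs \<in> tuples Ms \<Longrightarrow> g (pure K Ms xs) = h xs"
    by (rule tensor_lift_exists[OF Ms N h]) blast
  have r: "?P (restrict g (tensors Ms))"
    using linear_map_cong[OF tensor_module[OF Ms] _ g(1), of "restrict g (tensors Ms)"] g(2)
      pure_closed[OF Ms]
    by simp
  have "\<exists>!\<phi>. ?P \<phi>"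
  proof (rule ex1I[of ?P, OF r])
    fix \<phi> assume p: "?P \<phi>"
    show "\<phi> = restrict g (tensors Ms)"
    proof (rule extensionalityI)
      fix t assume t: "t \<in> tensors Ms"
      show "\<phi> t = restrict g (tensors Ms) t"
        by (rule tensor_eqI[OF Ms N conjunct1[OF conjunct2[OF p]] conjunct1[OF conjunct2[OF r]] _ t])
          (use conjunct2[OF conjunct2[OF p]] conjunct2[OF conjunct2[OF r]] in simp)
    qed (use p in auto)
  qed
  from theI'[OF this] have P: "?P (lift K Ms N h)" unfolding lift_def .
  show "lift K Ms N h \<in> extensional (tensors Ms)"
    using conjunct1[OF P] .
  show "linear_map K (tensor K Ms) N (lift K Ms N h)"
    using conjunct1[OF conjunct2[OF P]] .
  show "xs \<in> tuples Ms \<Longrightarrow> lift K Ms N h (pure K Ms xs) = h xs"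
    using conjunct2[OF conjunct2[OF P]] by simp
qed

section \<open>The bilinear concatenation of tensors and its associativity\<close>

section \<open>Concatenation of tensors\<close>

text \<open>The outer \<open>lift\<close> is meaningful only if the inner one depends multilinearly
  on \<open>xs\<close>. Both sides of that claim are linear in \<open>t\<close>, so pure
  \<open>t\<close> suffice. Linearity in the second argument is then recovered by testing on pure
  \<open>s\<close>.\<close>

lemma tcat_properties:
  assumes Ms: "modules Ms" and Ns: "modules Ns"
  shows tcat_linear_left: "t \<in> tensors Ns \<Longrightarrow>
      tlinear Ms (Ms @ Ns) (\<lambda>s. tcat K Ms Ns s t)"
    and tcat_linear_right: "s \<in> tensors Ms \<Longrightarrow>
      tlinear Ns (Ms @ Ns) (\<lambda>t. tcat K Ms Ns s t)"
    and tcat_pure: "xs \<in> tuples Ms \<Longrightarrow> ys \<in> tuples Ns \<Longrightarrow>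
      tcat K Ms Ns (pure K Ms xs) (pure K Ns ys) = pure K (Ms @ Ns) (xs @ ys)"
proof -
  let ?T = "tensor K (Ms @ Ns)"
  have MN: "modules (Ms @ Ns)" using Ms Ns by simp
  note T = tensor_module[OF MN]
  define g where "g xs = lift K Ns ?T (\<lambda>ys. pure K (Ms @ Ns) (xs @ ys))" for xs
  have ml: "multilinear Ns ?T (\<lambda>ys. pure K (Ms @ Ns) (xs @ ys))" if xs: "xs \<in> tuples Ms" for xs
    unfolding multilinear_def
  proof (intro ballI conjI allI impI)
    fix ys i assume ys: "ys \<in> tuples Ns"
    then show "pure K (Ms @ Ns) (xs @ ys) \<in> carrier ?T" by (rule pure_closed[OF MN tuples_append[OF xs]])
    assume "i < length Ns"
    then show "linear_map K (Ns ! i) ?T (\<lambda>a. pure K (Ms @ Ns) (xs @ ys[i := a]))"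
      using multilinear_linear[OF pure_multilinear[OF MN] tuples_append[OF xs ys], of "length Ms + i"]
        tuples_length[OF xs] by (simp add: list_update_append)
  qed
  note gl = lift_linear[OF Ns T ml, folded g_def] and gp = lift_pure[OF Ns T ml, folded g_def]
  have mg: "multilinear Ms ?T (\<lambda>xs. g xs t)" if t: "t \<in> tensors Ns" for t
    unfolding multilinear_def
  proof (intro ballI conjI allI impI)
    fix xs i assume xs: "xs \<in> tuples Ms"
    then show "g xs t \<in> carrier ?T" using linear_map_closed[OF gl t] by blast
    assume i: "i < length Ms"
    have m: "module K (Ms ! i)" using Ms i by (simp add: list_all_length)
    note u = tuples_update[OF xs, of _ i]
    have pl: "linear_map K (Ms ! i) ?T (\<lambda>a. pure K (Ms @ Ns) (xs[i := a] @ ys))"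
      if ys: "ys \<in> tuples Ns" for ys
      using multilinear_linear[OF pure_multilinear[OF MN] tuples_append[OF xs ys], of i]
        tuples_length[OF xs] i by (simp add: list_update_append nth_append)
    show "linear_map K (Ms ! i) ?T (\<lambda>a. g (xs[i := a]) t)"
    proof (rule linear_mapI)
      fix a assume a: "a \<in> carrier (Ms ! i)"
      show "g (xs[i := a]) t \<in> carrier ?T" using linear_map_closed[OF gl[OF u[OF a]] t] .
      fix b assume b: "b \<in> carrier (Ms ! i)"
      note ab = module_add_closed[OF m a b]
      show "g (xs[i := a \<oplus>\<^bsub>Ms ! i\<^esub> b]) t = g (xs[i := a]) t \<oplus>\<^bsub>?T\<^esub> g (xs[i := b]) t"
        by (rule tensor_eqI[OF Ns T gl[OF u[OF ab]]
              linear_map_add_fun[OF T gl[OF u[OF a]] gl[OF u[OF b]]] _ t])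
          (simp add: gp[OF u[OF a]] gp[OF u[OF b]] gp[OF u[OF ab]] linear_map_add[OF pl a b])
    next
      fix c a assume c: "c \<in> carrier K" and a: "a \<in> carrier (Ms ! i)"
      note ca = module_smult_closed[OF m c a]
      show "g (xs[i := c \<odot>\<^bsub>Ms ! i\<^esub> a]) t = c \<odot>\<^bsub>?T\<^esub> g (xs[i := a]) t"
        by (rule tensor_eqI[OF Ns T gl[OF u[OF ca]] linear_map_smult_fun[OF T gl[OF u[OF a]] c] _ t])
          (simp add: gp[OF u[OF a]] gp[OF u[OF ca]] linear_map_smult[OF pl c a])
    qed
  qed
  have tc: "lift K Ms ?T (\<lambda>xs. g xs t) = (\<lambda>s. tcat K Ms Ns s t)" for t
    by (simp add: tcat_def g_def)
  note tl = lift_linear[OF Ms T mg, unfolded tc] and tp = lift_pure[OF Ms T mg, unfolded tc]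
  show "linear_map K (tensor K Ms) ?T (\<lambda>s. tcat K Ms Ns s t)" if "t \<in> tensors Ns"
    using tl[OF that] .
  show "tcat K Ms Ns (pure K Ms xs) (pure K Ns ys) = pure K (Ms @ Ns) (xs @ ys)"
    if "xs \<in> tuples Ms" "ys \<in> tuples Ns"
    using tp[OF pure_closed[OF Ns that(2)] that(1)] gp[OF that] by simp
  show "linear_map K (tensor K Ns) ?T (\<lambda>t. tcat K Ms Ns s t)" if s: "s \<in> tensors Ms"
  proof (rule linear_mapI)
    fix t assume t: "t \<in> tensors Ns"
    show "tcat K Ms Ns s t \<in> carrier ?T" using linear_map_closed[OF tl[OF t] s] .
    fix u assume u: "u \<in> tensors Ns"
    note tu = module_add_closed[OF tensor_module[OF Ns] t u]
    show "tcat K Ms Ns s (t \<oplus>\<^bsub>tensor K Ns\<^esub> u) = tcat K Ms Ns s t \<oplus>\<^bsub>?T\<^esub> tcat K Ms Ns s u"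
      by (rule tensor_eqI[OF Ms T tl[OF tu] linear_map_add_fun[OF T tl[OF t] tl[OF u]] _ s])
        (simp add: tp[OF t] tp[OF u] tp[OF tu] linear_map_add[OF gl t u])
  next
    fix c t assume c: "c \<in> carrier K" and t: "t \<in> tensors Ns"
    note ct = module_smult_closed[OF tensor_module[OF Ns] c t]
    show "tcat K Ms Ns s (c \<odot>\<^bsub>tensor K Ns\<^esub> t) = c \<odot>\<^bsub>?T\<^esub> tcat K Ms Ns s t"
      by (rule tensor_eqI[OF Ms T tl[OF ct] linear_map_smult_fun[OF T tl[OF t] c] _ s])
        (simp add: tp[OF t] tp[OF ct] linear_map_smult[OF gl c t])
  qed
qed

lemma tcat_closed:
  "modules Ms \<Longrightarrow> modules Ns \<Longrightarrow> s \<in> tensors Ms \<Longrightarrow>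
    t \<in> tensors Ns \<Longrightarrow> tcat K Ms Ns s t \<in> tensors (Ms @ Ns)"
  using linear_map_closed[OF tcat_linear_left] by blast

lemma tcat_eqI:
  assumes Ms: "modules Ms" and Ns: "modules Ns" and N: "module K N"
    and f: "linear_map K (tensor K (Ms @ Ns)) N f" and g: "linear_map K (tensor K (Ms @ Ns)) N g"
    and eq: "\<And>s t. s \<in> tensors Ms \<Longrightarrow> t \<in> tensors Ns \<Longrightarrow>
      f (tcat K Ms Ns s t) = g (tcat K Ms Ns s t)"
    and t: "t \<in> tensors (Ms @ Ns)"
  shows "f t = g t"
proof (rule tensor_eqI[OF _ N f g _ t])
  show "modules (Ms @ Ns)" using Ms Ns by simp
  fix zs assume "zs \<in> tuples (Ms @ Ns)"
  then obtain xs ys where z: "zs = xs @ ys" "xs \<in> tuples Ms" "ys \<in> tuples Ns" by (rule tuples_appendE)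
  show "f (pure K (Ms @ Ns) zs) = g (pure K (Ms @ Ns) zs)"
    using eq[OF pure_closed[OF Ms z(2)] pure_closed[OF Ns z(3)]]
    by (simp add: tcat_pure[OF Ms Ns z(2,3)] z(1))
qed

lemma tcat_Nil_left:
  assumes Ms: "modules Ms" and t: "t \<in> tensors Ms"
  shows "tcat K [] Ms (pure K [] []) t = t"
proof -
  have Nil: "modules []" by simp
  have p: "pure K [] [] \<in> tensors []" by (rule pure_closed) auto
  show ?thesis
    by (rule tensor_eqI[OF Ms tensor_module[OF Ms] tcat_linear_right[OF Nil Ms p, simplified]
          linear_map_ident _ t])
      (use tcat_pure[OF Nil Ms, of "[]"] in simp)
qed

lemma tcat_Nil_right:
  assumes Ms: "modules Ms" and t: "t \<in> tensors Ms"
  shows "tcat K Ms [] t (pure K [] []) = t"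
proof -
  have Nil: "modules []" by simp
  have p: "pure K [] [] \<in> tensors []" by (rule pure_closed) auto
  show ?thesis
    by (rule tensor_eqI[OF Ms tensor_module[OF Ms] tcat_linear_left[OF Ms Nil p, simplified]
          linear_map_ident _ t])
      (use tcat_pure[OF Ms Nil, of _ "[]"] in simp)
qed

text \<open>Both sides live over the same list because append is associative. They are linear in
  each argument, so the arguments may be made pure one at a time, and then associativity of append
  gives the claim once more.\<close>

lemma tcat_assoc:
  assumes Ms: "modules Ms" and Ns: "modules Ns" and Ps: "modules Ps"
    and s: "s \<in> tensors Ms" and t: "t \<in> tensors Ns" and u: "u \<in> tensors Ps"
  shows "tcat K (Ms @ Ns) Ps (tcat K Ms Ns s t) u = tcat K Ms (Ns @ Ps) s (tcat K Ns Ps t u)"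
proof -
  let ?T = "tensor K (Ms @ Ns @ Ps)"
  have MN: "modules (Ms @ Ns)" and NP: "modules (Ns @ Ps)"
    and all: "modules (Ms @ Ns @ Ps)" using Ms Ns Ps by simp_all
  note T = tensor_module[OF all]
  note left = tcat_linear_left and right = tcat_linear_right
  have A: "linear_map K (tensor K Ms) ?T (\<lambda>s. tcat K (Ms @ Ns) Ps (tcat K Ms Ns s t) u)"
    and A': "linear_map K (tensor K Ms) ?T (\<lambda>s. tcat K Ms (Ns @ Ps) s (tcat K Ns Ps t u))"
    if "t \<in> tensors Ns" "u \<in> tensors Ps" for t u
    using linear_map_compose[OF left[OF Ms Ns that(1)] left[OF MN Ps that(2)]]
      left[OF Ms NP tcat_closed[OF Ns Ps that]] by simp_all
  have B: "linear_map K (tensor K Ns) ?T (\<lambda>t. tcat K (Ms @ Ns) Ps (tcat K Ms Ns s t) u)"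
    and B': "linear_map K (tensor K Ns) ?T (\<lambda>t. tcat K Ms (Ns @ Ps) s (tcat K Ns Ps t u))"
    if "s \<in> tensors Ms" "u \<in> tensors Ps" for s u
    using linear_map_compose[OF right[OF Ms Ns that(1)] left[OF MN Ps that(2)]]
      linear_map_compose[OF left[OF Ns Ps that(2)] right[OF Ms NP that(1)]] by simp_all
  have C: "linear_map K (tensor K Ps) ?T (\<lambda>u. tcat K (Ms @ Ns) Ps (tcat K Ms Ns s t) u)"
    and C': "linear_map K (tensor K Ps) ?T (\<lambda>u. tcat K Ms (Ns @ Ps) s (tcat K Ns Ps t u))"
    if "s \<in> tensors Ms" "t \<in> tensors Ns" for s t
    using right[OF MN Ps tcat_closed[OF Ms Ns that]]
      linear_map_compose[OF right[OF Ns Ps that(2)] right[OF Ms NP that(1)]] by simp_all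
  show ?thesis
  proof (rule tensor_eqI[OF Ms T A[OF t u] A'[OF t u] _ s])
    fix xs assume xs: "xs \<in> tuples Ms"
    note px = pure_closed[OF Ms xs]
    show "tcat K (Ms @ Ns) Ps (tcat K Ms Ns (pure K Ms xs) t) u
        = tcat K Ms (Ns @ Ps) (pure K Ms xs) (tcat K Ns Ps t u)"
    proof (rule tensor_eqI[OF Ns T B[OF px u] B'[OF px u] _ t])
      fix ys assume ys: "ys \<in> tuples Ns"
      note py = pure_closed[OF Ns ys]
      show "tcat K (Ms @ Ns) Ps (tcat K Ms Ns (pure K Ms xs) (pure K Ns ys)) u
          = tcat K Ms (Ns @ Ps) (pure K Ms xs) (tcat K Ns Ps (pure K Ns ys) u)"
        by (rule tensor_eqI[OF Ps T C[OF px py] C'[OF px py] _ u])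
          (simp add: tcat_pure Ms Ns Ps xs ys tuples_append)
    qed
  qed
qed

section \<open>Maps tensored with identities: functoriality, nesting and interchange\<close>

section \<open>Maps acting on some of the tensor factors\<close>

text \<open>\<open>leg\<close> is prescribed on pure tensors of the whole list, while its use
  requires general tensors in all three blocks, in particular values of other maps. Both sides are
  linear in each block, so the formula spreads from pure tensors block by block.\<close>

lemma leg_properties:
  assumes Ms: "modules Ms" and Ns: "modules Ns"
    and Ps: "modules Ps" and Qs: "modules Qs"
    and f: "tlinear Ps Qs f"
  shows leg_linear: "tlinear (Ms @ Ps @ Ns) (Ms @ Qs @ Ns) (leg K Ms Ns Ps Qs f)"
    and leg_tcat: "s \<in> tensors Ms \<Longrightarrow> t \<in> tensors Ps \<Longrightarrow> u \<in> tensors Ns \<Longrightarrow>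
      leg K Ms Ns Ps Qs f (tcat K Ms (Ps @ Ns) s (tcat K Ps Ns t u))
      = tcat K Ms (Qs @ Ns) s (tcat K Qs Ns (f t) u)"
proof -
  let ?S = "tensor K (Ms @ Ps @ Ns)" and ?T = "tensor K (Ms @ Qs @ Ns)"
  have PN: "modules (Ps @ Ns)" and QN: "modules (Qs @ Ns)"
    and all: "modules (Ms @ Ps @ Ns)" "modules (Ms @ Qs @ Ns)"
    using assms by simp_all
  note S = tensor_module[OF all(1)] and T = tensor_module[OF all(2)]
  define h where "h zs = (let xs = take (length Ms) zs; ps = take (length Ps) (drop (length Ms) zs);
      ys = drop (length Ms + length Ps) zs
    in tcat K Ms (Qs @ Ns) (pure K Ms xs) (tcat K Qs Ns (f (pure K Ps ps)) (pure K Ns ys)))" for zs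
  have h: "h (xs @ ps @ ys) = tcat K Ms (Qs @ Ns) (pure K Ms xs) (tcat K Qs Ns (f (pure K Ps ps)) (pure K Ns ys))"
    if "xs \<in> tuples Ms" "ps \<in> tuples Ps" for xs ps ys
    using that[THEN tuples_length] by (simp add: h_def)
  note pM = pure_closed[OF Ms] and pN = pure_closed[OF Ns] and pP = pure_closed[OF Ps]
  note mM = pure_multilinear[OF Ms] and mN = pure_multilinear[OF Ns] and mP = pure_multilinear[OF Ps]
  note fc = linear_map_closed[OF f]
  have hm: "multilinear (Ms @ Ps @ Ns) ?T h"
  proof (rule multilinear_append)
    fix zs assume "zs \<in> tuples (Ps @ Ns)"
    then obtain ps ys where z: "zs = ps @ ys" "ps \<in> tuples Ps" "ys \<in> tuples Ns" by (rule tuples_appendE)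
    show "multilinear Ms ?T (\<lambda>xs. h (xs @ zs))"
      unfolding z(1)
      by (rule multilinear_cong[OF Ms h[OF _ z(2), symmetric]], assumption)
        (rule multilinear_compose[OF mM tcat_linear_left[OF Ms QN tcat_closed[OF Qs Ns fc[OF pP[OF z(2)]] pN[OF z(3)]]]])
  next
    fix xs assume xs: "xs \<in> tuples Ms"
    note L = tcat_linear_right[OF Ms QN pM[OF xs]]
    show "multilinear (Ps @ Ns) ?T (\<lambda>zs. h (xs @ zs))"
    proof (rule multilinear_append)
      fix ys assume ys: "ys \<in> tuples Ns"
      show "multilinear Ps ?T (\<lambda>ps. h (xs @ ps @ ys))"
        by (rule multilinear_cong[OF Ps h[OF xs, symmetric]], assumption)
          (rule multilinear_compose[OF mP linear_map_compose[OF f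
              linear_map_compose[OF tcat_linear_left[OF Qs Ns pN[OF ys]] L]]])
    next
      fix ps assume ps: "ps \<in> tuples Ps"
      show "multilinear Ns ?T (\<lambda>ys. h (xs @ ps @ ys))"
        by (rule multilinear_cong[OF Ns h[OF xs ps, symmetric]])
          (rule multilinear_compose[OF mN linear_map_compose[OF tcat_linear_right[OF Qs Ns fc[OF pP[OF ps]]] L]])
    qed
  qed
  have le: "leg K Ms Ns Ps Qs f = lift K (Ms @ Ps @ Ns) ?T h" by (simp add: leg_def h_def[abs_def])
  show lin: "linear_map K ?S ?T (leg K Ms Ns Ps Qs f)" unfolding le by (rule lift_linear[OF all(1) T hm])
  assume s: "s \<in> tensors Ms" and t: "t \<in> tensors Ps" and u: "u \<in> tensors Ns"
  note left = tcat_linear_left and right = tcat_linear_right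
  show "leg K Ms Ns Ps Qs f (tcat K Ms (Ps @ Ns) s (tcat K Ps Ns t u))
      = tcat K Ms (Qs @ Ns) s (tcat K Qs Ns (f t) u)"
  proof (rule tensor_eqI[OF Ms T linear_map_compose[OF left[OF Ms PN tcat_closed[OF Ps Ns t u]] lin]
        left[OF Ms QN tcat_closed[OF Qs Ns fc[OF t] u]] _ s])
    fix xs assume xs: "xs \<in> tuples Ms"
    note R1 = linear_map_compose[OF right[OF Ms PN pM[OF xs]] lin] and R2 = right[OF Ms QN pM[OF xs]]
    show "leg K Ms Ns Ps Qs f (tcat K Ms (Ps @ Ns) (pure K Ms xs) (tcat K Ps Ns t u))
        = tcat K Ms (Qs @ Ns) (pure K Ms xs) (tcat K Qs Ns (f t) u)"
    proof (rule tensor_eqI[OF Ps T linear_map_compose[OF left[OF Ps Ns u] R1]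
          linear_map_compose[OF f linear_map_compose[OF left[OF Qs Ns u] R2]] _ t])
      fix ps assume ps: "ps \<in> tuples Ps"
      show "leg K Ms Ns Ps Qs f (tcat K Ms (Ps @ Ns) (pure K Ms xs) (tcat K Ps Ns (pure K Ps ps) u))
          = tcat K Ms (Qs @ Ns) (pure K Ms xs) (tcat K Qs Ns (f (pure K Ps ps)) u)"
        by (rule tensor_eqI[OF Ns T linear_map_compose[OF right[OF Ps Ns pP[OF ps]] R1]
              linear_map_compose[OF right[OF Qs Ns fc[OF pP[OF ps]]] R2] _ u])
          (simp add: tcat_pure Ms Ps Ns xs ps tuples_append le lift_pure[OF all(1) T hm] h)
    qed
  qed
qed

lemma tcat3_eqI:
  assumes Ms: "modules Ms" and Ps: "modules Ps" and Ns: "modules Ns"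
    and N: "module K N"
    and f: "linear_map K (tensor K (Ms @ Ps @ Ns)) N f" and g: "linear_map K (tensor K (Ms @ Ps @ Ns)) N g"
    and eq: "\<And>s t u. s \<in> tensors Ms \<Longrightarrow> t \<in> tensors Ps \<Longrightarrow> u \<in> tensors Ns \<Longrightarrow>
      f (tcat K Ms (Ps @ Ns) s (tcat K Ps Ns t u)) = g (tcat K Ms (Ps @ Ns) s (tcat K Ps Ns t u))"
    and x: "x \<in> tensors (Ms @ Ps @ Ns)"
  shows "f x = g x"
proof (rule tcat_eqI[OF Ms _ N f g _ x])
  show PN: "modules (Ps @ Ns)" using Ps Ns by simp
  fix s t assume s: "s \<in> tensors Ms" and t: "t \<in> tensors (Ps @ Ns)"
  note L = tcat_linear_right[OF Ms PN s]
  show "f (tcat K Ms (Ps @ Ns) s t) = g (tcat K Ms (Ps @ Ns) s t)"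
    by (rule tcat_eqI[OF Ps Ns N linear_map_compose[OF L f] linear_map_compose[OF L g] eq[OF s] t])
qed

lemma leg_compose:
  assumes "modules Ms" "modules Ns"
    "modules Ps" "modules Qs" "modules Os"
    and f: "tlinear Ps Qs f" and g: "tlinear Qs Os g"
    and t: "t \<in> tensors (Ms @ Ps @ Ns)"
  shows "leg K Ms Ns Qs Os g (leg K Ms Ns Ps Qs f t) = leg K Ms Ns Ps Os (\<lambda>x. g (f x)) t"
  by (rule tcat3_eqI[OF assms(1,3,2) tensor_module linear_map_compose[OF leg_linear leg_linear]
        leg_linear[OF _ _ _ _ linear_map_compose[OF f g]] _ t])
    (use assms in \<open>auto simp: leg_tcat linear_map_compose[OF f g] linear_map_closed[OF f]\<close>)

lemma leg_cong:
  assumes "modules Ms" "modules Ns" "modules Ps" "modules Qs"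
    and f: "tlinear Ps Qs f" and g: "tlinear Ps Qs g"
    and eq: "\<And>x. x \<in> tensors Ps \<Longrightarrow> f x = g x"
    and t: "t \<in> tensors (Ms @ Ps @ Ns)"
  shows "leg K Ms Ns Ps Qs f t = leg K Ms Ns Ps Qs g t"
  by (rule tcat3_eqI[OF assms(1,3,2) tensor_module leg_linear[OF _ _ _ _ f] leg_linear[OF _ _ _ _ g] _ t])
    (use assms in \<open>auto simp: leg_tcat\<close>)

lemma leg_ident:
  assumes "modules Ms" "modules Ns" "modules Ps"
    and t: "t \<in> tensors (Ms @ Ps @ Ns)"
  shows "leg K Ms Ns Ps Ps (\<lambda>x. x) t = t"
  by (rule tcat3_eqI[OF assms(1,3,2) tensor_module leg_linear[OF _ _ _ _ linear_map_ident] linear_map_ident _ t])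
    (use assms in \<open>auto simp: leg_tcat linear_map_ident\<close>)

lemma leg_Nil:
  assumes "modules Ps" "modules Qs"
    and f: "tlinear Ps Qs f" and t: "t \<in> tensors Ps"
  shows "leg K [] [] Ps Qs f t = f t"
proof -
  have p: "pure K [] [] \<in> tensors []" by (rule pure_closed) auto
  from leg_tcat[of "[]" "[]" Ps Qs f "pure K [] []" t "pure K [] []"] assms p show ?thesis
    by (simp add: tcat_Nil_left tcat_Nil_right linear_map_closed[OF f])
qed

text \<open>Identities may be added in two stages or in one. On a concatenation of five tensors the
  two versions differ only in bracketing, which \<open>tcat_assoc\<close> removes.\<close>

lemma leg_leg:
  assumes m: "modules Ms" "modules Ns" "modules As" "modules Bs"
      "modules Ps" "modules Qs"
    and f: "tlinear Ps Qs f"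
    and t: "t \<in> tensors (Ms @ As @ Ps @ Bs @ Ns)"
  shows "leg K Ms Ns (As @ Ps @ Bs) (As @ Qs @ Bs) (leg K As Bs Ps Qs f) t = leg K (Ms @ As) (Bs @ Ns) Ps Qs f t"
proof -
  let ?T = "tensor K (Ms @ As @ Qs @ Bs @ Ns)"
  have m': "modules (Ms @ As)" "modules (Bs @ Ns)" "modules (Ps @ Bs)"
    "modules (Qs @ Bs)" "modules (Ps @ Bs @ Ns)" "modules (Qs @ Bs @ Ns)"
    "modules (As @ Ps @ Bs)" "modules (As @ Qs @ Bs)"
    "modules (As @ Ps @ Bs @ Ns)" "modules (As @ Qs @ Bs @ Ns)"
    using m by simp_all
  have T: "module K ?T" by (rule tensor_module) (use m in simp)
  note l = leg_linear[OF m(3,4,5,6) f]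
  have L: "linear_map K (tensor K (Ms @ As @ Ps @ Bs @ Ns)) ?T
      (leg K Ms Ns (As @ Ps @ Bs) (As @ Qs @ Bs) (leg K As Bs Ps Qs f))"
    using leg_linear[OF m(1,2) m'(7,8) l] by simp
  have R: "linear_map K (tensor K (Ms @ As @ Ps @ Bs @ Ns)) ?T (leg K (Ms @ As) (Bs @ Ns) Ps Qs f)"
    using leg_linear[OF m'(1,2) m(5,6) f] by simp
  show ?thesis
  proof (rule tcat_eqI[OF m(1) m'(9) T L R _ t])
    fix s u assume s: "s \<in> tensors Ms" and u: "u \<in> tensors (As @ Ps @ Bs @ Ns)"
    note c = tcat_linear_right[OF m(1) m'(9) s]
    note cL = linear_map_compose[OF c L] and cR = linear_map_compose[OF c R]
    show "leg K Ms Ns (As @ Ps @ Bs) (As @ Qs @ Bs) (leg K As Bs Ps Qs f) (tcat K Ms (As @ Ps @ Bs @ Ns) s u)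
        = leg K (Ms @ As) (Bs @ Ns) Ps Qs f (tcat K Ms (As @ Ps @ Bs @ Ns) s u)"
    proof (rule tcat_eqI[OF m(3) m'(5) T cL cR _ u])
      fix a v assume a: "a \<in> tensors As" and v: "v \<in> tensors (Ps @ Bs @ Ns)"
      note d = tcat_linear_right[OF m(3) m'(5) a]
      show "leg K Ms Ns (As @ Ps @ Bs) (As @ Qs @ Bs) (leg K As Bs Ps Qs f)
            (tcat K Ms (As @ Ps @ Bs @ Ns) s (tcat K As (Ps @ Bs @ Ns) a v))
          = leg K (Ms @ As) (Bs @ Ns) Ps Qs f (tcat K Ms (As @ Ps @ Bs @ Ns) s (tcat K As (Ps @ Bs @ Ns) a v))"
      proof (rule tcat3_eqI[OF m(5,4,2) T linear_map_compose[OF d cL] linear_map_compose[OF d cR] _ v])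
        fix p b n assume p: "p \<in> tensors Ps" and b: "b \<in> tensors Bs"
          and n: "n \<in> tensors Ns"
        note fp = linear_map_closed[OF f p]
        note pb = tcat_closed[OF m(5,4) p b] and qb = tcat_closed[OF m(6,4) fp b]
          and bn = tcat_closed[OF m(4,2) b n] and sa = tcat_closed[OF m(1,3) s a]
        note apb = tcat_closed[OF m(3) m'(3) a pb] and aqb = tcat_closed[OF m(3) m'(4) a qb]
        note pbn = tcat_closed[OF m(5) m'(2) p bn] and qbn = tcat_closed[OF m(6) m'(2) fp bn]
        \<comment> \<open>The inner \<open>leg\<close> needs the blocks \<open>As\<close>,
          \<open>Ps\<close>, \<open>Bs\<close> bracketed together, whereas the concatenation at hand
          is bracketed to the right.\<close>
        have 1: "tcat K As (Ps @ Bs @ Ns) a (tcat K Ps (Bs @ Ns) p (tcat K Bs Ns b n))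
            = tcat K (As @ Ps @ Bs) Ns (tcat K As (Ps @ Bs) a (tcat K Ps Bs p b)) n"
          using tcat_assoc[OF m(3) m'(3) m(2) a pb n] tcat_assoc[OF m(5,4,2) p b n] by simp
        have 2: "tcat K As (Qs @ Bs @ Ns) a (tcat K Qs (Bs @ Ns) (f p) (tcat K Bs Ns b n))
            = tcat K (As @ Qs @ Bs) Ns (tcat K As (Qs @ Bs) a (tcat K Qs Bs (f p) b)) n"
          using tcat_assoc[OF m(3) m'(4) m(2) a qb n] tcat_assoc[OF m(6,4,2) fp b n] by simp
        have "leg K Ms Ns (As @ Ps @ Bs) (As @ Qs @ Bs) (leg K As Bs Ps Qs f)
            (tcat K Ms ((As @ Ps @ Bs) @ Ns) s
              (tcat K (As @ Ps @ Bs) Ns (tcat K As (Ps @ Bs) a (tcat K Ps Bs p b)) n))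
            = tcat K Ms ((As @ Qs @ Bs) @ Ns) s
              (tcat K (As @ Qs @ Bs) Ns (tcat K As (Qs @ Bs) a (tcat K Qs Bs (f p) b)) n)"
          unfolding leg_tcat[OF m(1,2) m'(7,8) l s apb n] leg_tcat[OF m(3,4,5,6) f a p b] ..
        moreover have "leg K (Ms @ As) (Bs @ Ns) Ps Qs f
            (tcat K (Ms @ As) (Ps @ Bs @ Ns) (tcat K Ms As s a) (tcat K Ps (Bs @ Ns) p (tcat K Bs Ns b n)))
            = tcat K (Ms @ As) (Qs @ Bs @ Ns) (tcat K Ms As s a) (tcat K Qs (Bs @ Ns) (f p) (tcat K Bs Ns b n))"
          by (rule leg_tcat[OF m'(1,2) m(5,6) f sa p bn])
        ultimately show "leg K Ms Ns (As @ Ps @ Bs) (As @ Qs @ Bs) (leg K As Bs Ps Qs f)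
            (tcat K Ms (As @ Ps @ Bs @ Ns) s
              (tcat K As (Ps @ Bs @ Ns) a (tcat K Ps (Bs @ Ns) p (tcat K Bs Ns b n))))
          = leg K (Ms @ As) (Bs @ Ns) Ps Qs f
            (tcat K Ms (As @ Ps @ Bs @ Ns) s
              (tcat K As (Ps @ Bs @ Ns) a (tcat K Ps (Bs @ Ns) p (tcat K Bs Ns b n))))"
          unfolding tcat_assoc[OF m(1,3) m'(5) s a pbn] tcat_assoc[OF m(1,3) m'(6) s a qbn] 1 2
          by simp
      qed
    qed
  qed
qed

text \<open>This is the interchange law for maps on disjoint blocks; by it, crossings of distant
  strands change places.\<close>

lemma leg_commute:
  assumes m: "modules As" "modules Bs"
      "modules Ps" "modules Qs" "modules Cs"
      "modules Ns" "modules Os"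
    and f: "tlinear Ps Qs f" and g: "tlinear Ns Os g"
    and t: "t \<in> tensors (As @ Ps @ Bs @ Ns @ Cs)"
  shows "leg K As (Bs @ Os @ Cs) Ps Qs f (leg K (As @ Ps @ Bs) Cs Ns Os g t)
    = leg K (As @ Qs @ Bs) Cs Ns Os g (leg K As (Bs @ Ns @ Cs) Ps Qs f t)"
proof -
  let ?BN = "Bs @ Ns @ Cs" and ?BO = "Bs @ Os @ Cs"
  have m': "modules ?BN" "modules ?BO"
    "modules (As @ Ps)" "modules (As @ Qs)" "modules (As @ Ps @ Bs)"
    "modules (As @ Qs @ Bs)" "modules (Ps @ ?BN)" "modules (Qs @ ?BO)"
    "modules (As @ Qs @ ?BO)" "modules (Ps @ ?BO)" "modules (Qs @ ?BN)"
    using m by simp_all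
  note T = tensor_module[OF m'(9)]
  note g' = leg_linear[OF m(2,5,6,7) g]
  have gl: "tlinear (As @ Ps @ ?BN) (As @ Ps @ ?BO) (leg K (As @ Ps @ Bs) Cs Ns Os g)"
    using leg_linear[OF m'(5) m(5,6,7) g] by simp
  have gr: "tlinear (As @ Qs @ ?BN) (As @ Qs @ ?BO) (leg K (As @ Qs @ Bs) Cs Ns Os g)"
    using leg_linear[OF m'(6) m(5,6,7) g] by simp
  \<comment> \<open>The action of \<open>g\<close> is absorbed into the last block
    \<open>Bs @ Ns @ Cs\<close>, after which \<open>f\<close> and \<open>g\<close> act on different
    arguments of \<open>tcat\<close>. The middle block is a variable \<open>Xs\<close> because the
    formula is used both before and after \<open>f\<close>.\<close>
  have e: "leg K (As @ Xs @ Bs) Cs Ns Os g (tcat K As (Xs @ ?BN) a (tcat K Xs ?BN x y))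
      = tcat K As (Xs @ ?BO) a (tcat K Xs ?BO x (leg K Bs Cs Ns Os g y))"
    if X: "modules Xs" and a: "a \<in> tensors As" and x: "x \<in> tensors Xs"
      and y: "y \<in> tensors ?BN" for Xs a x y
  proof -
    have mx: "modules (As @ Xs)" using m X by simp
    have nil: "pure K [] [] \<in> tensors []" by (rule pure_closed) auto
    have ax: "tcat K As Xs a x \<in> tensors (As @ Xs)" by (rule tcat_closed[OF m(1) X a x])
    have gy: "leg K Bs Cs Ns Os g y \<in> tensors ?BO" by (rule linear_map_closed[OF g' y])
    have cl: "tcat K (As @ Xs) ?BN (tcat K As Xs a x) y \<in> tensors ((As @ Xs) @ Bs @ Ns @ Cs @ [])"
      using tcat_closed[OF mx m'(1) ax y] by simp
    have "leg K (As @ Xs @ Bs) Cs Ns Os g (tcat K (As @ Xs) ?BN (tcat K As Xs a x) y)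
        = leg K (As @ Xs) [] ?BN ?BO (leg K Bs Cs Ns Os g) (tcat K (As @ Xs) ?BN (tcat K As Xs a x) y)"
      using leg_leg[OF mx _ m(2,5,6,7) g cl] by simp
    also have "\<dots> = tcat K (As @ Xs) ?BO (tcat K As Xs a x) (leg K Bs Cs Ns Os g y)"
      using leg_tcat[OF mx _ m'(1,2) g' ax y nil] y gy m'(1,2)
      by (simp add: tcat_Nil_right)
    finally show ?thesis
      using tcat_assoc[OF m(1) X m'(1) a x y] tcat_assoc[OF m(1) X m'(2) a x gy] by simp
  qed
  show ?thesis
    by (rule tcat3_eqI[OF m(1,3) m'(1) T linear_map_compose[OF gl leg_linear[OF m(1) m'(2) m(3,4) f]]
          linear_map_compose[OF leg_linear[OF m(1) m'(1) m(3,4) f] gr] _ t])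
      (simp add: e m(1,3,4) leg_tcat[OF m(1) m'(2) m(3,4) f] leg_tcat[OF m(1) m'(1) m(3,4) f]
        linear_map_closed[OF g'] linear_map_closed[OF f])
qed

end

section \<open>Combinatorics of crossing words\<close>

section \<open>Crossing words\<close>

text \<open>A typing judgement for words. \<open>cross_at\<close> swaps any two neighbours, but a
  map from \<open>P \<otimes> Q\<close> to \<open>Q \<otimes> P\<close> fits only where a
  \<open>P\<close> stands directly left of a \<open>Q\<close>. The relation follows the list of
  factors through the word; \<open>Suc (length As)\<close> is the position of that \<open>P\<close>,
  counted from 1.\<close>

inductive crosses :: "'b \<Rightarrow> 'b \<Rightarrow> nat list \<Rightarrow> 'b list \<Rightarrow> 'b list \<Rightarrow> bool" for P Q where
  Nil: "crosses P Q [] Ms Ms"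
| Cons: "crosses P Q is (As @ [Q, P] @ Bs) Ns \<Longrightarrow> crosses P Q (Suc (length As) # is) (As @ [P, Q] @ Bs) Ns"

lemma map_plus_0: "map ((+) (0::nat)) xs = xs"
  by (simp add: map_idI)

lemma map_plus_upt: "map ((+) k) [i..<j] = [k + i..<k + j]"
  by (rule nth_equalityI) auto

lemma swap_at_eq: "swap_at (Suc (length As)) (As @ [P, Q] @ Bs) = As @ [Q, P] @ Bs"
  by (simp add: swap_at_def nth_append)

lemma cross_at_eq: "cross_at K f (Suc (length As)) (As @ [P, Q] @ Bs) = leg K As Bs [P, Q] [Q, P] f"
  by (simp add: cross_at_def nth_append)

lemma cross_seq_Cons:
  "cross_seq K f (Suc (length As) # is) (As @ [P, Q] @ Bs) t
    = cross_seq K f is (As @ [Q, P] @ Bs) (leg K As Bs [P, Q] [Q, P] f t)"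
  unfolding cross_seq.simps swap_at_eq cross_at_eq ..

lemma crosses_append:
  "crosses P Q is Ms Ns \<Longrightarrow> crosses P Q js Ns Os \<Longrightarrow> crosses P Q (is @ js) Ms Os"
  by (induction rule: crosses.induct) (auto intro: crosses.intros[simplified])

lemma cross_seq_append:
  "crosses P Q is Ms Ns \<Longrightarrow> cross_seq K f (is @ js) Ms t = cross_seq K f js Ns (cross_seq K f is Ms t)"
  by (induction arbitrary: t rule: crosses.induct) 
    (simp_all only: append_Nil append_Cons cross_seq_Cons[unfolded append_Nil append_Cons] cross_seq.simps(1))

text \<open>Indices count positions from the left, so only the strands added on that side alter
  them.\<close>

lemma crosses_shift:
  "crosses P Q is Ms Ns \<Longrightarrow> crosses P Q (map ((+) (length Cs)) is) (Cs @ Ms @ Ds) (Cs @ Ns @ Ds)"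
proof (induction rule: crosses.induct)
  case (Nil Ms)
  then show ?case by (simp add: crosses.Nil)
next
  case (Cons is' As Bs Ns)
  show ?case
    using crosses.Cons[of P Q "map ((+) (length Cs)) is'" "Cs @ As" "Bs @ Ds" "Cs @ Ns @ Ds"] Cons.IH
    by simp
qed

lemma crosses_set: "crosses P Q is Ms Ns \<Longrightarrow> set Ns = set Ms"
  by (induction rule: crosses.induct) auto

text \<open>The single \<open>Q\<close> travels to the left and meets the nearest \<open>P\<close>
  first, whence the decreasing indices. In the induction the first crossing takes it past the last
  \<open>P\<close>, which from then on stays at the right end.\<close>

lemma crosses_strand: "crosses P Q (rev [1..<n + 1]) (replicate n P @ [Q]) (Q # replicate n P)"
proof (induction n)
  case 0
  then show ?case by (simp add: crosses.Nil)
next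
  case (Suc n)
  have "crosses P Q (rev [1..<n + 1]) (replicate n P @ [Q, P]) (Q # replicate n P @ [P])"
    using crosses_shift[OF Suc, of "[]" "[P]"] by (simp add: map_plus_0 del: upt_Suc One_nat_def)
  then have "crosses P Q (Suc (length (replicate n P)) # rev [1..<n + 1]) (replicate n P @ [P, Q] @ [])
      (Q # replicate n P @ [P])"
    by (intro crosses.Cons) simp
  moreover have "rev [1..<Suc n + 1] = Suc n # rev [1..<n + 1]" by simp
  moreover have "replicate n P @ [P, Q] @ [] = replicate (Suc n) P @ [Q]"
    by (simp add: replicate_app_Cons_same)
  ultimately show ?case by (simp only: length_replicate replicate_append_same replicate_Suc)
qed

lemma strand_add: "rev [1..<n + k + 1] = map ((+) n) (rev [1..<k + 1]) @ rev [1..<n + 1]"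
proof -
  have "[1..<n + k + 1] = [1..<n + 1] @ [n + 1..<n + 1 + k]"
    using upt_add_eq_append[of 1 "n + 1" k] by (simp add: add.commute add.left_commute)
  moreover have "[n + 1..<n + 1 + k] = map ((+) n) [1..<k + 1]"
    by (simp add: map_plus_upt add.commute add.left_commute del: upt_Suc)
  ultimately show ?thesis by (simp add: rev_map del: upt_Suc)
qed

lemma block_crossing_0 [simp]: "block_crossing n 0 = []" "block_crossing 0 m = []"
  by (simp_all add: block_crossing_def)

lemma block_crossing_1: "block_crossing n (Suc 0) = rev [1..<n + 1]"
  by (simp add: block_crossing_def upt_conv_Cons)

text \<open>The second group of \<open>p\<close> strands crosses when the first \<open>m\<close>
  have already arrived at the left, and these displace all its indices by \<open>m\<close>.\<close>

lemma block_crossing_add: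
  "block_crossing n (m + p) = block_crossing n m @ map ((+) m) (block_crossing n p)"
proof -
  have "[1..<m + p + 1] = [1..<m + 1] @ [m + 1..<m + 1 + p]"
    using upt_add_eq_append[of 1 "m + 1" p] by (simp add: add.commute add.left_commute)
  moreover have "[m + 1..<m + 1 + p] = map ((+) m) [1..<p + 1]"
    by (simp add: map_plus_upt add.commute add.left_commute del: upt_Suc)
  moreover have "rev [m + j..<n + (m + j)] = map ((+) m) (rev [j..<n + j])" for j
    by (simp add: rev_map[symmetric] map_plus_upt add.commute add.left_commute del: upt_Suc)
  ultimately show ?thesis by (simp add: block_crossing_def map_concat comp_def del: upt_Suc)
qed

lemma crosses_block:
  "crosses P Q (block_crossing n m) (replicate n P @ replicate m Q) (replicate m Q @ replicate n P)"
proof (induction m)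
  case 0
  then show ?case by (simp add: crosses.Nil)
next
  case (Suc m)
  have 1: "crosses P Q (block_crossing n m) ((replicate n P @ replicate m Q) @ [Q])
      (replicate m Q @ replicate n P @ [Q])"
    using crosses_shift[OF Suc, of "[]" "[Q]"] by (simp add: map_plus_0)
  have 2: "crosses P Q (map ((+) m) (block_crossing n (Suc 0))) (replicate m Q @ replicate n P @ [Q])
      (replicate m Q @ Q # replicate n P)"
    using crosses_shift[OF crosses_strand[of P Q n], of "replicate m Q" "[]"]
    by (simp add: block_crossing_1)
  show ?case
    using crosses_append[OF 1 2] block_crossing_add[of n m "Suc 0"]
    by (simp add: replicate_append_same replicate_app_Cons_same)
qed

section \<open>Crossing words as linear maps on tensor products\<close>

context scalar_ring
begin

lemma cross_seq_linear:
  assumes "crosses P Q is Ms Ns" "modules Ms"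
    and f: "tlinear [P, Q] [Q, P] f"
  shows "tlinear Ms Ns (cross_seq K f is Ms)"
  using assms(1,2)
proof (induction rule: crosses.induct)
  case (Nil Ms)
  have "cross_seq K f [] Ms = (\<lambda>t. t)" by auto
  then show ?case by (simp add: linear_map_ident)
next
  case (Cons is' As Bs Ns)
  have "cross_seq K f (Suc (length As) # is') (As @ [P, Q] @ Bs)
      = (\<lambda>t. cross_seq K f is' (As @ [Q, P] @ Bs) (leg K As Bs [P, Q] [Q, P] f t))"
    using cross_seq_Cons by fastforce
  moreover have "tlinear (As @ [P, Q] @ Bs) Ns \<dots>"
    by (rule linear_map_compose[OF leg_linear[OF _ _ _ _ f] Cons.IH]) (use Cons.prems in auto)
  ultimately show ?case by simp
qed

text \<open>Each letter, applied inside the larger list, is a nested \<open>leg\<close>, and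
  functoriality gathers the letters into one. It turns equations between words into equations
  between maps on blocks.\<close>

lemma cross_seq_shift:
  assumes "crosses P Q is Ms Ns" "modules Ms"
    and f: "tlinear [P, Q] [Q, P] f"
    and Cs: "modules Cs" and Ds: "modules Ds"
    and t: "t \<in> tensors (Cs @ Ms @ Ds)"
  shows "cross_seq K f (map ((+) (length Cs)) is) (Cs @ Ms @ Ds) t
    = leg K Cs Ds Ms Ns (cross_seq K f is Ms) t"
  using assms(1,2) t
proof (induction arbitrary: t rule: crosses.induct)
  case (Nil Ms)
  have "cross_seq K f [] Ms = (\<lambda>t. t)" by auto
  then show ?case using leg_ident[OF Cs Ds Nil] by simp
next
  case (Cons is' As Bs Ns)
  have m: "modules As" "modules Bs" "modules [P, Q]"
    "modules [Q, P]" "modules (As @ [P, Q] @ Bs)"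
    "modules (As @ [Q, P] @ Bs)" "modules Ns"
    using Cons.prems crosses_set[OF Cons.hyps] by (auto simp: list_all_iff)
  note l = leg_linear[OF m(1,2,3,4) f]
  note cs = cross_seq_linear[OF Cons.hyps m(6) f]
  have t: "t \<in> tensors (Cs @ (As @ [P, Q] @ Bs) @ Ds)" using Cons.prems by simp
  have c: "leg K Cs Ds (As @ [P, Q] @ Bs) (As @ [Q, P] @ Bs) (leg K As Bs [P, Q] [Q, P] f) t
      \<in> tensors (Cs @ (As @ [Q, P] @ Bs) @ Ds)"
    by (rule linear_map_closed[OF leg_linear[OF Cs Ds m(5,6) l] t])
  have e: "cross_seq K f (Suc (length As) # is') (As @ [P, Q] @ Bs)
      = (\<lambda>t. cross_seq K f is' (As @ [Q, P] @ Bs) (leg K As Bs [P, Q] [Q, P] f t))"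
    using cross_seq_Cons by fastforce
  have "cross_seq K f (map ((+) (length Cs)) (Suc (length As) # is')) (Cs @ (As @ [P, Q] @ Bs) @ Ds) t
      = cross_seq K f (map ((+) (length Cs)) is') (Cs @ (As @ [Q, P] @ Bs) @ Ds)
          (leg K (Cs @ As) (Bs @ Ds) [P, Q] [Q, P] f t)"
    using cross_seq_Cons[of K f "Cs @ As" "map ((+) (length Cs)) is'" P Q "Bs @ Ds" t] by simp
  also have "\<dots> = cross_seq K f (map ((+) (length Cs)) is') (Cs @ (As @ [Q, P] @ Bs) @ Ds)
          (leg K Cs Ds (As @ [P, Q] @ Bs) (As @ [Q, P] @ Bs) (leg K As Bs [P, Q] [Q, P] f) t)"
    using leg_leg[OF Cs Ds m(1,2,3,4) f] t by simp
  also have "\<dots> = leg K Cs Ds (As @ [Q, P] @ Bs) Ns (cross_seq K f is' (As @ [Q, P] @ Bs))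
          (leg K Cs Ds (As @ [P, Q] @ Bs) (As @ [Q, P] @ Bs) (leg K As Bs [P, Q] [Q, P] f) t)"
    by (rule Cons.IH[OF m(6) c])
  also have "\<dots> = leg K Cs Ds (As @ [P, Q] @ Bs) Ns (cross_seq K f (Suc (length As) # is') (As @ [P, Q] @ Bs)) t"
    unfolding e by (rule leg_compose[OF Cs Ds m(5,6,7) l cs t])
  finally show ?case .
qed

text \<open>Carries a factorisation of \<open>h\<close> into two legs over to a larger list. The
  coincidences of lists are premises because a list such as \<open>replicate (n + k) P\<close>
  matches a concatenation only after rewriting.\<close>

lemma leg_decompose:
  assumes m: "modules Ms" "modules Ns"
    and m1: "modules As" "modules Bs" "modules Ps" "modules Qs"
    and m2: "modules Cs" "modules Ds" "modules Os" "modules Rs"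
    and f: "tlinear Ps Qs f" and g: "tlinear Os Rs g"
    and H: "Hs = As @ Ps @ Bs" "As @ Qs @ Bs = Cs @ Os @ Ds" "Js = Cs @ Rs @ Ds"
    and h: "tlinear Hs Js h"
    and eq: "\<And>x. x \<in> tensors Hs \<Longrightarrow> h x = leg K Cs Ds Os Rs g (leg K As Bs Ps Qs f x)"
    and t: "t \<in> tensors (Ms @ Hs @ Ns)"
  shows "leg K Ms Ns Hs Js h t = leg K (Ms @ Cs) (Ds @ Ns) Os Rs g (leg K (Ms @ As) (Bs @ Ns) Ps Qs f t)"
proof -
  have m': "modules (As @ Ps @ Bs)" "modules (As @ Qs @ Bs)"
      "modules (Cs @ Os @ Ds)" "modules (Cs @ Rs @ Ds)"
    using m1 m2 by simp_all
  note lf = leg_linear[OF m1 f] and lg = leg_linear[OF m2 g]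
  note lg' = lg[folded H(2)]
  \<comment> \<open>The intermediate list has two readings, as target of the first leg and as source
    of the second.\<close>
  have "Ms @ As @ Qs @ Bs @ Ns = Ms @ Cs @ Os @ Ds @ Ns"
    using H(2)[THEN arg_cong, of "\<lambda>x. Ms @ x @ Ns"] by simp
  moreover have "leg K (Ms @ As) (Bs @ Ns) Ps Qs f t \<in> tensors (Ms @ As @ Qs @ Bs @ Ns)"
    using linear_map_closed[OF leg_linear[of "Ms @ As" "Bs @ Ns", OF _ _ m1(3,4) f], of t] m m1 t H(1)
    by simp
  ultimately have c: "leg K (Ms @ As) (Bs @ Ns) Ps Qs f t \<in> tensors (Ms @ Cs @ Os @ Ds @ Ns)"
    by (simp only:)
  have "leg K Ms Ns Hs Js h t
      = leg K Ms Ns (As @ Ps @ Bs) (Cs @ Rs @ Ds) (\<lambda>x. leg K Cs Ds Os Rs g (leg K As Bs Ps Qs f x)) t"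
    unfolding H(1,3)
    by (rule leg_cong[OF m m'(1,4) h[unfolded H(1,3)] linear_map_compose[OF lf lg'] eq[unfolded H(1)] t[unfolded H(1)]])
  also have "\<dots> = leg K Ms Ns (Cs @ Os @ Ds) (Cs @ Rs @ Ds) (leg K Cs Ds Os Rs g)
      (leg K Ms Ns (As @ Ps @ Bs) (As @ Qs @ Bs) (leg K As Bs Ps Qs f) t)"
    using leg_compose[OF m m'(1,2,4) lf lg' t[unfolded H(1)]] by (simp add: H(2))
  also have "leg K Ms Ns (As @ Ps @ Bs) (As @ Qs @ Bs) (leg K As Bs Ps Qs f) t
      = leg K (Ms @ As) (Bs @ Ns) Ps Qs f t"
    by (rule leg_leg[OF m m1 f]) (use t H(1) in simp)
  also have "leg K Ms Ns (Cs @ Os @ Ds) (Cs @ Rs @ Ds) (leg K Cs Ds Os Rs g)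
      (leg K (Ms @ As) (Bs @ Ns) Ps Qs f t)
      = leg K (Ms @ Cs) (Ds @ Ns) Os Rs g (leg K (Ms @ As) (Bs @ Ns) Ps Qs f t)"
    by (rule leg_leg[OF m m2 g c])
  finally show ?thesis .
qed

end

section \<open>Block crossings and their multiplicativity in both sizes\<close>

section \<open>Block crossings\<close>

text \<open>The two kinds of strands are kept apart, so that one development serves
  \<open>psi\<close>, with \<open>P = V'\<close> and \<open>Q = V\<close>, as well as the braid
  products, where both kinds are the same space.\<close>

locale crossing = scalar_ring +
  fixes P Q :: "('a, 'v) module" and f
  assumes P: "module K P" and Q: "module K Q"
    and f: "tlinear [P, Q] [Q, P] f"
begin

abbreviation Ps :: "nat \<Rightarrow> ('a, 'v) module list" where "Ps n \<equiv> replicate n P"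
abbreviation Qs :: "nat \<Rightarrow> ('a, 'v) module list" where "Qs n \<equiv> replicate n Q"

definition block :: "nat \<Rightarrow> nat \<Rightarrow> ('v list \<Rightarrow> 'a) set \<Rightarrow> ('v list \<Rightarrow> 'a) set"
  where "block n m = cross_seq K f (block_crossing n m) (Ps n @ Qs m)"

lemma modules [simp]: "modules (Ps n)" "modules (Qs n)"
  using P Q by (simp_all add: list_all_length)

lemma modules' [simp]: "module K P" "module K Q"
  using P Q by simp_all

lemma block_linear: "tlinear (Ps n @ Qs m) (Qs m @ Ps n) (block n m)"
  unfolding block_def by (rule cross_seq_linear[OF crosses_block _ f]) simp

lemma block_linear_1: "tlinear (Ps n @ [Q]) (Q # Ps n) (block n (Suc 0))"
  using block_linear[of n "Suc 0"] by simp

lemma block_0: "block n 0 t = t" "block 0 m t = t"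
  by (simp_all add: block_def)

lemma block_1_1: "t \<in> tensors [P, Q] \<Longrightarrow> block (Suc 0) (Suc 0) t = f t"
  using cross_seq_Cons[of K f "[]" "[]" P Q "[]" t] leg_Nil[OF _ _ f]
  by (simp add: block_def block_crossing_1)

text \<open>The word for \<open>m + p\<close> is the word for \<open>m\<close> followed by a shifted
  word for \<open>p\<close>, so in this direction no crossings have to be rearranged.\<close>

lemma block_add_right:
  assumes t: "t \<in> tensors (Ps n @ Qs (m + p))"
  shows "block n (m + p) t = leg K (Qs m) [] (Ps n @ Qs p) (Qs p @ Ps n) (block n p)
    (leg K [] (Qs p) (Ps n @ Qs m) (Qs m @ Ps n) (block n m) t)"
proof -
  have t': "t \<in> tensors ([] @ (Ps n @ Qs m) @ Qs p)" using t by (simp add: replicate_add)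
  have 1: "cross_seq K f (block_crossing n m) ((Ps n @ Qs m) @ Qs p) t
      = leg K [] (Qs p) (Ps n @ Qs m) (Qs m @ Ps n) (block n m) t"
    using cross_seq_shift[OF crosses_block _ f _ _ t'] by (simp add: block_def map_plus_0)
  have c: "leg K [] (Qs p) (Ps n @ Qs m) (Qs m @ Ps n) (block n m) t
      \<in> tensors (Qs m @ (Ps n @ Qs p) @ [])"
    using linear_map_closed[OF leg_linear[OF _ _ _ _ block_linear] t'] by simp
  have 2: "cross_seq K f (map ((+) m) (block_crossing n p)) (Qs m @ Ps n @ Qs p)
        (leg K [] (Qs p) (Ps n @ Qs m) (Qs m @ Ps n) (block n m) t)
      = leg K (Qs m) [] (Ps n @ Qs p) (Qs p @ Ps n) (block n p)
        (leg K [] (Qs p) (Ps n @ Qs m) (Qs m @ Ps n) (block n m) t)"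
    using cross_seq_shift[OF crosses_block _ f _ _ c] by (simp add: block_def)
  have cr: "crosses P Q (block_crossing n m) ((Ps n @ Qs m) @ Qs p) (Qs m @ Ps n @ Qs p)"
    using crosses_shift[OF crosses_block[of P Q n m], of "[]" "Qs p"] by (simp add: map_plus_0)
  have "block n (m + p) t
      = cross_seq K f (block_crossing n m @ map ((+) m) (block_crossing n p)) ((Ps n @ Qs m) @ Qs p) t"
    by (simp add: block_def block_crossing_add replicate_add)
  then show ?thesis unfolding cross_seq_append[OF cr] 1 2 .
qed

lemma Qs_Suc: "Qs (Suc m) = Qs m @ [Q]"
  by (simp add: replicate_append_same)

lemma block_Suc_linear:
  "tlinear (Ps n @ Qs m @ [Q]) (Qs m @ Q # Ps n) (block n (Suc m))"
  using block_linear[of n "Suc m"] unfolding Qs_Suc by simp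

lemma block_Suc_right:
  assumes "t \<in> tensors (Ps n @ Qs m @ [Q])"
  shows "block n (Suc m) t = leg K (Qs m) [] (Ps n @ [Q]) (Q # Ps n) (block n (Suc 0))
    (leg K [] [Q] (Ps n @ Qs m) (Qs m @ Ps n) (block n m) t)"
  using block_add_right[of t n m "Suc 0"] assms by (simp add: replicate_append_same)

text \<open>A single \<open>Q\<close> passes the nearer \<open>k\<close> strands before the other
  \<open>n\<close>, so for one column the word does split along \<open>n + k\<close>.\<close>

lemma strand_add_left:
  assumes t: "t \<in> tensors (Ps (n + k) @ [Q])"
  shows "block (n + k) (Suc 0) t = leg K [] (Ps k) (Ps n @ [Q]) (Q # Ps n) (block n (Suc 0))
    (leg K (Ps n) [] (Ps k @ [Q]) (Q # Ps k) (block k (Suc 0)) t)"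
proof -
  have t': "t \<in> tensors (Ps n @ (Ps k @ [Q]) @ [])" using t by (simp add: replicate_add)
  have 1: "cross_seq K f (map ((+) n) (rev [1..<k + 1])) (Ps n @ (Ps k @ [Q])) t
      = leg K (Ps n) [] (Ps k @ [Q]) (Q # Ps k) (block k (Suc 0)) t"
    using cross_seq_shift[OF crosses_strand _ f _ _ t'] by (simp add: block_def block_crossing_1)
  have c: "leg K (Ps n) [] (Ps k @ [Q]) (Q # Ps k) (block k (Suc 0)) t
      \<in> tensors ([] @ (Ps n @ [Q]) @ Ps k)"
    using linear_map_closed[OF leg_linear[OF _ _ _ _ block_linear_1] t'] by simp
  have 2: "cross_seq K f (rev [1..<n + 1]) (Ps n @ [Q] @ Ps k)
        (leg K (Ps n) [] (Ps k @ [Q]) (Q # Ps k) (block k (Suc 0)) t)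
      = leg K [] (Ps k) (Ps n @ [Q]) (Q # Ps n) (block n (Suc 0))
        (leg K (Ps n) [] (Ps k @ [Q]) (Q # Ps k) (block k (Suc 0)) t)"
    using cross_seq_shift[OF crosses_strand _ f _ _ c] by (simp add: block_def block_crossing_1 map_plus_0)
  have cr: "crosses P Q (map ((+) n) (rev [1..<k + 1])) (Ps n @ (Ps k @ [Q])) (Ps n @ [Q] @ Ps k)"
    using crosses_shift[OF crosses_strand[of P Q k], of "Ps n" "[]"] by simp
  have "block (n + k) (Suc 0) t
      = cross_seq K f (map ((+) n) (rev [1..<k + 1]) @ rev [1..<n + 1]) (Ps n @ (Ps k @ [Q])) t"
    using strand_add[of n k] by (simp add: block_def block_crossing_1 replicate_add)
  then show ?thesis unfolding cross_seq_append[OF cr] 1 2 .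
qed

text \<open>With several columns the word does not split along \<open>n + k\<close>, since each
  \<open>Q\<close> passes all \<open>n + k\<close> strands before the next one starts. Hence the
  induction on \<open>m\<close>: the new \<open>Q\<close> is treated by the single-strand case, and
  one interchange sorts the crossings into the two blocks.\<close>

lemma block_add_left:
  assumes t: "t \<in> tensors (Ps (n + k) @ Qs m)"
  shows "block (n + k) m t = leg K [] (Ps k) (Ps n @ Qs m) (Qs m @ Ps n) (block n m)
    (leg K (Ps n) [] (Ps k @ Qs m) (Qs m @ Ps k) (block k m) t)"
  using t
proof (induction m arbitrary: t)
  case 0
  have i: "block n 0 = (\<lambda>t. t)" for n by (simp add: fun_eq_iff block_0)
  have "leg K (Ps n) [] (Ps k) (Ps k) (\<lambda>t. t) t = t"
    by (rule leg_ident) (use 0 in \<open>simp_all add: replicate_add\<close>)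
  moreover have "leg K [] (Ps k) (Ps n) (Ps n) (\<lambda>t. t) t = t"
    by (rule leg_ident) (use 0 in \<open>simp_all add: replicate_add\<close>)
  ultimately show ?case by (simp add: i)
next
  case (Suc m)
  let ?L1 = "leg K (Qs m) (Ps k) (Ps n @ [Q]) (Q # Ps n) (block n (Suc 0))"
  let ?L2 = "leg K (Qs m @ Ps n) [] (Ps k @ [Q]) (Q # Ps k) (block k (Suc 0))"
  let ?L3 = "leg K [] (Ps k @ [Q]) (Ps n @ Qs m) (Qs m @ Ps n) (block n m)"
  let ?L4 = "leg K (Ps n) [Q] (Ps k @ Qs m) (Qs m @ Ps k) (block k m)"
  let ?L2' = "leg K (Ps n @ Qs m) [] (Ps k @ [Q]) (Q # Ps k) (block k (Suc 0))"
  let ?L3' = "leg K [] (Q # Ps k) (Ps n @ Qs m) (Qs m @ Ps n) (block n m)"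
  note Q1 = Qs_Suc[of m]
  have t: "t \<in> tensors (Ps n @ Ps k @ Qs m @ [Q])"
    using Suc.prems unfolding Q1 by (simp add: replicate_add)
  have c4: "?L4 t \<in> tensors (Ps n @ Qs m @ Ps k @ [Q])"
    using linear_map_closed[OF leg_linear[OF _ _ _ _ block_linear[of k m], of "Ps n" "[Q]"], of t] t by simp
  have c34: "?L3 (?L4 t) \<in> tensors (Qs m @ Ps n @ Ps k @ [Q])"
    using linear_map_closed[OF leg_linear[OF _ _ _ _ block_linear[of n m], of "[]" "Ps k @ [Q]"], of "?L4 t"] c4
    by simp
  have "block (n + k) (m + Suc 0) t = leg K (Qs m) [] (Ps (n + k) @ [Q]) (Q # Ps (n + k)) (block (n + k) (Suc 0))
      (leg K [] [Q] (Ps (n + k) @ Qs m) (Qs m @ Ps (n + k)) (block (n + k) m) t)"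
    using block_add_right[of t "n + k" m "Suc 0"] Suc.prems by simp
  also have "leg K [] [Q] (Ps (n + k) @ Qs m) (Qs m @ Ps (n + k)) (block (n + k) m) t = ?L3 (?L4 t)"
    using leg_decompose[OF _ _ _ _ _ _ _ _ _ _ block_linear[of k m] block_linear[of n m] _ _ _
        block_linear[of "n + k" m] Suc.IH, of "[]" "[Q]" t] t
    by (simp add: replicate_add)
  also have "leg K (Qs m) [] (Ps (n + k) @ [Q]) (Q # Ps (n + k)) (block (n + k) (Suc 0)) (?L3 (?L4 t))
      = ?L1 (?L2 (?L3 (?L4 t)))"
    using leg_decompose[OF _ _ _ _ _ _ _ _ _ _ block_linear_1[of k] block_linear_1[of n] _ _ _
        block_linear_1[of "n + k"] strand_add_left, of "Qs m" "[]" "?L3 (?L4 t)"] c34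
    by (simp add: replicate_add)
  \<comment> \<open>The decisive interchange: the new \<open>Q\<close> passing the last
    \<open>k\<close> strands and the old \<open>m\<close> factors passing the first \<open>n\<close>
    strands touch disjoint parts of the list.\<close>
  also have "?L2 (?L3 (?L4 t)) = ?L3' (?L2' (?L4 t))"
    using leg_commute[OF _ _ _ _ _ _ _ block_linear[of n m] block_linear_1[of k], of "[]" "[]" "[]" "?L4 t"] c4
    by simp
  also have "?L2' (?L4 t) = leg K (Ps n) [] (Ps k @ Qs (Suc m)) (Qs (Suc m) @ Ps k) (block k (Suc m)) t"
    using leg_decompose[OF _ _ _ _ _ _ _ _ _ _ block_linear[of k m] block_linear_1[of k] _ _ _
        block_Suc_linear[of k m] block_Suc_right[of _ k m], of "Ps n" "[]" t] t
    unfolding Q1 by simp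
  also have "?L1 (?L3' \<dots>) = leg K [] (Ps k) (Ps n @ Qs (Suc m)) (Qs (Suc m) @ Ps n) (block n (Suc m))
      (leg K (Ps n) [] (Ps k @ Qs (Suc m)) (Qs (Suc m) @ Ps k) (block k (Suc m)) t)"
  proof -
    let ?t = "leg K (Ps n) [] (Ps k @ Qs (Suc m)) (Qs (Suc m) @ Ps k) (block k (Suc m)) t"
    have c: "?t \<in> tensors (Ps n @ Qs m @ [Q] @ Ps k)"
      using linear_map_closed[OF leg_linear[OF _ _ _ _ block_Suc_linear[of k m], of "Ps n" "[]"], of t] t
      unfolding Q1 by simp
    show ?thesis
      using leg_decompose[OF _ _ _ _ _ _ _ _ _ _ block_linear[of n m] block_linear_1[of n] _ _ _
        block_Suc_linear[of n m] block_Suc_right[of _ n m], of "[]" "Ps k" ?t] c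
      unfolding Q1 by simp
  qed
  finally show ?case by simp
qed

end

context scalar_ring
begin

text \<open>Functoriality of \<open>leg\<close> applied to a commuting square; in this form
  naturality squares are moved into a larger list.\<close>

lemma leg_square:
  assumes m: "modules Ms" "modules Ns" "modules Ps"
      "modules Qs" "modules Os" "modules Rs"
    and f: "tlinear Ps Qs f" and g: "tlinear Qs Rs g"
    and f': "tlinear Ps Os f'" and g': "tlinear Os Rs g'"
    and eq: "\<And>x. x \<in> tensors Ps \<Longrightarrow> g (f x) = g' (f' x)"
    and t: "t \<in> tensors (Ms @ Ps @ Ns)"
  shows "leg K Ms Ns Qs Rs g (leg K Ms Ns Ps Qs f t) = leg K Ms Ns Os Rs g' (leg K Ms Ns Ps Os f' t)"
  unfolding leg_compose[OF m(1,2,3,4,6) f g t] leg_compose[OF m(1,2,3,5,6) f' g' t]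
  by (rule leg_cong[OF m(1,2,3,6) linear_map_compose[OF f g] linear_map_compose[OF f' g'] eq t])

end

section \<open>Naturality of block crossings\<close>

context crossing
begin

text \<open>An endomorphism of the \<open>Q\<close> factors slides through the block crossing.
  Linearity belongs to the predicate because every rule for \<open>leg\<close> asks for it, and the
  inductions below have to hand it on.\<close>

definition right_natural :: "nat \<Rightarrow> nat \<Rightarrow> (('v list \<Rightarrow> 'a) set \<Rightarrow> ('v list \<Rightarrow> 'a) set) \<Rightarrow> bool"
  where "right_natural n m g \<longleftrightarrow> tlinear (Qs m) (Qs m) g \<and>
    (\<forall>t\<in>tensors (Ps n @ Qs m).
      block n m (leg K (Ps n) [] (Qs m) (Qs m) g t) = leg K [] (Ps n) (Qs m) (Qs m) g (block n m t))"

definition left_natural :: "nat \<Rightarrow> nat \<Rightarrow> (('v list \<Rightarrow> 'a) set \<Rightarrow> ('v list \<Rightarrow> 'a) set) \<Rightarrow> bool"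
  where "left_natural n m g \<longleftrightarrow> tlinear (Ps n) (Ps n) g \<and>
    (\<forall>t\<in>tensors (Ps n @ Qs m).
      block n m (leg K [] (Qs m) (Ps n) (Ps n) g t) = leg K (Qs m) [] (Ps n) (Ps n) g (block n m t))"

lemma leg_block_linear:
  assumes "modules Ms" "modules Ns"
  shows "tlinear (Ms @ Ps n @ Qs m @ Ns) (Ms @ Qs m @ Ps n @ Ns)
    (leg K Ms Ns (Ps n @ Qs m) (Qs m @ Ps n) (block n m))"
  using leg_linear[OF assms _ _ block_linear[of n m]] by simp

text \<open>By \<open>block_add_left\<close> the crossing is a composite of two; \<open>g\<close>
  slides past the last \<open>k\<close> strands and then past the first \<open>n\<close>.\<close>

lemma right_natural_add_left:
  assumes 1: "right_natural n m g" and 2: "right_natural k m g"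
  shows "right_natural (n + k) m g"
  unfolding right_natural_def
proof (intro conjI ballI)
  note g = 1[unfolded right_natural_def, THEN conjunct1] and n1 = 1[unfolded right_natural_def, THEN conjunct2, rule_format]
  note n2 = 2[unfolded right_natural_def, THEN conjunct2, rule_format]
  show "tlinear (Qs m) (Qs m) g" by (rule g)
  fix t assume "t \<in> tensors (Ps (n + k) @ Qs m)"
  then have t: "t \<in> tensors (Ps n @ Ps k @ Qs m)" by (simp add: replicate_add)
  have lg: "tlinear (Ms @ Qs m @ Ns) (Ms @ Qs m @ Ns) (leg K Ms Ns (Qs m) (Qs m) g)"
    if "modules Ms" "modules Ns" for Ms Ns
    using leg_linear[OF that _ _ g] by simp
  let ?B1 = "leg K [] (Ps k) (Ps n @ Qs m) (Qs m @ Ps n) (block n m)"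
  let ?B2 = "leg K (Ps n) [] (Ps k @ Qs m) (Qs m @ Ps k) (block k m)"
  have B: "block (n + k) m x = ?B1 (?B2 x)" if "x \<in> tensors (Ps n @ Ps k @ Qs m)" for x
    using block_add_left[of x n k m] that by (simp add: replicate_add)
  let ?u = "?B2 t"
  have u: "?u \<in> tensors (Ps n @ Qs m @ Ps k)"
    using linear_map_closed[OF leg_block_linear[of "Ps n" "[]" k m], of t] t by simp
  have v: "?B1 ?u \<in> tensors (Qs m @ Ps n @ Ps k)"
    using linear_map_closed[OF leg_block_linear[of "[]" "Ps k" n m], of ?u] u by simp
  have c: "leg K (Ps n @ Ps k) [] (Qs m) (Qs m) g t \<in> tensors (Ps n @ Ps k @ Qs m)"
    using linear_map_closed[OF lg[of "Ps n @ Ps k" "[]"], of t] t by simp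
  have "block (n + k) m (leg K (Ps n @ Ps k) [] (Qs m) (Qs m) g t)
      = ?B1 (?B2 (leg K (Ps n) [] (Ps k @ Qs m) (Ps k @ Qs m) (leg K (Ps k) [] (Qs m) (Qs m) g) t))"
    unfolding B[OF c] using leg_leg[OF _ _ _ _ _ _ g, of "Ps n" "[]" "Ps k" "[]" t] t by simp
  also have "?B2 (leg K (Ps n) [] (Ps k @ Qs m) (Ps k @ Qs m) (leg K (Ps k) [] (Qs m) (Qs m) g) t)
      = leg K (Ps n) [] (Qs m @ Ps k) (Qs m @ Ps k) (leg K [] (Ps k) (Qs m) (Qs m) g) ?u"
    using leg_square[OF _ _ _ _ _ _ lg[of "Ps k" "[]", simplified] block_linear block_linear
      lg[of "[]" "Ps k", simplified] n2, of "Ps n" "[]" t] t by simp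
  \<comment> \<open>Two uses of \<open>leg_leg\<close> regroup the factors around \<open>g\<close>,
    so that the second naturality square fits.\<close>
  also have "\<dots> = leg K [] (Ps k) (Ps n @ Qs m) (Ps n @ Qs m) (leg K (Ps n) [] (Qs m) (Qs m) g) ?u"
    using leg_leg[OF _ _ _ _ _ _ g, of "Ps n" "[]" "[]" "Ps k" ?u]
      leg_leg[OF _ _ _ _ _ _ g, of "[]" "Ps k" "Ps n" "[]" ?u] u by simp
  also have "?B1 \<dots> = leg K [] (Ps k) (Qs m @ Ps n) (Qs m @ Ps n) (leg K [] (Ps n) (Qs m) (Qs m) g) (?B1 ?u)"
    using leg_square[OF _ _ _ _ _ _ lg[of "Ps n" "[]", simplified] block_linear block_linear
      lg[of "[]" "Ps n", simplified] n1, of "[]" "Ps k" ?u] u by simp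
  also have "\<dots> = leg K [] (Ps n @ Ps k) (Qs m) (Qs m) g (?B1 ?u)"
    using leg_leg[OF _ _ _ _ _ _ g, of "[]" "Ps k" "[]" "Ps n" "?B1 ?u"] v by simp
  also have "?B1 ?u = block (n + k) m t" using B[OF t] by simp
  finally show "block (n + k) m (leg K (Ps (n + k)) [] (Qs m) (Qs m) g t)
      = leg K [] (Ps (n + k)) (Qs m) (Qs m) g (block (n + k) m t)"
    by (simp add: replicate_add)
qed

text \<open>The mirror image, with \<open>block_add_right\<close> as the cut: \<open>g\<close>
  slides past the first \<open>m\<close> factors \<open>Q\<close> and then past the other
  \<open>p\<close>.\<close>

lemma left_natural_add_right:
  assumes 1: "left_natural n m g" and 2: "left_natural n p g"
  shows "left_natural n (m + p) g"
  unfolding left_natural_def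
proof (intro conjI ballI)
  note g = 1[unfolded left_natural_def, THEN conjunct1] and n1 = 1[unfolded left_natural_def, THEN conjunct2, rule_format]
  note n2 = 2[unfolded left_natural_def, THEN conjunct2, rule_format]
  show "tlinear (Ps n) (Ps n) g" by (rule g)
  fix t assume "t \<in> tensors (Ps n @ Qs (m + p))"
  then have t: "t \<in> tensors (Ps n @ Qs m @ Qs p)" by (simp add: replicate_add)
  have lg: "tlinear (Ms @ Ps n @ Ns) (Ms @ Ps n @ Ns) (leg K Ms Ns (Ps n) (Ps n) g)"
    if "modules Ms" "modules Ns" for Ms Ns
    using leg_linear[OF that _ _ g] by simp
  let ?B1 = "leg K (Qs m) [] (Ps n @ Qs p) (Qs p @ Ps n) (block n p)"
  let ?B2 = "leg K [] (Qs p) (Ps n @ Qs m) (Qs m @ Ps n) (block n m)"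
  have B: "block n (m + p) x = ?B1 (?B2 x)" if "x \<in> tensors (Ps n @ Qs m @ Qs p)" for x
    using block_add_right[of x n m p] that by (simp add: replicate_add)
  let ?u = "?B2 t"
  have u: "?u \<in> tensors (Qs m @ Ps n @ Qs p)"
    using linear_map_closed[OF leg_block_linear[of "[]" "Qs p" n m], of t] t by simp
  have v: "?B1 ?u \<in> tensors (Qs m @ Qs p @ Ps n)"
    using linear_map_closed[OF leg_block_linear[of "Qs m" "[]" n p], of ?u] u by simp
  have c: "leg K [] (Qs m @ Qs p) (Ps n) (Ps n) g t \<in> tensors (Ps n @ Qs m @ Qs p)"
    using linear_map_closed[OF lg[of "[]" "Qs m @ Qs p"], of t] t by simp
  have "block n (m + p) (leg K [] (Qs m @ Qs p) (Ps n) (Ps n) g t)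
      = ?B1 (?B2 (leg K [] (Qs p) (Ps n @ Qs m) (Ps n @ Qs m) (leg K [] (Qs m) (Ps n) (Ps n) g) t))"
    unfolding B[OF c] using leg_leg[OF _ _ _ _ _ _ g, of "[]" "Qs p" "[]" "Qs m" t] t by simp
  also have "?B2 (leg K [] (Qs p) (Ps n @ Qs m) (Ps n @ Qs m) (leg K [] (Qs m) (Ps n) (Ps n) g) t)
      = leg K [] (Qs p) (Qs m @ Ps n) (Qs m @ Ps n) (leg K (Qs m) [] (Ps n) (Ps n) g) ?u"
    using leg_square[OF _ _ _ _ _ _ lg[of "[]" "Qs m", simplified] block_linear block_linear
      lg[of "Qs m" "[]", simplified] n1, of "[]" "Qs p" t] t by simp
  also have "\<dots> = leg K (Qs m) [] (Ps n @ Qs p) (Ps n @ Qs p) (leg K [] (Qs p) (Ps n) (Ps n) g) ?u"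
    using leg_leg[OF _ _ _ _ _ _ g, of "[]" "Qs p" "Qs m" "[]" ?u]
      leg_leg[OF _ _ _ _ _ _ g, of "Qs m" "[]" "[]" "Qs p" ?u] u by simp
  also have "?B1 \<dots> = leg K (Qs m) [] (Qs p @ Ps n) (Qs p @ Ps n) (leg K (Qs p) [] (Ps n) (Ps n) g) (?B1 ?u)"
    using leg_square[OF _ _ _ _ _ _ lg[of "[]" "Qs p", simplified] block_linear block_linear
      lg[of "Qs p" "[]", simplified] n2, of "Qs m" "[]" ?u] u by simp
  also have "\<dots> = leg K (Qs m @ Qs p) [] (Ps n) (Ps n) g (?B1 ?u)"
    using leg_leg[OF _ _ _ _ _ _ g, of "Qs m" "[]" "Qs p" "[]" "?B1 ?u"] v by simp
  also have "?B1 ?u = block n (m + p) t" using B[OF t] by simp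
  finally show "block n (m + p) (leg K [] (Qs (m + p)) (Ps n) (Ps n) g t)
      = leg K (Qs (m + p)) [] (Ps n) (Ps n) g (block n (m + p) t)"
    by (simp add: replicate_add)
qed

text \<open>Strands are added one at a time, starting from none, where the block crossing is the
  identity. So only the square for a single strand has to be verified.\<close>

lemma right_natural_all:
  assumes "right_natural (Suc 0) m g"
  shows "right_natural n m g"
proof (induction n)
  case 0
  then show ?case using assms by (simp add: right_natural_def block_0)
next
  case (Suc n)
  then show ?case using right_natural_add_left[OF assms Suc] by simp
qed

lemma left_natural_all:
  assumes "left_natural n (Suc 0) g"
  shows "left_natural n m g"
proof (induction m)
  case 0
  then show ?case using assms by (simp add: left_natural_def block_0)
next
  case (Suc m)
  then show ?case using left_natural_add_right[OF assms Suc] by simp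
qed

text \<open>The crossing is cut into three at the ends of the block on which \<open>g\<close> acts.
  The outer pieces commute with \<open>g\<close> because they touch other factors, the middle one by
  assumption. The bracketing \<open>a + (m + b)\<close> fits two uses of
  \<open>block_add_right\<close>.\<close>

lemma right_natural_leg:
  assumes 1: "right_natural n m g"
  shows "right_natural n (a + (m + b)) (leg K (Qs a) (Qs b) (Qs m) (Qs m) g)"
proof -
  note g = 1[unfolded right_natural_def, THEN conjunct1] and n1 = 1[unfolded right_natural_def, THEN conjunct2, rule_format]
  have lg: "tlinear (Ms @ Qs m @ Ns) (Ms @ Qs m @ Ns) (leg K Ms Ns (Qs m) (Qs m) g)"
    if "modules Ms" "modules Ns" for Ms Ns
    using leg_linear[OF that _ _ g] by simp
  let ?B1 = "leg K (Qs a @ Qs m) [] (Ps n @ Qs b) (Qs b @ Ps n) (block n b)"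
  let ?B2 = "leg K (Qs a) (Qs b) (Ps n @ Qs m) (Qs m @ Ps n) (block n m)"
  let ?B3 = "leg K [] (Qs m @ Qs b) (Ps n @ Qs a) (Qs a @ Ps n) (block n a)"
  have c3: "?B3 x \<in> tensors (Qs a @ Ps n @ Qs m @ Qs b)"
    if "x \<in> tensors (Ps n @ Qs a @ Qs m @ Qs b)" for x
    using linear_map_closed[OF leg_block_linear[of "[]" "Qs m @ Qs b" n a], of x] that by simp
  have c2: "?B2 x \<in> tensors (Qs a @ Qs m @ Ps n @ Qs b)"
    if "x \<in> tensors (Qs a @ Ps n @ Qs m @ Qs b)" for x
    using linear_map_closed[OF leg_block_linear[of "Qs a" "Qs b" n m], of x] that by simp
  have c1: "?B1 x \<in> tensors (Qs a @ Qs m @ Qs b @ Ps n)"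
    if "x \<in> tensors (Qs a @ Qs m @ Ps n @ Qs b)" for x
    using linear_map_closed[OF leg_block_linear[of "Qs a @ Qs m" "[]" n b], of x] that by simp
  have B: "block n (a + (m + b)) x = ?B1 (?B2 (?B3 x))"
    if "x \<in> tensors (Ps n @ Qs a @ Qs m @ Qs b)" for x
    using block_add_right[of x n a "m + b"] that
      leg_decompose[OF _ _ _ _ _ _ _ _ _ _ block_linear[of n m] block_linear[of n b] _ _ _
        block_linear[of n "m + b"] block_add_right[of _ n m b], of "Qs a" "[]" "?B3 x"] c3[OF that]
    by (simp add: replicate_add)
  show ?thesis
    unfolding right_natural_def
  proof (intro conjI ballI)
    show "tlinear (Qs (a + (m + b))) (Qs (a + (m + b)))
        (leg K (Qs a) (Qs b) (Qs m) (Qs m) g)"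
      using lg[of "Qs a" "Qs b"] by (simp add: replicate_add)
    let ?G = "leg K (Qs a) (Qs b) (Qs m) (Qs m) g"
    fix t assume "t \<in> tensors (Ps n @ Qs (a + (m + b)))"
    then have t: "t \<in> tensors (Ps n @ Qs a @ Qs m @ Qs b)" by (simp add: replicate_add)
    note c = c3[OF t] c2[OF c3[OF t]] c1[OF c2[OF c3[OF t]]]
    have cg: "leg K (Ps n @ Qs a) (Qs b) (Qs m) (Qs m) g t \<in> tensors (Ps n @ Qs a @ Qs m @ Qs b)"
      using linear_map_closed[OF lg[of "Ps n @ Qs a" "Qs b"], of t] t by simp
    have "block n (a + (m + b)) (leg K (Ps n) [] (Qs a @ Qs m @ Qs b) (Qs a @ Qs m @ Qs b) ?G t)
        = ?B1 (?B2 (?B3 (leg K (Ps n @ Qs a) (Qs b) (Qs m) (Qs m) g t)))"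
      using B[OF cg] leg_leg[OF _ _ _ _ _ _ g, of "Ps n" "[]" "Qs a" "Qs b" t] t by simp
    also have "?B3 (leg K (Ps n @ Qs a) (Qs b) (Qs m) (Qs m) g t)
        = leg K (Qs a @ Ps n) (Qs b) (Qs m) (Qs m) g (?B3 t)"
      using leg_commute[OF _ _ _ _ _ _ _ block_linear[of n a] g, of "[]" "[]" "Qs b" t] t by simp
    also have "\<dots> = leg K (Qs a) (Qs b) (Ps n @ Qs m) (Ps n @ Qs m) (leg K (Ps n) [] (Qs m) (Qs m) g) (?B3 t)"
      using leg_leg[OF _ _ _ _ _ _ g, of "Qs a" "Qs b" "Ps n" "[]" "?B3 t"] c by simp
    also have "?B2 \<dots> = leg K (Qs a) (Qs b) (Qs m @ Ps n) (Qs m @ Ps n)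
        (leg K [] (Ps n) (Qs m) (Qs m) g) (?B2 (?B3 t))"
      using leg_square[OF _ _ _ _ _ _ lg[of "Ps n" "[]", simplified] block_linear block_linear
        lg[of "[]" "Ps n", simplified] n1, of "Qs a" "Qs b" "?B3 t"] c by simp
    also have "\<dots> = leg K (Qs a) (Ps n @ Qs b) (Qs m) (Qs m) g (?B2 (?B3 t))"
      using leg_leg[OF _ _ _ _ _ _ g, of "Qs a" "Qs b" "[]" "Ps n" "?B2 (?B3 t)"] c by simp
    also have "?B1 \<dots> = leg K (Qs a) (Qs b @ Ps n) (Qs m) (Qs m) g (?B1 (?B2 (?B3 t)))"
      using leg_commute[OF _ _ _ _ _ _ _ g block_linear[of n b], of "Qs a" "[]" "[]" "?B2 (?B3 t)"] c by simp
    also have "\<dots> = leg K [] (Ps n) (Qs a @ Qs m @ Qs b) (Qs a @ Qs m @ Qs b) ?G (block n (a + (m + b)) t)"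
      using leg_leg[OF _ _ _ _ _ _ g, of "[]" "Ps n" "Qs a" "Qs b" "?B1 (?B2 (?B3 t))"] c B[OF t] by simp
    finally show "block n (a + (m + b)) (leg K (Ps n) [] (Qs (a + (m + b))) (Qs (a + (m + b))) ?G t)
        = leg K [] (Ps n) (Qs (a + (m + b))) (Qs (a + (m + b))) ?G (block n (a + (m + b)) t)"
      by (simp add: replicate_add)
  qed
qed

text \<open>The same cut among the \<open>P\<close> strands, made by \<open>block_add_left\<close>;
  here the last \<open>b\<close> strands cross first.\<close>

lemma left_natural_leg:
  assumes 1: "left_natural n m g"
  shows "left_natural (a + (n + b)) m (leg K (Ps a) (Ps b) (Ps n) (Ps n) g)"
proof -
  note g = 1[unfolded left_natural_def, THEN conjunct1] and n1 = 1[unfolded left_natural_def, THEN conjunct2, rule_format]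
  have lg: "tlinear (Ms @ Ps n @ Ns) (Ms @ Ps n @ Ns) (leg K Ms Ns (Ps n) (Ps n) g)"
    if "modules Ms" "modules Ns" for Ms Ns
    using leg_linear[OF that _ _ g] by simp
  let ?B1 = "leg K [] (Ps n @ Ps b) (Ps a @ Qs m) (Qs m @ Ps a) (block a m)"
  let ?B2 = "leg K (Ps a) (Ps b) (Ps n @ Qs m) (Qs m @ Ps n) (block n m)"
  let ?B3 = "leg K (Ps a @ Ps n) [] (Ps b @ Qs m) (Qs m @ Ps b) (block b m)"
  have c3: "?B3 x \<in> tensors (Ps a @ Ps n @ Qs m @ Ps b)"
    if "x \<in> tensors (Ps a @ Ps n @ Ps b @ Qs m)" for x
    using linear_map_closed[OF leg_block_linear[of "Ps a @ Ps n" "[]" b m], of x] that by simp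
  have c2: "?B2 x \<in> tensors (Ps a @ Qs m @ Ps n @ Ps b)"
    if "x \<in> tensors (Ps a @ Ps n @ Qs m @ Ps b)" for x
    using linear_map_closed[OF leg_block_linear[of "Ps a" "Ps b" n m], of x] that by simp
  have c1: "?B1 x \<in> tensors (Qs m @ Ps a @ Ps n @ Ps b)"
    if "x \<in> tensors (Ps a @ Qs m @ Ps n @ Ps b)" for x
    using linear_map_closed[OF leg_block_linear[of "[]" "Ps n @ Ps b" a m], of x] that by simp
  have B: "block (a + (n + b)) m x = ?B1 (?B2 (?B3 x))"
    if "x \<in> tensors (Ps a @ Ps n @ Ps b @ Qs m)" for x
    using block_add_left[of x a "n + b" m] that
      leg_decompose[OF _ _ _ _ _ _ _ _ _ _ block_linear[of b m] block_linear[of n m] _ _ _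
        block_linear[of "n + b" m] block_add_left[of _ n b m], of "Ps a" "[]" x]
    by (simp add: replicate_add)
  show ?thesis
    unfolding left_natural_def
  proof (intro conjI ballI)
    show "tlinear (Ps (a + (n + b))) (Ps (a + (n + b)))
        (leg K (Ps a) (Ps b) (Ps n) (Ps n) g)"
      using lg[of "Ps a" "Ps b"] by (simp add: replicate_add)
    let ?G = "leg K (Ps a) (Ps b) (Ps n) (Ps n) g"
    fix t assume "t \<in> tensors (Ps (a + (n + b)) @ Qs m)"
    then have t: "t \<in> tensors (Ps a @ Ps n @ Ps b @ Qs m)" by (simp add: replicate_add)
    note c = c3[OF t] c2[OF c3[OF t]] c1[OF c2[OF c3[OF t]]]
    have cg: "leg K (Ps a) (Ps b @ Qs m) (Ps n) (Ps n) g t \<in> tensors (Ps a @ Ps n @ Ps b @ Qs m)"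
      using linear_map_closed[OF lg[of "Ps a" "Ps b @ Qs m"], of t] t by simp
    have "block (a + (n + b)) m (leg K [] (Qs m) (Ps a @ Ps n @ Ps b) (Ps a @ Ps n @ Ps b) ?G t)
        = ?B1 (?B2 (?B3 (leg K (Ps a) (Ps b @ Qs m) (Ps n) (Ps n) g t)))"
      using B[OF cg] leg_leg[OF _ _ _ _ _ _ g, of "[]" "Qs m" "Ps a" "Ps b" t] t by simp
    also have "?B3 (leg K (Ps a) (Ps b @ Qs m) (Ps n) (Ps n) g t)
        = leg K (Ps a) (Qs m @ Ps b) (Ps n) (Ps n) g (?B3 t)"
      using leg_commute[OF _ _ _ _ _ _ _ g block_linear[of b m], of "Ps a" "[]" "[]" t] t by simp
    also have "\<dots> = leg K (Ps a) (Ps b) (Ps n @ Qs m) (Ps n @ Qs m) (leg K [] (Qs m) (Ps n) (Ps n) g) (?B3 t)"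
      using leg_leg[OF _ _ _ _ _ _ g, of "Ps a" "Ps b" "[]" "Qs m" "?B3 t"] c by simp
    also have "?B2 \<dots> = leg K (Ps a) (Ps b) (Qs m @ Ps n) (Qs m @ Ps n)
        (leg K (Qs m) [] (Ps n) (Ps n) g) (?B2 (?B3 t))"
      using leg_square[OF _ _ _ _ _ _ lg[of "[]" "Qs m", simplified] block_linear block_linear
        lg[of "Qs m" "[]", simplified] n1, of "Ps a" "Ps b" "?B3 t"] c by simp
    also have "\<dots> = leg K (Ps a @ Qs m) (Ps b) (Ps n) (Ps n) g (?B2 (?B3 t))"
      using leg_leg[OF _ _ _ _ _ _ g, of "Ps a" "Ps b" "Qs m" "[]" "?B2 (?B3 t)"] c by simp
    also have "?B1 \<dots> = leg K (Qs m @ Ps a) (Ps b) (Ps n) (Ps n) g (?B1 (?B2 (?B3 t)))"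
      using leg_commute[OF _ _ _ _ _ _ _ block_linear[of a m] g, of "[]" "[]" "Ps b" "?B2 (?B3 t)"] c by simp
    also have "\<dots> = leg K (Qs m) [] (Ps a @ Ps n @ Ps b) (Ps a @ Ps n @ Ps b) ?G (block (a + (n + b)) m t)"
      using leg_leg[OF _ _ _ _ _ _ g, of "Qs m" "[]" "Ps a" "Ps b" "?B1 (?B2 (?B3 t))"] c B[OF t] by simp
    finally show "block (a + (n + b)) m (leg K [] (Qs m) (Ps (a + (n + b))) (Ps (a + (n + b))) ?G t)
        = leg K (Qs m) [] (Ps (a + (n + b))) (Ps (a + (n + b))) ?G (block (a + (n + b)) m t)"
      by (simp add: replicate_add)
  qed
qed

lemma right_natural_compose:
  assumes 1: "right_natural n m g" and 2: "right_natural n m h"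
  shows "right_natural n m (\<lambda>x. h (g x))"
  unfolding right_natural_def
proof (intro conjI ballI)
  note g = 1[unfolded right_natural_def, THEN conjunct1] and n1 = 1[unfolded right_natural_def, THEN conjunct2, rule_format]
  note h = 2[unfolded right_natural_def, THEN conjunct1] and n2 = 2[unfolded right_natural_def, THEN conjunct2, rule_format]
  from g h show "tlinear (Qs m) (Qs m) (\<lambda>x. h (g x))"
    by (rule linear_map_compose)
  fix t assume t: "t \<in> tensors (Ps n @ Qs m)"
  have c: "leg K (Ps n) [] (Qs m) (Qs m) g t \<in> tensors (Ps n @ Qs m)"
    using linear_map_closed[OF leg_linear[OF _ _ _ _ g], of "Ps n" "[]" t] t by simp
  have b: "block n m t \<in> tensors (Qs m @ Ps n)" by (rule linear_map_closed[OF block_linear t])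
  show "block n m (leg K (Ps n) [] (Qs m) (Qs m) (\<lambda>x. h (g x)) t)
      = leg K [] (Ps n) (Qs m) (Qs m) (\<lambda>x. h (g x)) (block n m t)"
    using leg_compose[OF _ _ _ _ _ g h, of "Ps n" "[]" t] leg_compose[OF _ _ _ _ _ g h, of "[]" "Ps n" "block n m t"]
      t b n1[OF t] n2[OF c] by simp
qed

lemma left_natural_compose:
  assumes 1: "left_natural n m g" and 2: "left_natural n m h"
  shows "left_natural n m (\<lambda>x. h (g x))"
  unfolding left_natural_def
proof (intro conjI ballI)
  note g = 1[unfolded left_natural_def, THEN conjunct1] and n1 = 1[unfolded left_natural_def, THEN conjunct2, rule_format]
  note h = 2[unfolded left_natural_def, THEN conjunct1] and n2 = 2[unfolded left_natural_def, THEN conjunct2, rule_format]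
  from g h show "tlinear (Ps n) (Ps n) (\<lambda>x. h (g x))"
    by (rule linear_map_compose)
  fix t assume t: "t \<in> tensors (Ps n @ Qs m)"
  have c: "leg K [] (Qs m) (Ps n) (Ps n) g t \<in> tensors (Ps n @ Qs m)"
    using linear_map_closed[OF leg_linear[OF _ _ _ _ g], of "[]" "Qs m" t] t by simp
  have b: "block n m t \<in> tensors (Qs m @ Ps n)" by (rule linear_map_closed[OF block_linear t])
  show "block n m (leg K [] (Qs m) (Ps n) (Ps n) (\<lambda>x. h (g x)) t)
      = leg K (Qs m) [] (Ps n) (Ps n) (\<lambda>x. h (g x)) (block n m t)"
    using leg_compose[OF _ _ _ _ _ g h, of "[]" "Qs m" t] leg_compose[OF _ _ _ _ _ g h, of "Qs m" "[]" "block n m t"]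
      t b n1[OF t] n2[OF c] by simp
qed

lemma replicate_split:
  assumes "As @ [x, x] @ Bs = replicate m x"
  obtains a b where "As = replicate a x" "Bs = replicate b x" "m = a + (2 + b)"
proof
  have "\<forall>y\<in>set (As @ [x, x] @ Bs). y = x" unfolding assms by simp
  then show "As = replicate (length As) x" "Bs = replicate (length Bs) x"
    by (auto intro!: replicate_eqI)
  show "m = length As + (2 + length Bs)" using assms[THEN arg_cong, of length] by simp
qed

lemma right_natural_ident: "right_natural n m (\<lambda>x. x)"
  using block_linear[of n m] leg_ident[of "Ps n" "[]" "Qs m"] leg_ident[of "[]" "Ps n" "Qs m"]
  by (auto simp: right_natural_def linear_map_ident dest: linear_map_closed)

lemma left_natural_ident: "left_natural n m (\<lambda>x. x)"
  using block_linear[of n m] leg_ident[of "Qs m" "[]" "Ps n"] leg_ident[of "[]" "Qs m" "Ps n"]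
  by (auto simp: left_natural_def linear_map_ident dest: linear_map_closed)

text \<open>Each letter applies \<open>g\<close> to two neighbouring factors and is natural by
  \<open>right_natural_leg\<close>; composites of natural maps are natural. As all factors are
  equal, every intermediate list is again \<open>Qs m\<close>, so one predicate fits all stages of
  the word.\<close>

lemma right_natural_cross_seq:
  assumes g: "right_natural n 2 g" and c: "crosses Q Q is (Qs m) Ns"
  shows "right_natural n m (cross_seq K g is (Qs m))"
  using c
proof (induction "is" "Qs m" Ns rule: crosses.induct)
  case Nil
  have "cross_seq K g [] (Qs m) = (\<lambda>x. x)" by (simp add: fun_eq_iff)
  then show ?case using right_natural_ident[of n m] by simp
next
  case (Cons is' As Bs Ns)
  obtain a b where ab: "As = Qs a" "Bs = Qs b" "m = a + (2 + b)"
    using replicate_split[OF Cons.hyps(3)] .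
  have e: "cross_seq K g (Suc (length As) # is') (Qs m)
      = (\<lambda>t. cross_seq K g is' (Qs m) (leg K (Qs a) (Qs b) (Qs 2) (Qs 2) g t))"
    using cross_seq_Cons[of K g As is' Q Q Bs] Cons.hyps(3)
    by (simp add: ab fun_eq_iff numeral_2_eq_2)
  show ?case
    unfolding e
    by (rule right_natural_compose[OF _ Cons.hyps(2)])
      (use right_natural_leg[OF g, of a b] Cons.hyps(3) ab in \<open>simp_all\<close>)
qed

lemma left_natural_cross_seq:
  assumes g: "left_natural 2 m g" and c: "crosses P P is (Ps n) Ns"
  shows "left_natural n m (cross_seq K g is (Ps n))"
  using c
proof (induction "is" "Ps n" Ns rule: crosses.induct)
  case Nil
  have "cross_seq K g [] (Ps n) = (\<lambda>x. x)" by (simp add: fun_eq_iff)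
  then show ?case using left_natural_ident[of n m] by simp
next
  case (Cons is' As Bs Ns)
  obtain a b where ab: "As = Ps a" "Bs = Ps b" "n = a + (2 + b)"
    using replicate_split[OF Cons.hyps(3)] .
  have e: "cross_seq K g (Suc (length As) # is') (Ps n)
      = (\<lambda>t. cross_seq K g is' (Ps n) (leg K (Ps a) (Ps b) (Ps 2) (Ps 2) g t))"
    using cross_seq_Cons[of K g As is' P P Bs] Cons.hyps(3)
    by (simp add: ab fun_eq_iff numeral_2_eq_2)
  show ?case
    unfolding e
    by (rule left_natural_compose[OF _ Cons.hyps(2)])
      (use left_natural_leg[OF g, of a b] Cons.hyps(3) ab in \<open>simp_all\<close>)
qed

end

section \<open>From Yang-Baxter systems to braid relations\<close>

section \<open>Yang--Baxter systems\<close>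

context scalar_ring
begin

lemma unit_closed: "pure K [] [] \<in> tensors []"
  by (rule pure_closed) auto

lemma leg_left:
  assumes m: "modules Ns" "modules Ps" "modules Qs"
    and f: "tlinear Ps Qs f"
    and t: "t \<in> tensors Ps" and u: "u \<in> tensors Ns"
  shows "leg K [] Ns Ps Qs f (tcat K Ps Ns t u) = tcat K Qs Ns (f t) u"
  using leg_tcat[OF _ m f unit_closed t u] m t u linear_map_closed[OF f t]
  by (simp add: tcat_Nil_left tcat_closed)

lemma leg_right:
  assumes m: "modules Ms" "modules Ps" "modules Qs"
    and f: "tlinear Ps Qs f"
    and s: "s \<in> tensors Ms" and t: "t \<in> tensors Ps"
  shows "leg K Ms [] Ps Qs f (tcat K Ms Ps s t) = tcat K Ms Qs s (f t)"
  using leg_tcat[OF m(1) _ m(2,3) f s t unit_closed] m t s linear_map_closed[OF f t]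
  by (simp add: tcat_Nil_right tcat_closed)

lemma flip_properties:
  assumes P: "module K P" and Q: "module K Q"
  shows flip_linear: "tlinear [P, Q] [Q, P] (flip K P Q)"
    and flip_pure: "x \<in> carrier P \<Longrightarrow> y \<in> carrier Q \<Longrightarrow>
      flip K P Q (pure K [P, Q] [x, y]) = pure K [Q, P] [y, x]"
proof -
  have m: "modules [P, Q]" "modules [Q, P]" using P Q by simp_all
  have h: "multilinear [P, Q] (tensor K [Q, P]) (\<lambda>xs. pure K [Q, P] (rev xs))"
  proof (rule multilinear_pair)
    fix y assume y: "y \<in> carrier Q"
    show "linear_map K P (tensor K [Q, P]) (\<lambda>x. pure K [Q, P] (rev [x, y]))"
      using multilinear_linear[OF pure_multilinear[OF m(2)], of "[y, \<zero>\<^bsub>P\<^esub>]" 1] y module_zero_closed[OF P]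
      by simp
  next
    fix x assume x: "x \<in> carrier P"
    show "linear_map K Q (tensor K [Q, P]) (\<lambda>y. pure K [Q, P] (rev [x, y]))"
      using multilinear_linear[OF pure_multilinear[OF m(2)], of "[\<zero>\<^bsub>Q\<^esub>, x]" 0] x module_zero_closed[OF Q]
      by simp
  qed
  show "tlinear [P, Q] [Q, P] (flip K P Q)"
    unfolding flip_def by (rule lift_linear[OF m(1) tensor_module[OF m(2)] h])
  show "flip K P Q (pure K [P, Q] [x, y]) = pure K [Q, P] [y, x]"
    if "x \<in> carrier P" "y \<in> carrier Q"
    unfolding flip_def using lift_pure[OF m(1) tensor_module[OF m(2)] h, of "[x, y]"] that by simp
qed

lemma pure_pair_closed:
  "module K P \<Longrightarrow> module K Q \<Longrightarrow> x \<in> carrier P \<Longrightarrow> y \<in> carrier Q \<Longrightarrow> pure K [P, Q] [x, y] \<in> tensors [P, Q]"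
  by (rule pure_closed) auto

lemma pure_single_closed:
  "module K P \<Longrightarrow> x \<in> carrier P \<Longrightarrow> pure K [P] [x] \<in> tensors [P]"
  by (rule pure_closed) auto

lemma leg_pure_left:
  assumes m: "module K A" "module K B" "module K C" "modules Qs"
    and f: "tlinear [A, B] Qs f"
    and x: "a \<in> carrier A" "b \<in> carrier B" "c \<in> carrier C"
  shows "leg K [] [C] [A, B] Qs f (pure K [A, B, C] [a, b, c]) = tcat K Qs [C] (f (pure K [A, B] [a, b])) (pure K [C] [c])"
  using leg_left[OF _ _ m(4) f, of "[C]" "pure K [A, B] [a, b]" "pure K [C] [c]"] m x
    tcat_pure[of "[A, B]" "[C]" "[a, b]" "[c]"]
  by (simp add: pure_pair_closed pure_single_closed)

lemma leg_pure_right: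
  assumes m: "module K A" "module K B" "module K C" "modules Qs"
    and f: "tlinear [B, C] Qs f"
    and x: "a \<in> carrier A" "b \<in> carrier B" "c \<in> carrier C"
  shows "leg K [A] [] [B, C] Qs f (pure K [A, B, C] [a, b, c]) = tcat K [A] Qs (pure K [A] [a]) (f (pure K [B, C] [b, c]))"
  using leg_right[OF _ _ m(4) f, of "[A]" "pure K [A] [a]" "pure K [B, C] [b, c]"] m x
    tcat_pure[of "[A]" "[B, C]" "[a]" "[b, c]"]
  by (simp add: pure_pair_closed pure_single_closed)

lemma flip_leg_pure_left:
  assumes "module K A" "module K B" "module K C" "a \<in> carrier A" "b \<in> carrier B" "c \<in> carrier C"
  shows "leg K [] [C] [A, B] [B, A] (flip K A B) (pure K [A, B, C] [a, b, c]) = pure K [B, A, C] [b, a, c]"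
  using leg_pure_left[OF assms(1-3) _ flip_linear[OF assms(1,2)] assms(4-6)] assms
    tcat_pure[of "[B, A]" "[C]" "[b, a]" "[c]"] by (simp add: flip_pure)

lemma flip_leg_pure_right:
  assumes "module K A" "module K B" "module K C" "a \<in> carrier A" "b \<in> carrier B" "c \<in> carrier C"
  shows "leg K [A] [] [B, C] [C, B] (flip K B C) (pure K [A, B, C] [a, b, c]) = pure K [A, C, B] [a, c, b]"
  using leg_pure_right[OF assms(1-3) _ flip_linear[OF assms(2,3)] assms(4-6)] assms
    tcat_pure[of "[A]" "[C, B]" "[a]" "[c, b]"] by (simp add: flip_pure)

text \<open>Either way \<open>v\<close> ends up between the two factors of \<open>u\<close>. The
  lemma is applied to values of \<open>X\<close>, which are not pure; linearity in \<open>u\<close>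
  reduces it to the pure case.\<close>

lemma flip_into_pair:
  assumes m: "module K A" "module K B" "module K C"
    and u: "u \<in> tensors [A, B]" and v: "v \<in> carrier C"
  shows "leg K [] [B] [C, A] [A, C] (flip K C A) (tcat K [C] [A, B] (pure K [C] [v]) u)
    = leg K [A] [] [B, C] [C, B] (flip K B C) (tcat K [A, B] [C] u (pure K [C] [v]))"
proof (rule tensor_eqI[OF _ _ _ _ _ u])
  have l: "modules [A]" "modules [B]" "modules [C]" "modules [A, B]"
    "modules [C, A]" "modules [A, C]" "modules [B, C]" "modules [C, B]"
    "modules []"
    using m by simp_all
  show "modules [A, B]" by (rule l)
  show "module K (tensor K [A, C, B])" using m by (intro tensor_module) simp
  show "tlinear [A, B] [A, C, B]
      (\<lambda>u. leg K [] [B] [C, A] [A, C] (flip K C A) (tcat K [C] [A, B] (pure K [C] [v]) u))"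
    using linear_map_compose[OF tcat_linear_right[OF l(3,4) pure_single_closed[OF m(3) v], simplified]
        leg_linear[OF l(9,2,5,6) flip_linear[OF m(3,1)], simplified]] by simp
  show "tlinear [A, B] [A, C, B]
      (\<lambda>u. leg K [A] [] [B, C] [C, B] (flip K B C) (tcat K [A, B] [C] u (pure K [C] [v])))"
    using linear_map_compose[OF tcat_linear_left[OF l(4,3) pure_single_closed[OF m(3) v], simplified]
        leg_linear[OF l(1,9,7,8) flip_linear[OF m(2,3)], simplified]] by simp
  fix xs assume "xs \<in> tuples [A, B]"
  then obtain a b where xs: "xs = [a, b]" "a \<in> carrier A" "b \<in> carrier B" by (rule tuples_pairE)
  show "leg K [] [B] [C, A] [A, C] (flip K C A) (tcat K [C] [A, B] (pure K [C] [v]) (pure K [A, B] xs))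
      = leg K [A] [] [B, C] [C, B] (flip K B C) (tcat K [A, B] [C] (pure K [A, B] xs) (pure K [C] [v]))"
    using tcat_pure[OF l(3,4), of "[v]" "[a, b]"] tcat_pure[OF l(4,3), of "[a, b]" "[v]"] m xs v
    by (simp add: flip_leg_pure_left flip_leg_pure_right)
qed

text \<open>Replaces the vanishing commutator by an equation and supplies the linearity of its three
  factors, which every comparison on pure tensors requires.\<close>

lemma yb_commuteD:
  assumes m: "module K V1" "module K V2" "module K V3"
    and P: "tlinear [V1, V2] [V1, V2] P"
    and S: "tlinear [V1, V3] [V1, V3] S"
    and T: "tlinear [V2, V3] [V2, V3] T"
    and yb: "yb_commute K V1 V2 V3 P S T" and t: "t \<in> tensors [V1, V2, V3]"
  defines "P12 \<equiv> leg K [] [V3] [V1, V2] [V1, V2] P"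
    and "T23 \<equiv> leg K [V1] [] [V2, V3] [V2, V3] T"
    and "S13 \<equiv> \<lambda>t. leg K [V1] [] [V3, V2] [V2, V3] (flip K V3 V2)
      (leg K [] [V2] [V1, V3] [V1, V3] S (leg K [V1] [] [V2, V3] [V3, V2] (flip K V2 V3) t))"
  shows "tlinear [V1, V2, V3] [V1, V2, V3] P12"
    and "tlinear [V1, V2, V3] [V1, V2, V3] S13"
    and "tlinear [V1, V2, V3] [V1, V2, V3] T23"
    and "P12 (S13 (T23 t)) = T23 (S13 (P12 t))"
proof -
  let ?T = "tensor K [V1, V2, V3]"
  show P12: "linear_map K ?T ?T P12" unfolding P12_def using leg_linear[OF _ _ _ _ P, of "[]" "[V3]"] m by simp
  show T23: "linear_map K ?T ?T T23" unfolding T23_def using leg_linear[OF _ _ _ _ T, of "[V1]" "[]"] m by simp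
  show S13: "linear_map K ?T ?T S13"
    unfolding S13_def
    using linear_map_compose[OF linear_map_compose[OF
        leg_linear[OF _ _ _ _ flip_linear[OF m(2,3)], of "[V1]" "[]", simplified]
        leg_linear[OF _ _ _ _ S, of "[]" "[V2]", simplified]]
        leg_linear[OF _ _ _ _ flip_linear[OF m(3,2)], of "[V1]" "[]", simplified]] m
    by simp
  have c: "P12 (S13 (T23 t)) \<in> carrier ?T" "T23 (S13 (P12 t)) \<in> carrier ?T"
    using t linear_map_closed[OF P12] linear_map_closed[OF S13] linear_map_closed[OF T23] by auto
  interpret T: module K ?T by (rule tensor_module) (use m in simp)
  have "P12 (S13 (T23 t)) \<ominus>\<^bsub>?T\<^esub> T23 (S13 (P12 t)) = \<zero>\<^bsub>?T\<^esub>"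
    using yb t by (simp add: yb_commute_def yb_commutator_def Let_def P12_def S13_def T23_def)
  then show "P12 (S13 (T23 t)) = T23 (S13 (P12 t))"
    using c by (metis a_minus_def T.M.minus_equality T.M.minus_minus T.M.a_inv_closed)
qed

text \<open>The first flip can be computed on a pure tensor. The second cannot, because
  \<open>S\<close> returns a general tensor, so it remains in the formula and is later matched with
  a flip inside \<open>R\<close> or \<open>U\<close>.\<close>

lemma leg13_pure:
  assumes m: "module K A" "module K B" "module K C"
    and S: "tlinear [A, C] [A, C] S"
    and x: "a \<in> carrier A" "b \<in> carrier B" "c \<in> carrier C"
  shows "leg K [A] [] [C, B] [B, C] (flip K C B)
      (leg K [] [B] [A, C] [A, C] S (leg K [A] [] [B, C] [C, B] (flip K B C) (pure K [A, B, C] [a, b, c])))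
    = leg K [A] [] [C, B] [B, C] (flip K C B) (tcat K [A, C] [B] (S (pure K [A, C] [a, c])) (pure K [B] [b]))"
  using leg_pure_left[OF m(1,3,2) _ S x(1,3,2)] m x by (simp add: flip_leg_pure_right)

lemma leg_flip_compose:
  assumes m: "modules Ms" "modules Ns" "module K P" "module K Q" "modules Os"
    and S: "tlinear [Q, P] Os S"
    and t: "t \<in> tensors (Ms @ [P, Q] @ Ns)"
  shows "leg K Ms Ns [P, Q] Os (S \<circ> flip K P Q) t = leg K Ms Ns [Q, P] Os S (leg K Ms Ns [P, Q] [Q, P] (flip K P Q) t)"
  using leg_compose[OF m(1,2) _ _ m(5) flip_linear[OF m(3,4)] S t] m(3,4) by (simp add: comp_def)

text \<open>The relation \<open>W\<^sub>1\<^sub>2 X\<^sub>1\<^sub>3 X\<^sub>2\<^sub>3 = X\<^sub>2\<^sub>3 X\<^sub>1\<^sub>3 W\<^sub>1\<^sub>2\<close> precomposed with the reversal of the three tensor factors.\<close>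
lemma mixed_braid_right:
  assumes V: "module K V" "module K V'"
    and W: "tlinear [V, V] [V, V] W"
    and X: "tlinear [V, V'] [V, V'] X"
    and yb: "yb_commute K V V V' W X X" and t: "t \<in> tensors [V', V, V]"
  defines "R \<equiv> W \<circ> flip K V V" and "U \<equiv> X \<circ> flip K V' V"
  shows "leg K [] [V'] [V, V] [V, V] R
      (leg K [V] [] [V', V] [V, V'] U (leg K [] [V] [V', V] [V, V'] U t))
    = leg K [V] [] [V', V] [V, V'] U (leg K [] [V] [V', V] [V, V'] U (leg K [V'] [] [V, V] [V, V] R t))"
proof -
  let ?T = "tensor K [V, V, V']"
  let ?R12 = "leg K [] [V'] [V, V] [V, V] R" and ?R23 = "leg K [V'] [] [V, V] [V, V] R"
  let ?U12 = "leg K [] [V] [V', V] [V, V'] U" and ?U23 = "leg K [V] [] [V', V] [V, V'] U"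
  let ?W12 = "leg K [] [V'] [V, V] [V, V] W" and ?X23 = "leg K [V] [] [V, V'] [V, V'] X"
  let ?X13 = "\<lambda>t. leg K [V] [] [V', V] [V, V'] (flip K V' V)
      (leg K [] [V] [V, V'] [V, V'] X (leg K [V] [] [V, V'] [V', V] (flip K V V') t))"
  have m: "module K (tensor K Ms)" "modules Ms" if "set Ms \<subseteq> {V, V'}" for Ms
    using that V by (auto intro!: tensor_module simp: list_all_iff)
  have R: "tlinear [V, V] [V, V] R"
    unfolding R_def comp_def by (rule linear_map_compose[OF flip_linear[OF V(1,1)] W])
  have U: "tlinear [V', V] [V, V'] U"
    unfolding U_def comp_def by (rule linear_map_compose[OF flip_linear[OF V(2,1)] X])
  have lR12: "linear_map K ?T ?T ?R12" and lR23: "tlinear [V', V, V] [V', V, V] ?R23"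
    using leg_linear[OF _ _ _ _ R, of "[]" "[V']"] leg_linear[OF _ _ _ _ R, of "[V']" "[]"] V by simp_all
  have lU12: "tlinear [V', V, V] [V, V', V] ?U12"
    and lU23: "linear_map K (tensor K [V, V', V]) ?T ?U23"
    using leg_linear[OF _ _ _ _ U, of "[]" "[V]"] leg_linear[OF _ _ _ _ U, of "[V]" "[]"] V by simp_all
  note yb' = yb_commuteD[OF V(1,1,2) W X X yb]
  \<comment> \<open>The linearity facts carry the premise on a tensor as well; the zero vector
    discharges it.\<close>
  note lW12 = yb'(1)[OF module_zero_closed] and lX13 = yb'(2)[OF module_zero_closed]
    and lX23 = yb'(3)[OF module_zero_closed] and YB = yb'(4)
  note lW12 = lW12[OF m(1)] and lX13 = lX13[OF m(1)] and lX23 = lX23[OF m(1)]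
  have U_pure: "U (pure K [V', V] [x, a]) = X (pure K [V, V'] [a, x])" if "x \<in> carrier V'" "a \<in> carrier V" for x a
    using V that by (simp add: U_def flip_pure)
  have R_pure: "R (pure K [V, V] [a, b]) = W (pure K [V, V] [b, a])" if "a \<in> carrier V" "b \<in> carrier V" for a b
    using V that by (simp add: R_def flip_pure)
  have Xc: "X (pure K [V, V'] [a, x]) \<in> tensors [V, V']" if "x \<in> carrier V'" "a \<in> carrier V" for x a
    using linear_map_closed[OF X pure_pair_closed[OF V]] that by blast
  \<comment> \<open>Here \<open>s\<close> stands for the value of \<open>X\<close> left behind by
    \<open>?U12\<close>, a general tensor. Moving \<open>b\<close> from its right to its left turns
    \<open>?U23\<close> and \<open>?R12\<close> into \<open>?X13\<close> and \<open>?W12\<close>; by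
    linearity this is tested on pure \<open>s\<close>.\<close>
  have claim2: "?R12 (?U23 (tcat K [V, V'] [V] s (pure K [V] [b]))) = ?W12 (?X13 (tcat K [V] [V, V'] (pure K [V] [b]) s))"
    if b: "b \<in> carrier V" and s: "s \<in> tensors [V, V']" for b s
  proof (rule tensor_eqI[OF _ _ _ _ _ s])
    note pb = pure_single_closed[OF V(1) b]
    show "linear_map K (tensor K [V, V']) ?T (\<lambda>s. ?R12 (?U23 (tcat K [V, V'] [V] s (pure K [V] [b]))))"
      using linear_map_compose[OF tcat_linear_left[OF m(2) m(2) pb, of "[V, V']", simplified] linear_map_compose[OF lU23 lR12]] by simp
    show "linear_map K (tensor K [V, V']) ?T (\<lambda>s. ?W12 (?X13 (tcat K [V] [V, V'] (pure K [V] [b]) s)))"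
      using linear_map_compose[OF tcat_linear_right[OF m(2) m(2) pb, of "[V, V']", simplified] linear_map_compose[OF lX13 lW12]] by simp
    fix xs assume "xs \<in> tuples [V, V']"
    then obtain v w where xs: "xs = [v, w]" "v \<in> carrier V" "w \<in> carrier V'" by (rule tuples_pairE)
    let ?u = "X (pure K [V, V'] [b, w])"
    have u: "?u \<in> tensors [V, V']" by (rule Xc[OF xs(3) b])
    have "?U23 (pure K [V, V', V] [v, w, b]) = tcat K [V] [V, V'] (pure K [V] [v]) ?u"
      using leg_pure_right[OF V(1,2,1) _ U xs(2,3) b] V U_pure[OF xs(3) b] by simp
    \<comment> \<open>The flip inside \<open>R\<close> brings \<open>v\<close> between the factors
      of \<open>?u\<close> from the left, the last flip of \<open>?X13\<close> brings it there from
      the right; \<open>flip_into_pair\<close> identifies the two.\<close>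
    moreover have "?R12 (tcat K [V] [V, V'] (pure K [V] [v]) ?u)
        = ?W12 (leg K [V] [] [V', V] [V, V'] (flip K V' V) (tcat K [V, V'] [V] ?u (pure K [V] [v])))"
      unfolding R_def
      using leg_flip_compose[OF _ _ V(1,1) _ W, of "[]" "[V']" "tcat K [V] [V, V'] (pure K [V] [v]) ?u"]
        flip_into_pair[OF V(1,2,1) u xs(2)] tcat_closed[OF m(2) m(2) pure_single_closed[OF V(1) xs(2)] u] V
      by simp
    moreover have "?X13 (pure K [V, V, V'] [b, v, w])
        = leg K [V] [] [V', V] [V, V'] (flip K V' V) (tcat K [V, V'] [V] ?u (pure K [V] [v]))"
      by (rule leg13_pure[OF V(1,1,2) X b xs(2,3)])
    ultimately show "?R12 (?U23 (tcat K [V, V'] [V] (pure K [V, V'] xs) (pure K [V] [b])))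
        = ?W12 (?X13 (tcat K [V] [V, V'] (pure K [V] [b]) (pure K [V, V'] xs)))"
      using tcat_pure[of "[V, V']" "[V]" "[v, w]" "[b]"] tcat_pure[of "[V]" "[V, V']" "[b]" "[v, w]"] V xs b
      by simp
  qed (use m V in auto)
  \<comment> \<open>The other side of the relation, with \<open>q\<close> for the value of
    \<open>W\<close>. The flip inside \<open>U\<close> and the last flip of \<open>?X13\<close> act
    on the same pair here, so they agree at once.\<close>
  have claim3: "?U23 (?U12 (tcat K [V'] [V, V] (pure K [V'] [x]) q)) = ?X23 (?X13 (tcat K [V, V] [V'] q (pure K [V'] [x])))"
    if x: "x \<in> carrier V'" and q: "q \<in> tensors [V, V]" for x q
  proof (rule tensor_eqI[OF _ _ _ _ _ q])
    note px = pure_single_closed[OF V(2) x]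
    show "linear_map K (tensor K [V, V]) ?T (\<lambda>q. ?U23 (?U12 (tcat K [V'] [V, V] (pure K [V'] [x]) q)))"
      using linear_map_compose[OF tcat_linear_right[OF m(2) m(2) px, of "[V, V]", simplified] linear_map_compose[OF lU12 lU23]] by simp
    show "linear_map K (tensor K [V, V]) ?T (\<lambda>q. ?X23 (?X13 (tcat K [V, V] [V'] q (pure K [V'] [x]))))"
      using linear_map_compose[OF tcat_linear_left[OF m(2) m(2) px, of "[V, V]", simplified] linear_map_compose[OF lX13 lX23]] by simp
    fix xs assume "xs \<in> tuples [V, V]"
    then obtain c d where xs: "xs = [c, d]" "c \<in> carrier V" "d \<in> carrier V" by (rule tuples_pairE)
    let ?u = "X (pure K [V, V'] [c, x])"
    have u: "?u \<in> tensors [V, V']" by (rule Xc[OF x xs(2)])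
    have "?U12 (pure K [V', V, V] [x, c, d]) = tcat K [V, V'] [V] ?u (pure K [V] [d])"
      using leg_pure_left[OF V(2,1,1) _ U x xs(2,3)] V U_pure[OF x xs(2)] by simp
    moreover have "?U23 (tcat K [V, V'] [V] ?u (pure K [V] [d]))
        = ?X23 (leg K [V] [] [V', V] [V, V'] (flip K V' V) (tcat K [V, V'] [V] ?u (pure K [V] [d])))"
      unfolding U_def
      using leg_flip_compose[OF _ _ V(2,1) _ X, of "[V]" "[]" "tcat K [V, V'] [V] ?u (pure K [V] [d])"]
        tcat_closed[OF m(2) m(2) u pure_single_closed[OF V(1) xs(3)]] V
      by simp
    moreover have "?X13 (pure K [V, V, V'] [c, d, x])
        = leg K [V] [] [V', V] [V, V'] (flip K V' V) (tcat K [V, V'] [V] ?u (pure K [V] [d]))"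
      by (rule leg13_pure[OF V(1,1,2) X xs(2,3) x])
    ultimately show "?U23 (?U12 (tcat K [V'] [V, V] (pure K [V'] [x]) (pure K [V, V] xs)))
        = ?X23 (?X13 (tcat K [V, V] [V'] (pure K [V, V] xs) (pure K [V'] [x])))"
      using tcat_pure[of "[V']" "[V, V]" "[x]" "[c, d]"] tcat_pure[of "[V, V]" "[V']" "[c, d]" "[x]"] V xs x
      by simp
  qed (use m V in auto)
  show ?thesis
  proof (rule tensor_eqI[OF _ _ linear_map_compose[OF lU12 linear_map_compose[OF lU23 lR12]]
        linear_map_compose[OF lR23 linear_map_compose[OF lU12 lU23]] _ t])
    fix xs assume "xs \<in> tuples [V', V, V]"
    then obtain x a b where xs: "xs = [x, a, b]" "x \<in> carrier V'" "a \<in> carrier V" "b \<in> carrier V"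
      by (rule tuples_tripleE)
    \<comment> \<open>On \<open>x \<otimes> a \<otimes> b\<close> the claims turn the two sides into
      the two sides of the Yang-Baxter relation at the reversed tensor
      \<open>b \<otimes> a \<otimes> x\<close>.\<close>
    let ?s = "X (pure K [V, V'] [a, x])" and ?q = "W (pure K [V, V] [b, a])"
    have "?U12 (pure K [V', V, V] xs) = tcat K [V, V'] [V] ?s (pure K [V] [b])"
      using leg_pure_left[OF V(2,1,1) _ U xs(2,3,4)] V U_pure[OF xs(2,3)] xs(1) by simp
    moreover have "?X23 (pure K [V, V, V'] [b, a, x]) = tcat K [V] [V, V'] (pure K [V] [b]) ?s"
      using leg_pure_right[OF V(1,1,2) _ X xs(4,3,2)] V by simp
    moreover have "?R23 (pure K [V', V, V] xs) = tcat K [V'] [V, V] (pure K [V'] [x]) ?q"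
      using leg_pure_right[OF V(2,1,1) _ R xs(2,3,4)] V R_pure[OF xs(3,4)] xs(1) by simp
    moreover have "?W12 (pure K [V, V, V'] [b, a, x]) = tcat K [V, V] [V'] ?q (pure K [V'] [x])"
      using leg_pure_left[OF V(1,1,2) _ W xs(4,3,2)] V by simp
    moreover have "?q \<in> tensors [V, V]"
      by (rule linear_map_closed[OF W pure_pair_closed[OF V(1,1) xs(4,3)]])
    moreover have pc: "pure K [V, V, V'] [b, a, x] \<in> carrier ?T" by (rule pure_closed) (use V xs in auto)
    ultimately show "?R12 (?U23 (?U12 (pure K [V', V, V] xs))) = ?U23 (?U12 (?R23 (pure K [V', V, V] xs)))"
      using claim2[OF xs(4) Xc[OF xs(2,3)]] claim3[OF xs(2)] YB[OF pc] by simp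
  qed (use m V in auto)
qed

text \<open>The relation \<open>X\<^sub>1\<^sub>2 X\<^sub>1\<^sub>3 Z\<^sub>2\<^sub>3 = Z\<^sub>2\<^sub>3 X\<^sub>1\<^sub>3 X\<^sub>1\<^sub>2\<close> precomposed with the reversal; for \<open>X = Z\<close> it is the
  braid relation.\<close>
lemma mixed_braid_left:
  assumes V: "module K V" "module K V'"
    and X: "tlinear [V, V'] [V, V'] X"
    and Z: "tlinear [V', V'] [V', V'] Z"
    and yb: "yb_commute K V V' V' X X Z" and t: "t \<in> tensors [V', V', V]"
  defines "R \<equiv> Z \<circ> flip K V' V'" and "U \<equiv> X \<circ> flip K V' V"
  shows "leg K [] [V'] [V', V] [V, V'] U
      (leg K [V'] [] [V', V] [V, V'] U (leg K [] [V] [V', V'] [V', V'] R t))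
    = leg K [V] [] [V', V'] [V', V'] R (leg K [] [V'] [V', V] [V, V'] U (leg K [V'] [] [V', V] [V, V'] U t))"
proof -
  let ?T = "tensor K [V, V', V']"
  let ?R12 = "leg K [] [V] [V', V'] [V', V'] R" and ?R23 = "leg K [V] [] [V', V'] [V', V'] R"
  let ?U12 = "leg K [] [V'] [V', V] [V, V'] U" and ?U23 = "leg K [V'] [] [V', V] [V, V'] U"
  let ?Z23 = "leg K [V] [] [V', V'] [V', V'] Z" and ?X12 = "leg K [] [V'] [V, V'] [V, V'] X"
  let ?X13 = "\<lambda>t. leg K [V] [] [V', V'] [V', V'] (flip K V' V')
      (leg K [] [V'] [V, V'] [V, V'] X (leg K [V] [] [V', V'] [V', V'] (flip K V' V') t))"
  have m: "module K (tensor K Ms)" "modules Ms" if "set Ms \<subseteq> {V, V'}" for Ms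
    using that V by (auto intro!: tensor_module simp: list_all_iff)
  have R: "tlinear [V', V'] [V', V'] R"
    unfolding R_def comp_def by (rule linear_map_compose[OF flip_linear[OF V(2,2)] Z])
  have U: "tlinear [V', V] [V, V'] U"
    unfolding U_def comp_def by (rule linear_map_compose[OF flip_linear[OF V(2,1)] X])
  have lR23: "linear_map K ?T ?T ?R23" and lR12: "tlinear [V', V', V] [V', V', V] ?R12"
    using leg_linear[OF _ _ _ _ R, of "[]" "[V]"] leg_linear[OF _ _ _ _ R, of "[V]" "[]"] V by simp_all
  have lU23: "tlinear [V', V', V] [V', V, V'] ?U23"
    and lU12: "linear_map K (tensor K [V', V, V']) ?T ?U12"
    using leg_linear[OF _ _ _ _ U, of "[]" "[V']"] leg_linear[OF _ _ _ _ U, of "[V']" "[]"] V by simp_all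
  note yb' = yb_commuteD[OF V(1,2,2) X X Z yb]
  note lX12 = yb'(1)[OF module_zero_closed] and lX13 = yb'(2)[OF module_zero_closed]
    and lZ23 = yb'(3)[OF module_zero_closed] and YB = yb'(4)
  note lX12 = lX12[OF m(1)] and lX13 = lX13[OF m(1)] and lZ23 = lZ23[OF m(1)]
  have U_pure: "U (pure K [V', V] [x, a]) = X (pure K [V, V'] [a, x])" if "x \<in> carrier V'" "a \<in> carrier V" for x a
    using V that by (simp add: U_def flip_pure)
  have R_pure: "R (pure K [V', V'] [a, b]) = Z (pure K [V', V'] [b, a])" if "a \<in> carrier V'" "b \<in> carrier V'" for a b
    using V that by (simp add: R_def flip_pure)
  have Xc: "X (pure K [V, V'] [a, x]) \<in> tensors [V, V']" if "x \<in> carrier V'" "a \<in> carrier V" for x a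
    using linear_map_closed[OF X pure_pair_closed[OF V]] that by blast
  have claim2: "?R23 (?U12 (tcat K [V'] [V, V'] (pure K [V'] [c]) s)) = ?Z23 (?X13 (tcat K [V, V'] [V'] s (pure K [V'] [c])))"
    if c: "c \<in> carrier V'" and s: "s \<in> tensors [V, V']" for c s
  proof (rule tensor_eqI[OF _ _ _ _ _ s])
    note pc = pure_single_closed[OF V(2) c]
    show "linear_map K (tensor K [V, V']) ?T (\<lambda>s. ?R23 (?U12 (tcat K [V'] [V, V'] (pure K [V'] [c]) s)))"
      using linear_map_compose[OF tcat_linear_right[OF m(2) m(2) pc, of "[V, V']", simplified] linear_map_compose[OF lU12 lR23]] by simp
    show "linear_map K (tensor K [V, V']) ?T (\<lambda>s. ?Z23 (?X13 (tcat K [V, V'] [V'] s (pure K [V'] [c]))))"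
      using linear_map_compose[OF tcat_linear_left[OF m(2) m(2) pc, of "[V, V']", simplified] linear_map_compose[OF lX13 lZ23]] by simp
    fix xs assume "xs \<in> tuples [V, V']"
    then obtain v w where xs: "xs = [v, w]" "v \<in> carrier V" "w \<in> carrier V'" by (rule tuples_pairE)
    let ?u = "X (pure K [V, V'] [v, c])"
    have u: "?u \<in> tensors [V, V']" by (rule Xc[OF c xs(2)])
    have "?U12 (pure K [V', V, V'] [c, v, w]) = tcat K [V, V'] [V'] ?u (pure K [V'] [w])"
      using leg_pure_left[OF V(2,1,2) _ U c xs(2,3)] V U_pure[OF c xs(2)] by simp
    moreover have "?R23 (tcat K [V, V'] [V'] ?u (pure K [V'] [w]))
        = ?Z23 (leg K [V] [] [V', V'] [V', V'] (flip K V' V') (tcat K [V, V'] [V'] ?u (pure K [V'] [w])))"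
      unfolding R_def
      using leg_flip_compose[OF _ _ V(2,2) _ Z, of "[V]" "[]" "tcat K [V, V'] [V'] ?u (pure K [V'] [w])"]
        tcat_closed[OF m(2) m(2) u pure_single_closed[OF V(2) xs(3)]] V
      by simp
    moreover have "?X13 (pure K [V, V', V'] [v, w, c])
        = leg K [V] [] [V', V'] [V', V'] (flip K V' V') (tcat K [V, V'] [V'] ?u (pure K [V'] [w]))"
      by (rule leg13_pure[OF V(1,2,2) X xs(2,3) c])
    ultimately show "?R23 (?U12 (tcat K [V'] [V, V'] (pure K [V'] [c]) (pure K [V, V'] xs)))
        = ?Z23 (?X13 (tcat K [V, V'] [V'] (pure K [V, V'] xs) (pure K [V'] [c])))"
      using tcat_pure[of "[V']" "[V, V']" "[c]" "[v, w]"] tcat_pure[of "[V, V']" "[V']" "[v, w]" "[c]"] V xs c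
      by simp
  qed (use m V in auto)
  \<comment> \<open>In this relation it is the flip inside \<open>U\<close> that acts on the first
    pair, so \<open>flip_into_pair\<close> enters on the side that carries \<open>q\<close>, the
    value of \<open>Z\<close>.\<close>
  have claim3: "?U12 (?U23 (tcat K [V', V'] [V] q (pure K [V] [a]))) = ?X12 (?X13 (tcat K [V] [V', V'] (pure K [V] [a]) q))"
    if a: "a \<in> carrier V" and q: "q \<in> tensors [V', V']" for a q
  proof (rule tensor_eqI[OF _ _ _ _ _ q])
    note pa = pure_single_closed[OF V(1) a]
    show "linear_map K (tensor K [V', V']) ?T (\<lambda>q. ?U12 (?U23 (tcat K [V', V'] [V] q (pure K [V] [a]))))"
      using linear_map_compose[OF tcat_linear_left[OF m(2) m(2) pa, of "[V', V']", simplified] linear_map_compose[OF lU23 lU12]] by simp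
    show "linear_map K (tensor K [V', V']) ?T (\<lambda>q. ?X12 (?X13 (tcat K [V] [V', V'] (pure K [V] [a]) q)))"
      using linear_map_compose[OF tcat_linear_right[OF m(2) m(2) pa, of "[V', V']", simplified] linear_map_compose[OF lX13 lX12]] by simp
    fix xs assume "xs \<in> tuples [V', V']"
    then obtain p r where xs: "xs = [p, r]" "p \<in> carrier V'" "r \<in> carrier V'" by (rule tuples_pairE)
    let ?u = "X (pure K [V, V'] [a, r])"
    have u: "?u \<in> tensors [V, V']" by (rule Xc[OF xs(3) a])
    have "?U23 (pure K [V', V', V] [p, r, a]) = tcat K [V'] [V, V'] (pure K [V'] [p]) ?u"
      using leg_pure_right[OF V(2,2,1) _ U xs(2,3) a] V U_pure[OF xs(3) a] by simp
    moreover have "?U12 (tcat K [V'] [V, V'] (pure K [V'] [p]) ?u)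
        = ?X12 (leg K [V] [] [V', V'] [V', V'] (flip K V' V') (tcat K [V, V'] [V'] ?u (pure K [V'] [p])))"
      unfolding U_def
      using leg_flip_compose[OF _ _ V(2,1) _ X, of "[]" "[V']" "tcat K [V'] [V, V'] (pure K [V'] [p]) ?u"]
        flip_into_pair[OF V(1,2,2) u xs(2)] tcat_closed[OF m(2) m(2) pure_single_closed[OF V(2) xs(2)] u] V
      by simp
    moreover have "?X13 (pure K [V, V', V'] [a, p, r])
        = leg K [V] [] [V', V'] [V', V'] (flip K V' V') (tcat K [V, V'] [V'] ?u (pure K [V'] [p]))"
      by (rule leg13_pure[OF V(1,2,2) X a xs(2,3)])
    ultimately show "?U12 (?U23 (tcat K [V', V'] [V] (pure K [V', V'] xs) (pure K [V] [a])))
        = ?X12 (?X13 (tcat K [V] [V', V'] (pure K [V] [a]) (pure K [V', V'] xs)))"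
      using tcat_pure[of "[V', V']" "[V]" "[p, r]" "[a]"] tcat_pure[of "[V]" "[V', V']" "[a]" "[p, r]"] V xs a
      by simp
  qed (use m V in auto)
  show ?thesis
  proof (rule tensor_eqI[OF _ _ linear_map_compose[OF lR12 linear_map_compose[OF lU23 lU12]]
        linear_map_compose[OF lU23 linear_map_compose[OF lU12 lR23]] _ t])
    fix xs assume "xs \<in> tuples [V', V', V]"
    then obtain c d a where xs: "xs = [c, d, a]" "c \<in> carrier V'" "d \<in> carrier V'" "a \<in> carrier V"
      by (rule tuples_tripleE)
    let ?s = "X (pure K [V, V'] [a, d])" and ?q = "Z (pure K [V', V'] [d, c])"
    have "?U23 (pure K [V', V', V] xs) = tcat K [V'] [V, V'] (pure K [V'] [c]) ?s"
      using leg_pure_right[OF V(2,2,1) _ U xs(2,3,4)] V U_pure[OF xs(3,4)] xs(1) by simp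
    moreover have "?X12 (pure K [V, V', V'] [a, d, c]) = tcat K [V, V'] [V'] ?s (pure K [V'] [c])"
      using leg_pure_left[OF V(1,2,2) _ X xs(4,3,2)] V by simp
    moreover have "?R12 (pure K [V', V', V] xs) = tcat K [V', V'] [V] ?q (pure K [V] [a])"
      using leg_pure_left[OF V(2,2,1) _ R xs(2,3,4)] V R_pure[OF xs(2,3)] xs(1) by simp
    moreover have "?Z23 (pure K [V, V', V'] [a, d, c]) = tcat K [V] [V', V'] (pure K [V] [a]) ?q"
      using leg_pure_right[OF V(1,2,2) _ Z xs(4,3,2)] V by simp
    moreover have "?q \<in> tensors [V', V']"
      by (rule linear_map_closed[OF Z pure_pair_closed[OF V(2,2) xs(3,2)]])
    moreover have pc: "pure K [V, V', V'] [a, d, c] \<in> carrier ?T" by (rule pure_closed) (use V xs in auto)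
    ultimately show "?U12 (?U23 (?R12 (pure K [V', V', V] xs))) = ?R23 (?U12 (?U23 (pure K [V', V', V] xs)))"
      using claim2[OF xs(2) Xc[OF xs(3,4)]] claim3[OF xs(4)] YB[OF pc] by simp
  qed (use m V in auto)
qed

end

section \<open>Direct sums, and linear and bilinear maps out of them\<close>

section \<open>Direct sums\<close>

context scalar_ring
begin

lemma direct_sum_sel [simp]:
  "zero (direct_sum M) = (\<lambda>i. \<zero>\<^bsub>M i\<^esub>)"
  "add (direct_sum M) x y = (\<lambda>i. x i \<oplus>\<^bsub>M i\<^esub> y i)"
  "smult (direct_sum M) c x = (\<lambda>i. c \<odot>\<^bsub>M i\<^esub> x i)"
  by (simp_all add: direct_sum_def)

lemma direct_sum_carrier:
  "x \<in> carrier (direct_sum M) \<longleftrightarrow> (\<forall>i. x i \<in> carrier (M i)) \<and> finite {i. x i \<noteq> \<zero>\<^bsub>M i\<^esub>}"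
  by (simp add: direct_sum_def)

lemma direct_sum_module:
  assumes M: "\<And>i. module K (M i)"
  shows "module K (direct_sum M)"
proof (rule moduleI)
  let ?D = "direct_sum M"
  show "cring K" by (rule is_cring)
  have ag: "abelian_group (M i)" for i using M[of i] by (simp add: module_def)
  have cl: "x i \<in> carrier (M i)" if "x \<in> carrier ?D" for x i using that by (simp add: direct_sum_carrier)
  have add: "(\<lambda>i. x i \<oplus>\<^bsub>M i\<^esub> y i) \<in> carrier ?D" if "x \<in> carrier ?D" "y \<in> carrier ?D" for x y
  proof -
    have "x i = \<zero>\<^bsub>M i\<^esub> \<Longrightarrow> y i = \<zero>\<^bsub>M i\<^esub> \<Longrightarrow> x i \<oplus>\<^bsub>M i\<^esub> y i = \<zero>\<^bsub>M i\<^esub>" for i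
      using abelian_monoid.l_zero[of "M i" "\<zero>\<^bsub>M i\<^esub>"] module_zero_closed[OF M] ag[of i]
      by (simp add: abelian_group_def)
    then have "{i. x i \<oplus>\<^bsub>M i\<^esub> y i \<noteq> \<zero>\<^bsub>M i\<^esub>} \<subseteq> {i. x i \<noteq> \<zero>\<^bsub>M i\<^esub>} \<union> {i. y i \<noteq> \<zero>\<^bsub>M i\<^esub>}"
      by auto
    then show ?thesis
      using that module_add_closed[OF M] unfolding direct_sum_carrier by (auto intro: finite_subset)
  qed
  have smult: "(\<lambda>i. c \<odot>\<^bsub>M i\<^esub> x i) \<in> carrier ?D" if "c \<in> carrier K" "x \<in> carrier ?D" for c x
  proof -
    have "{i. c \<odot>\<^bsub>M i\<^esub> x i \<noteq> \<zero>\<^bsub>M i\<^esub>} \<subseteq> {i. x i \<noteq> \<zero>\<^bsub>M i\<^esub>}"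
      using that module.smult_r_null[OF M] by auto
    then show ?thesis
      using that module_smult_closed[OF M] unfolding direct_sum_carrier by (auto intro: finite_subset)
  qed
  have zero: "(\<lambda>i. \<zero>\<^bsub>M i\<^esub>) \<in> carrier ?D" by (simp add: direct_sum_carrier module_zero_closed[OF M])
  show "abelian_group ?D"
  proof (rule abelian_groupI)
    fix x assume x: "x \<in> carrier ?D"
    have "(\<lambda>i. \<ominus>\<^bsub>K\<^esub> \<one> \<odot>\<^bsub>M i\<^esub> x i) \<in> carrier ?D" by (rule smult) (use x in auto)
    moreover have "(\<lambda>i. \<ominus>\<^bsub>K\<^esub> \<one> \<odot>\<^bsub>M i\<^esub> x i \<oplus>\<^bsub>M i\<^esub> x i) = (\<lambda>i. \<zero>\<^bsub>M i\<^esub>)"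
      using cl[OF x] M abelian_group.l_neg[OF ag]
      by (simp add: fun_eq_iff module.smult_l_minus[OF M] module.smult_one[OF M])
    ultimately show "\<exists>y\<in>carrier ?D. y \<oplus>\<^bsub>?D\<^esub> x = \<zero>\<^bsub>?D\<^esub>" by auto
  next
    fix x y z assume "x \<in> carrier ?D" "y \<in> carrier ?D" "z \<in> carrier ?D"
    then show "x \<oplus>\<^bsub>?D\<^esub> y \<oplus>\<^bsub>?D\<^esub> z = x \<oplus>\<^bsub>?D\<^esub> (y \<oplus>\<^bsub>?D\<^esub> z)" "x \<oplus>\<^bsub>?D\<^esub> y = y \<oplus>\<^bsub>?D\<^esub> x"
      using cl abelian_groupE(3,4)[OF ag] by (simp_all add: fun_eq_iff)
  next
    fix x assume "x \<in> carrier ?D"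
    then show "\<zero>\<^bsub>?D\<^esub> \<oplus>\<^bsub>?D\<^esub> x = x" using cl abelian_groupE(5)[OF ag] by (simp add: fun_eq_iff)
  qed (simp_all add: add zero)
  fix c x assume cx: "c \<in> carrier K" "x \<in> carrier ?D"
  show "c \<odot>\<^bsub>?D\<^esub> x \<in> carrier ?D" using smult[OF cx] by simp
  show "(c \<oplus> d) \<odot>\<^bsub>?D\<^esub> x = c \<odot>\<^bsub>?D\<^esub> x \<oplus>\<^bsub>?D\<^esub> d \<odot>\<^bsub>?D\<^esub> x" if "d \<in> carrier K" for d
    using cx cl that module.smult_l_distr[OF M] by (simp add: fun_eq_iff)
  show "(c \<otimes> d) \<odot>\<^bsub>?D\<^esub> x = c \<odot>\<^bsub>?D\<^esub> (d \<odot>\<^bsub>?D\<^esub> x)" if "d \<in> carrier K" for d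
    using cx cl that module.smult_assoc1[OF M] by (simp add: fun_eq_iff)
  show "c \<odot>\<^bsub>?D\<^esub> (x \<oplus>\<^bsub>?D\<^esub> y) = c \<odot>\<^bsub>?D\<^esub> x \<oplus>\<^bsub>?D\<^esub> c \<odot>\<^bsub>?D\<^esub> y" if "y \<in> carrier ?D" for y
    using cx cl that module.smult_r_distr[OF M] by (simp add: fun_eq_iff)
next
  fix x assume "x \<in> carrier (direct_sum M)"
  then show "\<one> \<odot>\<^bsub>direct_sum M\<^esub> x = x"
    using module.smult_one[OF M] by (simp add: fun_eq_iff direct_sum_carrier)
qed

lemma summand_closed:
  assumes M: "\<And>i. module K (M i)" and "a \<in> carrier (M i)"
  shows "summand M i a \<in> carrier (direct_sum M)"
proof -
  have "{j. summand M i a j \<noteq> \<zero>\<^bsub>M j\<^esub>} \<subseteq> {i}" by (auto simp: summand_def)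
  then show ?thesis
    using assms module_zero_closed[OF M] finite_subset by (auto simp: direct_sum_carrier summand_def)
qed

lemma module_zero_add: "module K M \<Longrightarrow> x \<in> carrier M \<Longrightarrow> \<zero>\<^bsub>M\<^esub> \<oplus>\<^bsub>M\<^esub> x = x"
  and module_add_zero: "module K M \<Longrightarrow> x \<in> carrier M \<Longrightarrow> x \<oplus>\<^bsub>M\<^esub> \<zero>\<^bsub>M\<^esub> = x"
  by (simp_all add: module_def abelian_group_def abelian_monoid.l_zero abelian_monoid.r_zero)

lemma summand_linear:
  assumes M: "\<And>i. module K (M i)"
  shows "linear_map K (M i) (direct_sum M) (summand M i)"
  by (rule linear_mapI)
    (auto simp: summand_closed[OF M], auto simp: summand_def fun_eq_iff module_zero_add[OF M]
      module_zero_closed[OF M] module.smult_r_null[OF M])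

lemma direct_sum_induct [consumes 2, case_names summand add]:
  assumes M: "\<And>i. module K (M i)" and x: "x \<in> carrier (direct_sum M)"
    and summand: "\<And>i a. a \<in> carrier (M i) \<Longrightarrow> P (summand M i a)"
    and add: "\<And>y z. y \<in> carrier (direct_sum M) \<Longrightarrow> z \<in> carrier (direct_sum M) \<Longrightarrow> P y \<Longrightarrow> P z \<Longrightarrow>
      P (y \<oplus>\<^bsub>direct_sum M\<^esub> z)"
  shows "P x"
proof -
  have "finite {i. x i \<noteq> \<zero>\<^bsub>M i\<^esub>}" using x by (simp add: direct_sum_carrier)
  then show ?thesis using x
  proof (induction "{i. x i \<noteq> \<zero>\<^bsub>M i\<^esub>}" arbitrary: x rule: finite_induct)
    case empty
    \<comment> \<open>The zero vector is itself a summand, with entry zero at an arbitrary index, so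
      the induction rule has no case for zero.\<close>
    then have "x = summand M undefined \<zero>\<^bsub>M undefined\<^esub>" by (auto simp: summand_def fun_eq_iff)
    then show ?case using summand[OF module_zero_closed[OF M]] by metis
  next
    case (insert i A)
    define y where "y = x(i := \<zero>\<^bsub>M i\<^esub>)"
    have A: "A = {j. y j \<noteq> \<zero>\<^bsub>M j\<^esub>}" using insert(2,4) by (auto simp: y_def)
    have cl: "x j \<in> carrier (M j)" for j using insert(5) by (simp add: direct_sum_carrier)
    have y: "y \<in> carrier (direct_sum M)"
      using cl A insert(1) module_zero_closed[OF M] by (auto simp: direct_sum_carrier y_def)
    define s where "s = summand M i (x i)"
    have s: "s \<in> carrier (direct_sum M)" "P s"
      unfolding s_def by (rule summand_closed[of M, OF M cl], rule summand[OF cl])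
    have "x = y \<oplus>\<^bsub>direct_sum M\<^esub> s"
      using cl by (auto simp: s_def y_def summand_def fun_eq_iff module_zero_add[OF M] module_add_zero[OF M])
    then show ?case
      using add[OF y s(1) insert(3)[OF A y] s(2)] by (simp only:)
  qed
qed

lemma direct_sum_eqI:
  assumes M: "\<And>i. module K (M i)"
    and f: "linear_map K (direct_sum M) N f" and g: "linear_map K (direct_sum M) N g"
    and eq: "\<And>i a. a \<in> carrier (M i) \<Longrightarrow> f (summand M i a) = g (summand M i a)"
    and x: "x \<in> carrier (direct_sum M)"
  shows "f x = g x"
  using M x
proof (induction rule: direct_sum_induct)
  case (add y z)
  then show ?case by (simp only: linear_map_add[OF f] linear_map_add[OF g])
qed (rule eq)

lemma direct_sum_lift:
  assumes M: "\<And>i. module K (M i)" and N: "module K N" and f: "\<And>i. linear_map K (M i) N (f i)"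
  obtains g where "linear_map K (direct_sum M) N g"
    and "\<And>i a. a \<in> carrier (M i) \<Longrightarrow> g (summand M i a) = f i a"
proof -
  interpret N: module K N by fact
  let ?D = "direct_sum M"
  let ?s = "\<lambda>x. {i. x i \<noteq> \<zero>\<^bsub>M i\<^esub>}"
  define g where "g x = (\<Oplus>\<^bsub>N\<^esub>i\<in>?s x. f i (x i))" for x
  have fz: "f i \<zero>\<^bsub>M i\<^esub> = \<zero>\<^bsub>N\<^esub>" for i by (rule linear_map_zero[OF M N f])
  have cl: "x i \<in> carrier (M i)" and fc: "f i (x i) \<in> carrier N" if "x \<in> carrier ?D" for x i
    using that linear_map_closed[OF f] by (auto simp: direct_sum_carrier)
  have fin: "finite (?s x)" if "x \<in> carrier ?D" for x using that by (simp add: direct_sum_carrier)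
  have super: "g x = (\<Oplus>\<^bsub>N\<^esub>i\<in>A. f i (x i))" if x: "x \<in> carrier ?D" and A: "finite A" "?s x \<subseteq> A" for x A
    unfolding g_def
    by (rule N.M.add.finprod_mono_neutral_cong_left) (use A fz fc[OF x] in \<open>auto simp: Pi_def\<close>)
  have "linear_map K ?D N g"
  proof (rule linear_mapI)
    fix x assume x: "x \<in> carrier ?D"
    show "g x \<in> carrier N" unfolding g_def by (rule N.M.finsum_closed) (use fc[OF x] in auto)
    show "g (c \<odot>\<^bsub>?D\<^esub> x) = c \<odot>\<^bsub>N\<^esub> g x" if c: "c \<in> carrier K" for c
    proof -
      have cx: "c \<odot>\<^bsub>?D\<^esub> x \<in> carrier ?D" by (rule module_smult_closed[OF direct_sum_module[OF M] c x])
      have "g (c \<odot>\<^bsub>?D\<^esub> x) = (\<Oplus>\<^bsub>N\<^esub>i\<in>?s x. f i ((c \<odot>\<^bsub>?D\<^esub> x) i))"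
        by (rule super[OF cx fin[OF x]]) (use c module.smult_r_null[OF M] in auto)
      also have "\<dots> = (\<Oplus>\<^bsub>N\<^esub>i\<in>?s x. c \<odot>\<^bsub>N\<^esub> f i (x i))"
        by (rule N.M.finsum_cong') (use c cl[OF x] fc[OF x] linear_map_smult[OF f] in auto)
      also have "\<dots> = c \<odot>\<^bsub>N\<^esub> g x"
        unfolding g_def by (rule N.finsum_smult_ldistr[symmetric]) (use fin[OF x] c fc[OF x] in auto)
      finally show ?thesis .
    qed
    fix y assume y: "y \<in> carrier ?D"
    let ?A = "?s x \<union> ?s y"
    have A: "finite ?A" using fin[OF x] fin[OF y] by simp
    have xy: "x \<oplus>\<^bsub>?D\<^esub> y \<in> carrier ?D" by (rule module_add_closed[OF direct_sum_module[OF M] x y])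
    have "g (x \<oplus>\<^bsub>?D\<^esub> y) = (\<Oplus>\<^bsub>N\<^esub>i\<in>?A. f i ((x \<oplus>\<^bsub>?D\<^esub> y) i))"
      by (rule super[OF xy A]) (use module_zero_add[OF M] module_zero_closed[OF M] in auto)
    also have "\<dots> = (\<Oplus>\<^bsub>N\<^esub>i\<in>?A. f i (x i) \<oplus>\<^bsub>N\<^esub> f i (y i))"
      by (rule N.M.finsum_cong') (use cl[OF x] cl[OF y] fc[OF x] fc[OF y] linear_map_add[OF f] in auto)
    also have "\<dots> = (\<Oplus>\<^bsub>N\<^esub>i\<in>?A. f i (x i)) \<oplus>\<^bsub>N\<^esub> (\<Oplus>\<^bsub>N\<^esub>i\<in>?A. f i (y i))"
      by (rule N.M.finsum_addf) (use fc[OF x] fc[OF y] in auto)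
    also have "\<dots> = g x \<oplus>\<^bsub>N\<^esub> g y" using super[OF x A] super[OF y A] by simp
    finally show "g (x \<oplus>\<^bsub>?D\<^esub> y) = g x \<oplus>\<^bsub>N\<^esub> g y" .
  qed
  moreover have "g (summand M i a) = f i a" if a: "a \<in> carrier (M i)" for i a
  proof -
    have "g (summand M i a) = (\<Oplus>\<^bsub>N\<^esub>j\<in>{i}. f j (summand M i a j))"
      by (rule super[OF summand_closed[of M, OF M a]]) (auto simp: summand_def)
    then show ?thesis using linear_map_closed[OF f a] by (simp add: summand_def)
  qed
  ultimately show thesis by (rule that)
qed

text \<open>Extension goes one variable at a time: in the second for a fixed homogeneous
  \<open>a\<close>, then in the first for a fixed \<open>y\<close>. Linearity in the variable that
  was held fixed is recovered afterwards, because linear maps on a direct sum are determined on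
  summands.\<close>

lemma direct_sum_bilinear_lift:
  assumes L: "\<And>i. module K (L i)" and M: "\<And>j. module K (M j)" and N: "module K N"
    and 1: "\<And>i j b. b \<in> carrier (M j) \<Longrightarrow> linear_map K (L i) N (\<lambda>a. B i j a b)"
    and 2: "\<And>i j a. a \<in> carrier (L i) \<Longrightarrow> linear_map K (M j) N (\<lambda>b. B i j a b)"
  obtains h where "\<And>y. y \<in> carrier (direct_sum M) \<Longrightarrow> linear_map K (direct_sum L) N (\<lambda>x. h x y)"
    and "\<And>x. x \<in> carrier (direct_sum L) \<Longrightarrow> linear_map K (direct_sum M) N (\<lambda>y. h x y)"
    and "\<And>i j a b. a \<in> carrier (L i) \<Longrightarrow> b \<in> carrier (M j) \<Longrightarrow> h (summand L i a) (summand M j b) = B i j a b"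
proof -
  let ?g = "\<lambda>i a g. linear_map K (direct_sum M) N g \<and> (\<forall>j. \<forall>b\<in>carrier (M j). g (summand M j b) = B i j a b)"
  have "\<exists>g. ?g i a g" if "a \<in> carrier (L i)" for i a
    by (rule direct_sum_lift[of M, OF M N 2[OF that]]) blast
  moreover define g where "g i a = (SOME g. ?g i a g)" for i a
  ultimately have "?g i a (g i a)" if "a \<in> carrier (L i)" for i a
    unfolding g_def using that by (intro someI_ex[of "?g i a"]) blast
  then have gl: "linear_map K (direct_sum M) N (g i a)"
    and gs: "b \<in> carrier (M j) \<Longrightarrow> g i a (summand M j b) = B i j a b" if "a \<in> carrier (L i)" for i j a b
    using that by blast+
  have gL: "linear_map K (L i) N (\<lambda>a. g i a y)" if y: "y \<in> carrier (direct_sum M)" for i y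
  proof (rule linear_mapI)
    fix a assume a: "a \<in> carrier (L i)"
    show "g i a y \<in> carrier N" using linear_map_closed[OF gl[OF a] y] .
    fix b assume b: "b \<in> carrier (L i)"
    note ab = module_add_closed[OF L a b]
    show "g i (a \<oplus>\<^bsub>L i\<^esub> b) y = g i a y \<oplus>\<^bsub>N\<^esub> g i b y"
      by (rule direct_sum_eqI[OF M gl[OF ab] linear_map_add_fun[OF N gl[OF a] gl[OF b]] _ y])
        (simp add: gs a b ab linear_map_add[OF 1])
  next
    fix c a assume c: "c \<in> carrier K" and a: "a \<in> carrier (L i)"
    note ca = module_smult_closed[OF L c a]
    show "g i (c \<odot>\<^bsub>L i\<^esub> a) y = c \<odot>\<^bsub>N\<^esub> g i a y"
      by (rule direct_sum_eqI[OF M gl[OF ca] linear_map_smult_fun[OF N gl[OF a] c] _ y])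
        (simp add: gs a c ca linear_map_smult[OF 1])
  qed
  let ?h = "\<lambda>y h. linear_map K (direct_sum L) N h \<and> (\<forall>i. \<forall>a\<in>carrier (L i). h (summand L i a) = g i a y)"
  have "\<exists>h. ?h y h" if "y \<in> carrier (direct_sum M)" for y
    by (rule direct_sum_lift[of L, OF L N gL[OF that]]) blast
  moreover define h where "h y = (SOME h. ?h y h)" for y
  ultimately have "?h y (h y)" if "y \<in> carrier (direct_sum M)" for y
    unfolding h_def using that by (intro someI_ex[of "?h y"]) blast
  then have hl: "linear_map K (direct_sum L) N (h y)"
    and hs: "a \<in> carrier (L i) \<Longrightarrow> h y (summand L i a) = g i a y" if "y \<in> carrier (direct_sum M)" for y i a
    using that by blast+
  have hM: "linear_map K (direct_sum M) N (\<lambda>y. h y x)" if x: "x \<in> carrier (direct_sum L)" for x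
  proof (rule linear_mapI)
    fix y assume y: "y \<in> carrier (direct_sum M)"
    show "h y x \<in> carrier N" using linear_map_closed[OF hl[OF y] x] .
    fix z assume z: "z \<in> carrier (direct_sum M)"
    note yz = module_add_closed[OF direct_sum_module[OF M] y z]
    show "h (y \<oplus>\<^bsub>direct_sum M\<^esub> z) x = h y x \<oplus>\<^bsub>N\<^esub> h z x"
      by (rule direct_sum_eqI[OF L hl[OF yz] linear_map_add_fun[OF N hl[OF y] hl[OF z]] _ x])
        (simp only: hs[OF y] hs[OF z] hs[OF yz] linear_map_add[OF gl y z])
  next
    fix c y assume c: "c \<in> carrier K" and y: "y \<in> carrier (direct_sum M)"
    note cy = module_smult_closed[OF direct_sum_module[OF M] c y]
    show "h (c \<odot>\<^bsub>direct_sum M\<^esub> y) x = c \<odot>\<^bsub>N\<^esub> h y x"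
      by (rule direct_sum_eqI[OF L hl[OF cy] linear_map_smult_fun[OF N hl[OF y] c] _ x])
        (simp only: hs[OF y] hs[OF cy] linear_map_smult[OF gl c y])
  qed
  show thesis
    by (rule that[of "\<lambda>x y. h y x"]) (auto simp: hl hM hs gs summand_closed[OF M])
qed

end

section \<open>The braid product makes the tensor space an associative algebra\<close>

section \<open>The braid algebra\<close>

text \<open>Transfers the module axioms from the tensor space to the braid algebra, which is the
  same record with new \<open>mult\<close> and \<open>one\<close>.\<close>

lemma module_cong:
  assumes M: "module K M" and eq: "carrier N = carrier M" "add N = add M" "zero N = zero M" "smult N = smult M"
  shows "module K N"
proof -
  interpret M: module K M by fact
  show ?thesis
  proof (rule moduleI)
    show "abelian_group N"
      by (rule abelian_groupI) (auto simp: eq M.M.a_ac intro: bexI[of _ "\<ominus>\<^bsub>M\<^esub> _"] M.M.l_neg)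
  qed (auto simp: eq M.is_cring M.smult_l_distr M.smult_r_distr M.smult_assoc1)
qed

locale braided_space = scalar_ring +
  fixes V :: "('a, 'v) module" and R
  assumes V: "module K V"
    and R: "tlinear [V, V] [V, V] R"
    and braid: "t \<in> tensors [V, V, V] \<Longrightarrow>
      leg K [] [V] [V, V] [V, V] R (leg K [V] [] [V, V] [V, V] R (leg K [] [V] [V, V] [V, V] R t))
      = leg K [V] [] [V, V] [V, V] R (leg K [] [V] [V, V] [V, V] R (leg K [V] [] [V, V] [V, V] R t))"

text \<open>Both kinds of strands become \<open>V\<close>, so \<open>Ps n\<close> and
  \<open>Qs n\<close> denote the same list, and a block crossing is an endomorphism of one tensor
  power.\<close>

sublocale braided_space \<subseteq> crossing K V V R
  by (intro crossing.intro crossing_axioms.intro scalar_ring_axioms V R)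

context crossing
begin

text \<open>Together with \<open>block_1_2\<close> this spells out the smallest blocks with two
  crossings; with them the naturality squares for one strand against two become the braid and mixed
  relations themselves.\<close>

lemma block_2_1:
  assumes t: "t \<in> tensors [P, P, Q]"
  shows "block 2 (Suc 0) t = leg K [] [P] [P, Q] [Q, P] f (leg K [P] [] [P, Q] [Q, P] f t)"
proof -
  let ?B = "block (Suc 0) (Suc 0)"
  have B: "tlinear [P, Q] [Q, P] ?B" using block_linear_1[of "Suc 0"] by simp
  have c: "leg K [P] [] [P, Q] [Q, P] f t \<in> tensors [P, Q, P]"
    using linear_map_closed[OF leg_linear[OF _ _ _ _ f, of "[P]" "[]"], of t] t by simp
  have "block (Suc 0 + Suc 0) (Suc 0) t
      = leg K [] [P] [P, Q] [Q, P] ?B (leg K [P] [] [P, Q] [Q, P] ?B t)"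
    using block_add_left[of t "Suc 0" "Suc 0" "Suc 0"] t by simp
  also have "leg K [P] [] [P, Q] [Q, P] ?B t = leg K [P] [] [P, Q] [Q, P] f t"
    by (rule leg_cong[OF _ _ _ _ B f block_1_1]) (use t in simp_all)
  also have "leg K [] [P] [P, Q] [Q, P] ?B \<dots> = leg K [] [P] [P, Q] [Q, P] f \<dots>"
    by (rule leg_cong[OF _ _ _ _ B f block_1_1]) (use c in simp_all)
  finally show ?thesis by (simp add: numeral_2_eq_2)
qed

lemma block_1_2:
  assumes t: "t \<in> tensors [P, Q, Q]"
  shows "block (Suc 0) 2 t = leg K [Q] [] [P, Q] [Q, P] f (leg K [] [Q] [P, Q] [Q, P] f t)"
proof -
  let ?B = "block (Suc 0) (Suc 0)"
  have B: "tlinear [P, Q] [Q, P] ?B" using block_linear_1[of "Suc 0"] by simp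
  have c: "leg K [] [Q] [P, Q] [Q, P] f t \<in> tensors [Q, P, Q]"
    using linear_map_closed[OF leg_linear[OF _ _ _ _ f, of "[]" "[Q]"], of t] t by simp
  have "block (Suc 0) (Suc 0 + Suc 0) t
      = leg K [Q] [] [P, Q] [Q, P] ?B (leg K [] [Q] [P, Q] [Q, P] ?B t)"
    using block_add_right[of t "Suc 0" "Suc 0" "Suc 0"] t by simp
  also have "leg K [] [Q] [P, Q] [Q, P] ?B t = leg K [] [Q] [P, Q] [Q, P] f t"
    by (rule leg_cong[OF _ _ _ _ B f block_1_1]) (use t in simp_all)
  also have "leg K [Q] [] [P, Q] [Q, P] ?B \<dots> = leg K [Q] [] [P, Q] [Q, P] f \<dots>"
    by (rule leg_cong[OF _ _ _ _ B f block_1_1]) (use c in simp_all)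
  finally show ?thesis by (simp add: numeral_2_eq_2)
qed

end

context braided_space
begin

text \<open>The braid relation is the square for two strands against one. Adding strands extends it
  to \<open>m\<close>, and the letters of \<open>block k l\<close> extend it to \<open>n\<close>
  factors. The premise \<open>k + l = n\<close> lets \<open>block k l\<close> be read as an
  endomorphism over \<open>Ps n\<close>.\<close>

lemma left_natural_R: "left_natural n m (block k l)" if "k + l = n"
proof -
  have "left_natural 2 (Suc 0) R"
    unfolding left_natural_def
  proof (intro conjI ballI)
    show "tlinear (Ps 2) (Ps 2) R" using R by (simp add: numeral_2_eq_2)
    fix t assume "t \<in> tensors (Ps 2 @ Qs (Suc 0))"
    then have t: "t \<in> tensors [V, V, V]" by (simp add: numeral_2_eq_2)
    have c: "leg K [] [V] [V, V] [V, V] R t \<in> tensors [V, V, V]"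
      using linear_map_closed[OF leg_linear[OF _ _ _ _ R, of "[]" "[V]"], of t] t by simp
    show "block 2 (Suc 0) (leg K [] (Qs (Suc 0)) (Ps 2) (Ps 2) R t)
        = leg K (Qs (Suc 0)) [] (Ps 2) (Ps 2) R (block 2 (Suc 0) t)"
      using braid[OF t] block_2_1[OF t] block_2_1[OF c] by (simp add: numeral_2_eq_2)
  qed
  moreover have n: "Ps n = Ps k @ Ps l" by (metis that replicate_add)
  then have "crosses V V (block_crossing k l) (Ps n) (Ps l @ Ps k)"
    using crosses_block[of V V k l] by simp
  ultimately have "left_natural n m (cross_seq K R (block_crossing k l) (Ps n))"
    by (rule left_natural_cross_seq[OF left_natural_all])
  then show ?thesis unfolding block_def n .
qed

abbreviation comp :: "nat \<Rightarrow> nat \<Rightarrow> ('v list \<Rightarrow> 'a) set \<Rightarrow> ('v list \<Rightarrow> 'a) set \<Rightarrow> ('v list \<Rightarrow> 'a) set"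
  where "comp n m x y \<equiv> braid_component K V R n m x y"

lemma comp_eq: "comp n m x y = block n m (tcat K (Ps n) (Ps m) x y)"
  by (simp add: braid_component_def block_def)

lemma tpower_module: "module K (tpower K V n)"
  by (simp add: tpower_def tensor_module)

text \<open>A block crossing exchanges two groups of factors. For equal factors the exchanged list
  is that of the power of degree \<open>n + m\<close>, so products land in the right degree.\<close>

lemma replicate_commute: "replicate m x @ replicate n x = replicate (n + m) x"
  by (simp add: replicate_add[symmetric] add.commute)

lemma comp_linear_left:
  "y \<in> carrier (tpower K V m) \<Longrightarrow> linear_map K (tpower K V n) (tpower K V (n + m)) (\<lambda>x. comp n m x y)"
  unfolding comp_eq tpower_def replicate_commute[symmetric]
  by (rule linear_map_compose[OF tcat_linear_left block_linear]) simp_all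

lemma comp_linear_right:
  "x \<in> carrier (tpower K V n) \<Longrightarrow> linear_map K (tpower K V m) (tpower K V (n + m)) (\<lambda>y. comp n m x y)"
  unfolding comp_eq tpower_def replicate_commute[symmetric]
  by (rule linear_map_compose[OF tcat_linear_right block_linear]) simp_all

lemma comp_closed:
  "x \<in> carrier (tpower K V n) \<Longrightarrow> y \<in> carrier (tpower K V m) \<Longrightarrow> comp n m x y \<in> carrier (tpower K V (n + m))"
  by (rule linear_map_closed[OF comp_linear_left])

text \<open>By naturality the crossing of \<open>x\<close> with \<open>y\<close> may be postponed
  until \<open>z\<close> has passed both. The passage of \<open>z\<close> splits along
  \<open>n + m\<close>: its crossing with \<open>y\<close> gives the inner product on the right, and
  the crossings of \<open>x\<close> with \<open>z\<close> and with \<open>y\<close> merge into one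
  block.\<close>

lemma comp_assoc:
  assumes x: "x \<in> carrier (tpower K V n)" and y: "y \<in> carrier (tpower K V m)" and z: "z \<in> carrier (tpower K V p)"
  shows "comp (n + m) p (comp n m x y) z = comp n (m + p) x (comp m p y z)"
proof -
  note xyz = x[unfolded tpower_def] y[unfolded tpower_def] z[unfolded tpower_def]
  have xy: "tcat K (Ps n) (Ps m) x y \<in> tensors (Ps n @ Ps m)"
    and yz: "tcat K (Ps m) (Ps p) y z \<in> tensors (Ps m @ Ps p)"
    using xyz by (auto intro: tcat_closed)
  let ?t = "tcat K (Ps n) (Ps m @ Ps p) x (tcat K (Ps m) (Ps p) y z)"
  have t: "?t \<in> tensors (Ps n @ Ps m @ Ps p)" using xyz yz by (auto intro: tcat_closed)
  have t': "tcat K (Ps n @ Ps m) (Ps p) (tcat K (Ps n) (Ps m) x y) z = ?t"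
    by (rule tcat_assoc) (use xyz in auto)
  let ?B = "leg K (Ps p) [] (Ps n @ Ps m) (Ps m @ Ps n) (block n m)"
  have "comp (n + m) p (comp n m x y) z
      = block (n + m) p (tcat K (Ps m @ Ps n) (Ps p) (block n m (tcat K (Ps n) (Ps m) x y)) z)"
    by (simp add: comp_eq replicate_commute)
  also have "tcat K (Ps m @ Ps n) (Ps p) (block n m (tcat K (Ps n) (Ps m) x y)) z
      = leg K [] (Ps p) (Ps n @ Ps m) (Ps m @ Ps n) (block n m) ?t"
    using leg_left[OF _ _ _ block_linear xy xyz(3)] t' by simp
  also have "block (n + m) p \<dots> = ?B (block (n + m) p ?t)"
    using left_natural_R[of n m "n + m" p, unfolded left_natural_def, THEN conjunct2, rule_format, of ?t] t
      replicate_commute[of m V n]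
    by (simp add: replicate_add)
  also have "block (n + m) p ?t = leg K [] (Ps m) (Ps n @ Ps p) (Ps p @ Ps n) (block n p)
      (leg K (Ps n) [] (Ps m @ Ps p) (Ps p @ Ps m) (block m p) ?t)"
    by (rule block_add_left) (use t in \<open>simp add: replicate_add\<close>)
  also have "leg K (Ps n) [] (Ps m @ Ps p) (Ps p @ Ps m) (block m p) ?t
      = tcat K (Ps n) (Ps p @ Ps m) x (block m p (tcat K (Ps m) (Ps p) y z))" (is "_ = ?u")
    by (rule leg_right[OF _ _ _ block_linear xyz(1) yz]) simp_all
  \<comment> \<open>The size is \<open>p + m\<close> rather than \<open>m + p\<close> because the
    product of \<open>y\<close> and \<open>z\<close> has already exchanged their groups of
    factors.\<close>
  also have "?B (leg K [] (Ps m) (Ps n @ Ps p) (Ps p @ Ps n) (block n p) ?u) = block n (p + m) ?u"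
    by (rule block_add_right[symmetric])
      (use tcat_closed[OF _ _ xyz(1) linear_map_closed[OF block_linear yz]] in \<open>simp add: replicate_add\<close>)
  also have "\<dots> = comp n (m + p) x (comp m p y z)"
    by (simp add: comp_eq replicate_commute add.commute)
  finally show ?thesis .
qed

abbreviation (input) TV where "TV \<equiv> tensor_space K V"
abbreviation (input) A where "A \<equiv> braid_algebra K V R"

lemma tensor_space_module: "module K TV"
  unfolding tensor_space_def by (rule direct_sum_module) (rule tpower_module)

lemma braid_algebra_sel [simp]:
  "carrier A = carrier TV" "add A = add TV" "zero A = zero TV" "smult A = smult TV"
  "one A = tensor_one K V"
  by (simp_all add: braid_algebra_def)

lemma mult_apply:
  "mult A x y q = (\<Oplus>\<^bsub>tpower K V q\<^esub>n\<in>{..q}. comp n (q - n) (x n) (y (q - n)))"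
  by (simp_all add: braid_algebra_def)

lemma TV_sel:
  "zero TV = (\<lambda>i. \<zero>\<^bsub>tpower K V i\<^esub>)"
  "add TV x y = (\<lambda>i. x i \<oplus>\<^bsub>tpower K V i\<^esub> y i)"
  "smult TV c x = (\<lambda>i. c \<odot>\<^bsub>tpower K V i\<^esub> x i)"
  by (simp_all add: tensor_space_def)

lemma TV_carrier:
  "x \<in> carrier TV \<longleftrightarrow> (\<forall>i. x i \<in> carrier (tpower K V i)) \<and> finite {i. x i \<noteq> \<zero>\<^bsub>tpower K V i\<^esub>}"
  by (simp add: tensor_space_def direct_sum_carrier)

lemma comp_closed':
  assumes "x \<in> carrier TV" "y \<in> carrier TV" "n \<le> q"
  shows "comp n (q - n) (x n) (y (q - n)) \<in> carrier (tpower K V q)"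
  using comp_closed[of "x n" n "y (q - n)" "q - n"] assms by (simp add: TV_carrier)

text \<open>A non-zero component in degree \<open>q\<close> forces a term whose two arguments are
  both non-zero, so the support of the product lies in the sumset of two finite supports.\<close>

lemma mult_closed:
  assumes x: "x \<in> carrier TV" and y: "y \<in> carrier TV"
  shows "x \<otimes>\<^bsub>A\<^esub> y \<in> carrier TV"
proof -
  let ?Z = "\<lambda>x. {i. x i \<noteq> \<zero>\<^bsub>tpower K V i\<^esub>}"
  have c: "(x \<otimes>\<^bsub>A\<^esub> y) q \<in> carrier (tpower K V q)" for q
  proof -
    interpret T: module K "tpower K V q" by (rule tpower_module)
    show ?thesis unfolding mult_apply by (rule T.M.finsum_closed) (use comp_closed'[OF x y] in auto)
  qed
  have "?Z (x \<otimes>\<^bsub>A\<^esub> y) \<subseteq> (\<lambda>(n, m). n + m) ` (?Z x \<times> ?Z y)"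
  proof
    fix q assume q: "q \<in> ?Z (x \<otimes>\<^bsub>A\<^esub> y)"
    interpret T: module K "tpower K V q" by (rule tpower_module)
    have "\<exists>n\<le>q. comp n (q - n) (x n) (y (q - n)) \<noteq> \<zero>\<^bsub>tpower K V q\<^esub>"
    proof (rule ccontr)
      assume *: "\<not> ?thesis"
      have "(x \<otimes>\<^bsub>A\<^esub> y) q = (\<Oplus>\<^bsub>tpower K V q\<^esub>n\<in>{..q}. \<zero>\<^bsub>tpower K V q\<^esub>)"
        unfolding mult_apply by (rule T.M.finsum_cong') (use * in auto)
      then show False using q by simp
    qed
    then obtain n where n: "n \<le> q" "comp n (q - n) (x n) (y (q - n)) \<noteq> \<zero>\<^bsub>tpower K V q\<^esub>" by auto
    have xy: "x n \<in> carrier (tpower K V n)" "y (q - n) \<in> carrier (tpower K V (q - n))"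
      using x y by (auto simp: TV_carrier)
    have "x n \<noteq> \<zero>\<^bsub>tpower K V n\<^esub>"
      using n linear_map_zero[OF tpower_module tpower_module comp_linear_left[OF xy(2), of n]] by auto
    moreover have "y (q - n) \<noteq> \<zero>\<^bsub>tpower K V (q - n)\<^esub>"
      using n linear_map_zero[OF tpower_module tpower_module comp_linear_right[OF xy(1), of "q - n"]] by auto
    ultimately show "q \<in> (\<lambda>(n, m). n + m) ` (?Z x \<times> ?Z y)"
      using n(1) by (auto intro!: rev_image_eqI[of "(n, q - n)"])
  qed
  then have "finite (?Z (x \<otimes>\<^bsub>A\<^esub> y))"
    by (rule finite_subset) (use x y in \<open>auto simp: TV_carrier\<close>)
  then show ?thesis using c by (simp add: TV_carrier)
qed

lemma mult_linear_left:
  assumes y: "y \<in> carrier TV"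
  shows "linear_map K TV TV (\<lambda>x. x \<otimes>\<^bsub>A\<^esub> y)"
proof (rule linear_mapI)
  fix x assume x: "x \<in> carrier TV"
  show "x \<otimes>\<^bsub>A\<^esub> y \<in> carrier TV" by (rule mult_closed[OF x y])
  have xc: "x n \<in> carrier (tpower K V n)" and yc: "y n \<in> carrier (tpower K V n)" for n
    using x y by (auto simp: TV_carrier)
  have lin: "linear_map K (tpower K V n) (tpower K V q) (\<lambda>a. comp n (q - n) a (y (q - n)))" if "n \<le> q" for n q
    using comp_linear_left[OF yc, of n "q - n"] that by simp
  show "(c \<odot>\<^bsub>TV\<^esub> x) \<otimes>\<^bsub>A\<^esub> y = c \<odot>\<^bsub>TV\<^esub> (x \<otimes>\<^bsub>A\<^esub> y)" if c: "c \<in> carrier K" for c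
  proof
    fix q
    interpret T: module K "tpower K V q" by (rule tpower_module)
    have "(\<Oplus>\<^bsub>tpower K V q\<^esub>n\<in>{..q}. comp n (q - n) (c \<odot>\<^bsub>tpower K V n\<^esub> x n) (y (q - n)))
        = (\<Oplus>\<^bsub>tpower K V q\<^esub>n\<in>{..q}. c \<odot>\<^bsub>tpower K V q\<^esub> comp n (q - n) (x n) (y (q - n)))"
      by (rule T.M.finsum_cong')
        (use linear_map_smult[OF lin c xc] comp_closed'[OF x y] c in auto)
    then show "((c \<odot>\<^bsub>TV\<^esub> x) \<otimes>\<^bsub>A\<^esub> y) q = (c \<odot>\<^bsub>TV\<^esub> (x \<otimes>\<^bsub>A\<^esub> y)) q"
      using T.finsum_smult_ldistr[of "{..q}" c "\<lambda>n. comp n (q - n) (x n) (y (q - n))"] c comp_closed'[OF x y]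
      by (simp add: TV_sel mult_apply Pi_def)
  qed
  fix z assume z: "z \<in> carrier TV"
  then have zc: "z n \<in> carrier (tpower K V n)" for n by (auto simp: TV_carrier)
  show "(x \<oplus>\<^bsub>TV\<^esub> z) \<otimes>\<^bsub>A\<^esub> y = x \<otimes>\<^bsub>A\<^esub> y \<oplus>\<^bsub>TV\<^esub> z \<otimes>\<^bsub>A\<^esub> y"
  proof
    fix q
    interpret T: module K "tpower K V q" by (rule tpower_module)
    have "(\<Oplus>\<^bsub>tpower K V q\<^esub>n\<in>{..q}. comp n (q - n) (x n \<oplus>\<^bsub>tpower K V n\<^esub> z n) (y (q - n)))
        = (\<Oplus>\<^bsub>tpower K V q\<^esub>n\<in>{..q}. comp n (q - n) (x n) (y (q - n))
            \<oplus>\<^bsub>tpower K V q\<^esub> comp n (q - n) (z n) (y (q - n)))"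
      by (rule T.M.finsum_cong')
        (use linear_map_add[OF lin xc zc] comp_closed'[OF x y] comp_closed'[OF z y] in auto)
    then show "((x \<oplus>\<^bsub>TV\<^esub> z) \<otimes>\<^bsub>A\<^esub> y) q = (x \<otimes>\<^bsub>A\<^esub> y \<oplus>\<^bsub>TV\<^esub> z \<otimes>\<^bsub>A\<^esub> y) q"
      using T.M.finsum_addf[of "\<lambda>n. comp n (q - n) (x n) (y (q - n))" "{..q}" "\<lambda>n. comp n (q - n) (z n) (y (q - n))"]
        comp_closed'[OF x y] comp_closed'[OF z y]
      by (simp add: TV_sel mult_apply Pi_def)
  qed
qed

lemma mult_linear_right:
  assumes x: "x \<in> carrier TV"
  shows "linear_map K TV TV (\<lambda>y. x \<otimes>\<^bsub>A\<^esub> y)"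
proof (rule linear_mapI)
  fix y assume y: "y \<in> carrier TV"
  show "x \<otimes>\<^bsub>A\<^esub> y \<in> carrier TV" by (rule mult_closed[OF x y])
  have xc: "x n \<in> carrier (tpower K V n)" and yc: "y n \<in> carrier (tpower K V n)" for n
    using x y by (auto simp: TV_carrier)
  have lin: "linear_map K (tpower K V (q - n)) (tpower K V q) (\<lambda>b. comp n (q - n) (x n) b)" if "n \<le> q" for n q
    using comp_linear_right[OF xc, of "q - n" n] that by simp
  show "x \<otimes>\<^bsub>A\<^esub> (c \<odot>\<^bsub>TV\<^esub> y) = c \<odot>\<^bsub>TV\<^esub> (x \<otimes>\<^bsub>A\<^esub> y)" if c: "c \<in> carrier K" for c
  proof
    fix q
    interpret T: module K "tpower K V q" by (rule tpower_module)
    have "(\<Oplus>\<^bsub>tpower K V q\<^esub>n\<in>{..q}. comp n (q - n) (x n) (c \<odot>\<^bsub>tpower K V (q - n)\<^esub> y (q - n)))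
        = (\<Oplus>\<^bsub>tpower K V q\<^esub>n\<in>{..q}. c \<odot>\<^bsub>tpower K V q\<^esub> comp n (q - n) (x n) (y (q - n)))"
      by (rule T.M.finsum_cong')
        (use linear_map_smult[OF lin c yc] comp_closed'[OF x y] c in auto)
    then show "(x \<otimes>\<^bsub>A\<^esub> (c \<odot>\<^bsub>TV\<^esub> y)) q = (c \<odot>\<^bsub>TV\<^esub> (x \<otimes>\<^bsub>A\<^esub> y)) q"
      using T.finsum_smult_ldistr[of "{..q}" c "\<lambda>n. comp n (q - n) (x n) (y (q - n))"] c comp_closed'[OF x y]
      by (simp add: TV_sel mult_apply Pi_def)
  qed
  fix z assume z: "z \<in> carrier TV"
  then have zc: "z n \<in> carrier (tpower K V n)" for n by (auto simp: TV_carrier)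
  show "x \<otimes>\<^bsub>A\<^esub> (y \<oplus>\<^bsub>TV\<^esub> z) = x \<otimes>\<^bsub>A\<^esub> y \<oplus>\<^bsub>TV\<^esub> x \<otimes>\<^bsub>A\<^esub> z"
  proof
    fix q
    interpret T: module K "tpower K V q" by (rule tpower_module)
    have "(\<Oplus>\<^bsub>tpower K V q\<^esub>n\<in>{..q}. comp n (q - n) (x n) (y (q - n) \<oplus>\<^bsub>tpower K V (q - n)\<^esub> z (q - n)))
        = (\<Oplus>\<^bsub>tpower K V q\<^esub>n\<in>{..q}. comp n (q - n) (x n) (y (q - n))
            \<oplus>\<^bsub>tpower K V q\<^esub> comp n (q - n) (x n) (z (q - n)))"
      by (rule T.M.finsum_cong')
        (use linear_map_add[OF lin yc zc] comp_closed'[OF x y] comp_closed'[OF x z] in auto)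
    then show "(x \<otimes>\<^bsub>A\<^esub> (y \<oplus>\<^bsub>TV\<^esub> z)) q = (x \<otimes>\<^bsub>A\<^esub> y \<oplus>\<^bsub>TV\<^esub> x \<otimes>\<^bsub>A\<^esub> z) q"
      using T.M.finsum_addf[of "\<lambda>n. comp n (q - n) (x n) (y (q - n))" "{..q}" "\<lambda>n. comp n (q - n) (x n) (z (q - n))"]
        comp_closed'[OF x y] comp_closed'[OF x z]
      by (simp add: TV_sel mult_apply Pi_def)
  qed
qed

lemma tsummand_closed: "a \<in> carrier (tpower K V n) \<Longrightarrow> summand (tpower K V) n a \<in> carrier TV"
  unfolding tensor_space_def by (rule summand_closed) (rule tpower_module)

text \<open>In the convolution only \<open>k = n\<close> with \<open>q - k = m\<close> can
  contribute, which happens in degree \<open>n + m\<close> alone. It reduces the algebra laws to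
  identities between components.\<close>

lemma mult_summand:
  assumes a: "a \<in> carrier (tpower K V n)" and b: "b \<in> carrier (tpower K V m)"
  shows "summand (tpower K V) n a \<otimes>\<^bsub>A\<^esub> summand (tpower K V) m b = summand (tpower K V) (n + m) (comp n m a b)"
proof
  fix q
  let ?x = "summand (tpower K V) n a" and ?y = "summand (tpower K V) m b"
  interpret T: module K "tpower K V q" by (rule tpower_module)
  note cl = comp_closed'[OF tsummand_closed[OF a] tsummand_closed[OF b]]
  have z: "comp k (q - k) (?x k) (?y (q - k)) = (if k = n \<and> q - k = m then comp n m a b else \<zero>\<^bsub>tpower K V q\<^esub>)"
    if k: "k \<le> q" for k
  proof -
    have l: "comp k (q - k) \<zero>\<^bsub>tpower K V k\<^esub> (?y (q - k)) = \<zero>\<^bsub>tpower K V q\<^esub>"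
      using linear_map_zero[OF tpower_module tpower_module comp_linear_left[of "?y (q - k)" "q - k" k]]
        tsummand_closed[OF b] k by (simp add: TV_carrier)
    have r: "comp k (q - k) (?x k) \<zero>\<^bsub>tpower K V (q - k)\<^esub> = \<zero>\<^bsub>tpower K V q\<^esub>"
      using linear_map_zero[OF tpower_module tpower_module comp_linear_right[of "?x k" k "q - k"]]
        tsummand_closed[OF a] k by (simp add: TV_carrier)
    show ?thesis
    proof (cases "k = n")
      case True
      then show ?thesis using r by (auto simp: summand_def)
    next
      case False
      then have "?x k = \<zero>\<^bsub>tpower K V k\<^esub>" by (simp add: summand_def)
      with False show ?thesis using l by simp
    qed
  qed
  have "(?x \<otimes>\<^bsub>A\<^esub> ?y) q = (\<Oplus>\<^bsub>tpower K V q\<^esub>k\<in>{..q}. if k = n \<and> q - k = m then comp n m a b else \<zero>\<^bsub>tpower K V q\<^esub>)"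
    unfolding mult_apply by (rule T.M.finsum_cong') (use cl z comp_closed[OF a b] in auto)
  also have "\<dots> = summand (tpower K V) (n + m) (comp n m a b) q"
  proof (cases "q = n + m")
    case True
    \<comment> \<open>For \<open>q = n + m\<close> the condition on \<open>q - k\<close> follows
      from \<open>k = n\<close>; the remaining test is turned round to match
      \<open>finsum_singleton\<close>.\<close>
    then have "(\<Oplus>\<^bsub>tpower K V q\<^esub>k\<in>{..q}. if k = n \<and> q - k = m then comp n m a b else \<zero>\<^bsub>tpower K V q\<^esub>)
        = (\<Oplus>\<^bsub>tpower K V q\<^esub>k\<in>{..q}. if n = k then comp n m a b else \<zero>\<^bsub>tpower K V q\<^esub>)"
      using comp_closed[OF a b] module_zero_closed[OF tpower_module] by (intro T.M.finsum_cong') auto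
    then show ?thesis
      using T.M.finsum_singleton[of n "{..q}" "\<lambda>_. comp n m a b"] comp_closed[OF a b] True by (simp add: summand_def)
  next
    case False
    then have "(\<Oplus>\<^bsub>tpower K V q\<^esub>k\<in>{..q}. if k = n \<and> q - k = m then comp n m a b else \<zero>\<^bsub>tpower K V q\<^esub>)
        = (\<Oplus>\<^bsub>tpower K V q\<^esub>k\<in>{..q}. \<zero>\<^bsub>tpower K V q\<^esub>)"
      by (intro T.M.finsum_cong') auto
    then show ?thesis using False by (simp add: summand_def)
  qed
  finally show "(?x \<otimes>\<^bsub>A\<^esub> ?y) q = summand (tpower K V) (n + m) (comp n m a b) q" .
qed

lemma TV_eqI:
  assumes "linear_map K TV N f" "linear_map K TV N g"
    and "\<And>n a. a \<in> carrier (tpower K V n) \<Longrightarrow> f (summand (tpower K V) n a) = g (summand (tpower K V) n a)"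
    and "x \<in> carrier TV"
  shows "f x = g x"
  using direct_sum_eqI[of "tpower K V", OF tpower_module] assms unfolding tensor_space_def by blast

lemma tpower_one_closed: "pure K [] [] \<in> carrier (tpower K V 0)"
  by (simp add: tpower_def unit_closed)

lemma tensor_one_closed: "tensor_one K V \<in> carrier TV"
  unfolding tensor_one_def by (rule tsummand_closed[OF tpower_one_closed])

text \<open>Both sides are linear in each of the three arguments, so homogeneous arguments suffice,
  and for these \<open>comp_assoc\<close> applies.\<close>

lemma mult_assoc:
  assumes x: "x \<in> carrier TV" and y: "y \<in> carrier TV" and z: "z \<in> carrier TV"
  shows "x \<otimes>\<^bsub>A\<^esub> y \<otimes>\<^bsub>A\<^esub> z = x \<otimes>\<^bsub>A\<^esub> (y \<otimes>\<^bsub>A\<^esub> z)"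
proof (rule TV_eqI[OF linear_map_compose[OF mult_linear_left[OF y] mult_linear_left[OF z]]
      mult_linear_left[OF mult_closed[OF y z]] _ x])
  fix n a assume a: "a \<in> carrier (tpower K V n)"
  note sa = tsummand_closed[OF a]
  show "summand (tpower K V) n a \<otimes>\<^bsub>A\<^esub> y \<otimes>\<^bsub>A\<^esub> z = summand (tpower K V) n a \<otimes>\<^bsub>A\<^esub> (y \<otimes>\<^bsub>A\<^esub> z)"
  proof (rule TV_eqI[OF linear_map_compose[OF mult_linear_right[OF sa] mult_linear_left[OF z]]
        linear_map_compose[OF mult_linear_left[OF z] mult_linear_right[OF sa]] _ y])
    fix m b assume b: "b \<in> carrier (tpower K V m)"
    note sb = tsummand_closed[OF b]
    show "summand (tpower K V) n a \<otimes>\<^bsub>A\<^esub> summand (tpower K V) m b \<otimes>\<^bsub>A\<^esub> z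
        = summand (tpower K V) n a \<otimes>\<^bsub>A\<^esub> (summand (tpower K V) m b \<otimes>\<^bsub>A\<^esub> z)"
      by (rule TV_eqI[OF mult_linear_right[OF mult_closed[OF sa sb]]
            linear_map_compose[OF mult_linear_right[OF sb] mult_linear_right[OF sa]] _ z])
        (simp only: mult_summand a b comp_closed comp_assoc add.assoc)
  qed
qed

lemma mult_one_left:
  assumes "x \<in> carrier TV" shows "tensor_one K V \<otimes>\<^bsub>A\<^esub> x = x"
  by (rule TV_eqI[OF mult_linear_right[OF tensor_one_closed] linear_map_ident _ assms])
    (simp add: tensor_one_def mult_summand tpower_one_closed, simp add: comp_eq block_0 tpower_def tcat_Nil_left)

lemma mult_one_right:
  assumes "x \<in> carrier TV" shows "x \<otimes>\<^bsub>A\<^esub> tensor_one K V = x"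
  by (rule TV_eqI[OF mult_linear_left[OF tensor_one_closed] linear_map_ident _ assms])
    (simp add: tensor_one_def mult_summand tpower_one_closed, simp add: comp_eq block_0 tpower_def tcat_Nil_right)

theorem braid_algebra_assoc: "assoc_algebra K A"
proof -
  have mod: "module K A" by (rule module_cong[OF tensor_space_module]) simp_all
  have "ring A"
  proof (rule ringI)
    show "abelian_group A" using mod by (simp add: module_def)
    show "Group.monoid A"
      by (rule monoidI) (simp_all add: mult_closed mult_assoc mult_one_left mult_one_right tensor_one_closed)
  qed (simp_all add: linear_map_add[OF mult_linear_left] linear_map_add[OF mult_linear_right])
  then show ?thesis
    unfolding assoc_algebra_def using mod
    by (simp add: linear_map_smult[OF mult_linear_left] linear_map_smult[OF mult_linear_right])
qed

end

section \<open>Tensor products of braid algebras and of their underlying spaces\<close>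

section \<open>Independence of the multiplication\<close>

text \<open>These are the fields that \<open>tuples\<close> and \<open>tensor_relations\<close> read
  from a factor, so agreement in them makes tensor products equal, not just isomorphic, and makes
  maps such as \<open>leg\<close> and \<open>lift\<close> literally the same.\<close>

definition same_space :: "('k, 'b) module \<Rightarrow> ('k, 'b) module \<Rightarrow> bool"
  where "same_space M N \<longleftrightarrow> carrier M = carrier N \<and> add M = add N \<and> smult M = smult N"

lemma same_space_refl [simp]: "same_space M M"
  by (simp add: same_space_def)

lemma same_spaces_nth:
  "list_all2 same_space Ms Ns \<Longrightarrow> i < length Ns \<Longrightarrow>
    carrier (Ms ! i) = carrier (Ns ! i) \<and> add (Ms ! i) = add (Ns ! i) \<and> smult (Ms ! i) = smult (Ns ! i)"
  by (simp add: list_all2_conv_all_nth same_space_def)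

lemma same_spaces_sym: "list_all2 same_space Ms Ns \<Longrightarrow> list_all2 same_space Ns Ms"
  by (simp add: list_all2_conv_all_nth same_space_def)

lemma tuples_same: "list_all2 same_space Ms Ns \<Longrightarrow> tuples Ms = tuples Ns"
  by (simp add: tuples_def list_all2_conv_all_nth same_space_def) metis

lemma tensor_relations_same_subset:
  assumes s: "list_all2 same_space Ms Ns"
  shows "tensor_relations K Ms \<subseteq> tensor_relations K Ns"
proof
  note t = tuples_same[OF s] and l = list_all2_lengthD[OF s] and n = same_spaces_nth[OF s]
  let ?F = "free_module K (tuples Ns)" and ?e = "free_gen K"
  fix r assume "r \<in> tensor_relations K Ms"
  then consider (add) xs i a b where "xs \<in> tuples Ns" "i < length Ns" "a \<in> carrier (Ns!i)" "b \<in> carrier (Ns!i)"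
        "r = ?e (xs[i := a \<oplus>\<^bsub>Ns!i\<^esub> b]) \<ominus>\<^bsub>?F\<^esub> (?e (xs[i := a]) \<oplus>\<^bsub>?F\<^esub> ?e (xs[i := b]))"
      | (smult) xs i c a where "xs \<in> tuples Ns" "i < length Ns" "c \<in> carrier K" "a \<in> carrier (Ns!i)"
        "r = ?e (xs[i := c \<odot>\<^bsub>Ns!i\<^esub> a]) \<ominus>\<^bsub>?F\<^esub> (c \<odot>\<^bsub>?F\<^esub> ?e (xs[i := a]))"
    unfolding tensor_relations_def Let_def t l by (auto simp: n)
  then show "r \<in> tensor_relations K Ns"
    unfolding tensor_relations_def Let_def by cases blast+
qed

lemma tensor_relations_same: "list_all2 same_space Ms Ns \<Longrightarrow> tensor_relations K Ms = tensor_relations K Ns"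
  by (intro equalityI tensor_relations_same_subset) (auto intro: same_spaces_sym)

lemma tensor_same: "list_all2 same_space Ms Ns \<Longrightarrow> tensor K Ms = tensor K Ns"
  by (simp add: tensor_def tensor_relations_same tuples_same)

lemma pure_same: "list_all2 same_space Ms Ns \<Longrightarrow> pure K Ms = pure K Ns"
  by (simp add: pure_def fun_eq_iff tensor_relations_same tuples_same)

lemma lift_same: "list_all2 same_space Ms Ns \<Longrightarrow> lift K Ms N f = lift K Ns N f"
  by (simp add: lift_def tensor_same tuples_same pure_same)

lemma tcat_same:
  assumes "list_all2 same_space Ms Ms'" "list_all2 same_space Ns Ns'"
  shows "tcat K Ms Ns = tcat K Ms' Ns'"
  using assms list_all2_appendI[OF assms]
  by (simp add: tcat_def fun_eq_iff lift_same tensor_same pure_same)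

lemma leg_same:
  assumes "list_all2 same_space Ms Ms'" "list_all2 same_space Ns Ns'"
    and "list_all2 same_space Ps Ps'" "list_all2 same_space Qs Qs'"
  shows "leg K Ms Ns Ps Qs f = leg K Ms' Ns' Ps' Qs' f"
proof -
  have "list_all2 same_space (Ms @ Ps @ Ns) (Ms' @ Ps' @ Ns')" "list_all2 same_space (Qs @ Ns) (Qs' @ Ns')"
    "list_all2 same_space (Ms @ Qs @ Ns) (Ms' @ Qs' @ Ns')"
    using assms by (auto intro!: list_all2_appendI)
  then show ?thesis
    using assms assms[THEN list_all2_lengthD]
      tcat_same[of Ms Ms' "Qs @ Ns" "Qs' @ Ns'" K] tcat_same[of Qs Qs' Ns Ns' K]
    by (simp add: leg_def lift_same[of "Ms @ Ps @ Ns" "Ms' @ Ps' @ Ns'"]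
        tensor_same[of "Ms @ Qs @ Ns" "Ms' @ Qs' @ Ns'"] pure_same[of Ms Ms'] pure_same[of Ps Ps'] pure_same[of Ns Ns'])
qed

section \<open>Uniqueness of linear maps out of tensor products of direct sums\<close>

section \<open>Multilinear maps on direct sums\<close>

context scalar_ring
begin

lemma pure_pair_linear:
  assumes m: "module K M" "module K N"
  shows "y \<in> carrier N \<Longrightarrow> linear_map K M (tensor K [M, N]) (\<lambda>x. pure K [M, N] [x, y])"
    and "x \<in> carrier M \<Longrightarrow> linear_map K N (tensor K [M, N]) (\<lambda>y. pure K [M, N] [x, y])"
  using multilinear_linear[OF pure_multilinear[of "[M, N]"], of "[\<zero>\<^bsub>M\<^esub>, y]" 0]
    multilinear_linear[OF pure_multilinear[of "[M, N]"], of "[x, \<zero>\<^bsub>N\<^esub>]" 1] m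
  by (simp_all add: module_zero_closed)

lemma pure_triple_linear:
  assumes m: "module K M" "module K N" "module K P"
  shows "y \<in> carrier N \<Longrightarrow> z \<in> carrier P \<Longrightarrow> linear_map K M (tensor K [M, N, P]) (\<lambda>x. pure K [M, N, P] [x, y, z])"
    and "x \<in> carrier M \<Longrightarrow> z \<in> carrier P \<Longrightarrow> linear_map K N (tensor K [M, N, P]) (\<lambda>y. pure K [M, N, P] [x, y, z])"
    and "x \<in> carrier M \<Longrightarrow> y \<in> carrier N \<Longrightarrow> linear_map K P (tensor K [M, N, P]) (\<lambda>z. pure K [M, N, P] [x, y, z])"
  using multilinear_linear[OF pure_multilinear[of "[M, N, P]"], of "[\<zero>\<^bsub>M\<^esub>, y, z]" 0]
    multilinear_linear[OF pure_multilinear[of "[M, N, P]"], of "[x, \<zero>\<^bsub>N\<^esub>, z]" 1]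
    multilinear_linear[OF pure_multilinear[of "[M, N, P]"], of "[x, y, \<zero>\<^bsub>P\<^esub>]" 2] m
  by (simp_all add: module_zero_closed numeral_2_eq_2)

lemma tensor2_direct_sum_eqI:
  assumes L: "\<And>i. module K (L i)" and M: "\<And>i. module K (M i)" and N: "module K N"
    and f: "linear_map K (tensor K [direct_sum L, direct_sum M]) N f"
    and g: "linear_map K (tensor K [direct_sum L, direct_sum M]) N g"
    and eq: "\<And>i j a b. a \<in> carrier (L i) \<Longrightarrow> b \<in> carrier (M j) \<Longrightarrow>
      f (pure K [direct_sum L, direct_sum M] [summand L i a, summand M j b])
      = g (pure K [direct_sum L, direct_sum M] [summand L i a, summand M j b])"
    and t: "t \<in> tensors [direct_sum L, direct_sum M]"
  shows "f t = g t"
proof -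
  note mod = direct_sum_module[of L, OF L] direct_sum_module[of M, OF M]
  note lin = pure_pair_linear[OF mod]
  show ?thesis
  proof (rule tensor_eqI[OF _ N f g _ t])
    show "modules [direct_sum L, direct_sum M]" using mod by simp
    fix xs assume "xs \<in> tuples [direct_sum L, direct_sum M]"
    then obtain x y where xs: "xs = [x, y]" "x \<in> carrier (direct_sum L)" "y \<in> carrier (direct_sum M)"
      by (rule tuples_pairE)
    show "f (pure K [direct_sum L, direct_sum M] xs) = g (pure K [direct_sum L, direct_sum M] xs)"
      unfolding xs(1)
    proof (rule direct_sum_eqI[OF L linear_map_compose[OF lin(1)[OF xs(3)] f]
          linear_map_compose[OF lin(1)[OF xs(3)] g] _ xs(2)])
      fix i a assume a: "a \<in> carrier (L i)"
      note sa = summand_closed[of L, OF L a]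
      show "f (pure K [direct_sum L, direct_sum M] [summand L i a, y])
          = g (pure K [direct_sum L, direct_sum M] [summand L i a, y])"
        by (rule direct_sum_eqI[OF M linear_map_compose[OF lin(2)[OF sa] f]
              linear_map_compose[OF lin(2)[OF sa] g] eq[OF a] xs(3)])
    qed
  qed
qed

lemma tensor3_direct_sum_eqI:
  assumes L: "\<And>i. module K (L i)" and M: "\<And>i. module K (M i)" and P: "\<And>i. module K (P i)" and N: "module K N"
    and f: "linear_map K (tensor K [direct_sum L, direct_sum M, direct_sum P]) N f"
    and g: "linear_map K (tensor K [direct_sum L, direct_sum M, direct_sum P]) N g"
    and eq: "\<And>i j k a b c. a \<in> carrier (L i) \<Longrightarrow> b \<in> carrier (M j) \<Longrightarrow> c \<in> carrier (P k) \<Longrightarrow>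
      f (pure K [direct_sum L, direct_sum M, direct_sum P] [summand L i a, summand M j b, summand P k c])
      = g (pure K [direct_sum L, direct_sum M, direct_sum P] [summand L i a, summand M j b, summand P k c])"
    and t: "t \<in> tensors [direct_sum L, direct_sum M, direct_sum P]"
  shows "f t = g t"
proof -
  let ?p = "pure K [direct_sum L, direct_sum M, direct_sum P]"
  note mod = direct_sum_module[of L, OF L] direct_sum_module[of M, OF M] direct_sum_module[of P, OF P]
  note lin = pure_triple_linear[OF mod]
  show ?thesis
  proof (rule tensor_eqI[OF _ N f g _ t])
    show "modules [direct_sum L, direct_sum M, direct_sum P]" using mod by simp
    fix xs assume "xs \<in> tuples [direct_sum L, direct_sum M, direct_sum P]"
    then obtain x y z where xs: "xs = [x, y, z]" "x \<in> carrier (direct_sum L)" "y \<in> carrier (direct_sum M)"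
      "z \<in> carrier (direct_sum P)" by (rule tuples_tripleE)
    show "f (?p xs) = g (?p xs)"
      unfolding xs(1)
    proof (rule direct_sum_eqI[OF L linear_map_compose[OF lin(1)[OF xs(3,4)] f]
          linear_map_compose[OF lin(1)[OF xs(3,4)] g] _ xs(2)])
      fix i a assume a: "a \<in> carrier (L i)"
      note sa = summand_closed[of L, OF L a]
      show "f (?p [summand L i a, y, z]) = g (?p [summand L i a, y, z])"
      proof (rule direct_sum_eqI[OF M linear_map_compose[OF lin(2)[OF sa xs(4)] f]
            linear_map_compose[OF lin(2)[OF sa xs(4)] g] _ xs(3)])
        fix j b assume b: "b \<in> carrier (M j)"
        note sb = summand_closed[of M, OF M b]
        show "f (?p [summand L i a, summand M j b, z]) = g (?p [summand L i a, summand M j b, z])"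
          by (rule direct_sum_eqI[OF P linear_map_compose[OF lin(3)[OF sa sb] f]
                linear_map_compose[OF lin(3)[OF sa sb] g] eq[OF a b] xs(4)])
      qed
    qed
  qed
qed

end

section \<open>Existence and uniqueness of the factorisation map\<close>

section \<open>The factorisation map\<close>

text \<open>The relations are recorded for \<open>R\<close>, \<open>R'\<close> and \<open>U\<close>
  in braid form, with the flips already absorbed into these maps; the construction of
  \<open>psi\<close> works from them.\<close>

locale mixed_braiding = scalar_ring +
  fixes V V' :: "('a, 'v) module" and R R' U
  assumes V_braided: "braided_space K V R" and V'_braided: "braided_space K V' R'"
    and U: "tlinear [V', V] [V, V'] U"
    and mixed_right: "t \<in> tensors [V', V, V] \<Longrightarrow>
      leg K [] [V'] [V, V] [V, V] R
        (leg K [V] [] [V', V] [V, V'] U (leg K [] [V] [V', V] [V, V'] U t))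
      = leg K [V] [] [V', V] [V, V'] U (leg K [] [V] [V', V] [V, V'] U (leg K [V'] [] [V, V] [V, V] R t))"
    and mixed_left: "t \<in> tensors [V', V', V] \<Longrightarrow>
      leg K [] [V'] [V', V] [V, V'] U
        (leg K [V'] [] [V', V] [V, V'] U (leg K [] [V] [V', V'] [V', V'] R' t))
      = leg K [V] [] [V', V'] [V', V'] R' (leg K [] [V'] [V', V] [V, V'] U (leg K [V'] [] [V', V] [V, V'] U t))"
begin

interpretation A: braided_space K V R by (rule V_braided)
interpretation B: braided_space K V' R' by (rule V'_braided)
interpretation C: crossing K V' V U
  by (intro crossing.intro crossing_axioms.intro scalar_ring_axioms A.V B.V U)

abbreviation (input) Vs where "Vs n \<equiv> replicate n V"
abbreviation (input) Ws where "Ws n \<equiv> replicate n V'"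
abbreviation (input) TV where "TV \<equiv> tensor_space K V"
abbreviation (input) TV' where "TV' \<equiv> tensor_space K V'"
abbreviation (input) TT where "TT \<equiv> tensor K [TV, TV']"
abbreviation (input) sV where "sV \<equiv> summand (tpower K V)"
abbreviation (input) sW where "sW \<equiv> summand (tpower K V')"
abbreviation (input) incl where "incl \<equiv> bidegree_incl K V V'"

lemma right_natural_R: "C.right_natural n (k + l) (A.block k l)"
proof -
  have "C.right_natural (Suc 0) 2 R"
    unfolding C.right_natural_def
  proof (intro conjI ballI)
    show "tlinear (Vs 2) (Vs 2) R" using A.R by (simp add: numeral_2_eq_2)
    fix t assume "t \<in> tensors (Ws (Suc 0) @ Vs 2)"
    then have t: "t \<in> tensors [V', V, V]" by (simp add: numeral_2_eq_2)
    have c: "leg K [V'] [] [V, V] [V, V] R t \<in> tensors [V', V, V]"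
      using linear_map_closed[OF leg_linear[OF _ _ _ _ A.R, of "[V']" "[]"], of t] t by simp
    show "C.block (Suc 0) 2 (leg K (Ws (Suc 0)) [] (Vs 2) (Vs 2) R t)
        = leg K [] (Ws (Suc 0)) (Vs 2) (Vs 2) R (C.block (Suc 0) 2 t)"
      using mixed_right[OF t] C.block_1_2[OF t] C.block_1_2[OF c] by (simp add: numeral_2_eq_2)
  qed
  then show ?thesis
    using C.right_natural_cross_seq[OF C.right_natural_all, of R "block_crossing k l" "k + l" "Vs l @ Vs k" n]
      crosses_block[of V V k l]
    by (simp add: A.block_def replicate_add)
qed

lemma left_natural_R': "C.left_natural (k + l) m (B.block k l)"
proof -
  have "C.left_natural 2 (Suc 0) R'"
    unfolding C.left_natural_def
  proof (intro conjI ballI)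
    show "tlinear (Ws 2) (Ws 2) R'" using B.R by (simp add: numeral_2_eq_2)
    fix t assume "t \<in> tensors (Ws 2 @ Vs (Suc 0))"
    then have t: "t \<in> tensors [V', V', V]" by (simp add: numeral_2_eq_2)
    have c: "leg K [] [V] [V', V'] [V', V'] R' t \<in> tensors [V', V', V]"
      using linear_map_closed[OF leg_linear[OF _ _ _ _ B.R, of "[]" "[V]"], of t] t by simp
    show "C.block 2 (Suc 0) (leg K [] (Vs (Suc 0)) (Ws 2) (Ws 2) R' t)
        = leg K (Vs (Suc 0)) [] (Ws 2) (Ws 2) R' (C.block 2 (Suc 0) t)"
      using mixed_left[OF t] C.block_2_1[OF t] C.block_2_1[OF c] by (simp add: numeral_2_eq_2)
  qed
  then show ?thesis
    using C.left_natural_cross_seq[OF C.left_natural_all, of R' "block_crossing k l" "k + l" "Ws l @ Ws k" m]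
      crosses_block[of V' V' k l]
    by (simp add: B.block_def replicate_add)
qed

lemma spaces [simp]: "module K TV" "module K TV'"
  by (rule A.tensor_space_module, rule B.tensor_space_module)

lemma TT_module: "module K TT"
  by (rule tensor_module) simp

lemma sV_closed: "a \<in> tensors (Vs m) \<Longrightarrow> sV m a \<in> carrier TV"
  using A.tsummand_closed by (simp add: tpower_def)

lemma sW_closed: "a \<in> tensors (Ws m) \<Longrightarrow> sW m a \<in> carrier TV'"
  using B.tsummand_closed by (simp add: tpower_def)

lemma sV_linear: "linear_map K (tensor K (Vs m)) TV (sV m)"
  using summand_linear[of "tpower K V" m] A.tpower_module by (simp add: tpower_def tensor_space_def)

lemma sW_linear: "linear_map K (tensor K (Ws m)) TV' (sW m)"
  using summand_linear[of "tpower K V'" m] B.tpower_module by (simp add: tpower_def tensor_space_def)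

lemma sV_sW_linear:
  shows "b \<in> tensors (Ws n) \<Longrightarrow>
      linear_map K (tensor K (Vs m)) TT (\<lambda>a. pure K [TV, TV'] [sV m a, sW n b])"
    and "a \<in> tensors (Vs m) \<Longrightarrow>
      linear_map K (tensor K (Ws n)) TT (\<lambda>b. pure K [TV, TV'] [sV m a, sW n b])"
  by (rule linear_map_compose[OF sV_linear pure_pair_linear(1)[OF spaces sW_closed]],
      assumption, rule linear_map_compose[OF sW_linear pure_pair_linear(2)[OF spaces sV_closed]])

text \<open>The bridge from flat tensors over \<open>Vs m @ Ws n\<close> to the nested product. The
  definition speaks of pure tensors; the formula for general \<open>a\<close> and \<open>b\<close>
  follows because both sides are linear in each.\<close>

lemma incl_properties:
  shows incl_linear: "linear_map K (tensor K (Vs m @ Ws n)) TT (incl m n)"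
    and incl_tcat: "a \<in> tensors (Vs m) \<Longrightarrow> b \<in> tensors (Ws n) \<Longrightarrow>
      incl m n (tcat K (Vs m) (Ws n) a b) = pure K [TV, TV'] [sV m a, sW n b]"
proof -
  define h where "h zs = pure K [TV, TV'] [sV m (pure K (Vs m) (take m zs)), sW n (pure K (Ws n) (drop m zs))]" for zs
  have h: "h (xs @ ys) = pure K [TV, TV'] [sV m (pure K (Vs m) xs), sW n (pure K (Ws n) ys)]"
    if "xs \<in> tuples (Vs m)" for xs ys
    using tuples_length[OF that] by (simp add: h_def)
  have l: "modules (Vs m)" "modules (Ws n)" "modules (Vs m @ Ws n)"
    by simp_all
  have hm: "multilinear (Vs m @ Ws n) TT h"
  proof (rule multilinear_append)
    fix ys assume ys: "ys \<in> tuples (Ws n)"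
    show "multilinear (Vs m) TT (\<lambda>xs. h (xs @ ys))"
      by (rule multilinear_cong[OF l(1) h[symmetric]], assumption)
        (rule multilinear_compose[OF pure_multilinear[OF l(1)] sV_sW_linear(1)[OF pure_closed[OF l(2) ys]]])
  next
    fix xs assume xs: "xs \<in> tuples (Vs m)"
    show "multilinear (Ws n) TT (\<lambda>ys. h (xs @ ys))"
      by (rule multilinear_cong[OF l(2) h[OF xs, symmetric]])
        (rule multilinear_compose[OF pure_multilinear[OF l(2)] sV_sW_linear(2)[OF pure_closed[OF l(1) xs]]])
  qed
  have e: "incl m n = lift K (Vs m @ Ws n) TT h" by (simp add: bidegree_incl_def h_def[abs_def])
  show lin: "linear_map K (tensor K (Vs m @ Ws n)) TT (incl m n)"
    unfolding e by (rule lift_linear[OF l(3) TT_module hm])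
  show "incl m n (tcat K (Vs m) (Ws n) a b) = pure K [TV, TV'] [sV m a, sW n b]"
    if a: "a \<in> tensors (Vs m)" and b: "b \<in> tensors (Ws n)"
  proof (rule tensor_eqI[OF l(1) TT_module linear_map_compose[OF tcat_linear_left[OF l(1,2) b] lin]
        sV_sW_linear(1)[OF b] _ a])
    fix xs assume xs: "xs \<in> tuples (Vs m)"
    note px = pure_closed[OF l(1) xs]
    show "incl m n (tcat K (Vs m) (Ws n) (pure K (Vs m) xs) b) = pure K [TV, TV'] [sV m (pure K (Vs m) xs), sW n b]"
      by (rule tensor_eqI[OF l(2) TT_module linear_map_compose[OF tcat_linear_right[OF l(1,2) px] lin]
            sV_sW_linear(2)[OF px] _ b])
        (simp add: tcat_pure xs tuples_append e lift_pure[OF l(3) TT_module hm] h)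
  qed
qed

text \<open>One formula for all bidegrees, zero included, where the empty word makes the block
  crossing the identity. So \<open>psi\<close> can be constructed without separate cases.\<close>

definition psi_deg :: "nat \<Rightarrow> nat \<Rightarrow> ('v list \<Rightarrow> 'a) set \<Rightarrow> ('v list \<Rightarrow> 'a) set \<Rightarrow> ((nat \<Rightarrow> ('v list \<Rightarrow> 'a) set) list \<Rightarrow> 'a) set"
  where "psi_deg n m a b = incl m n (C.block n m (tcat K (Ws n) (Vs m) a b))"

lemma psi_deg_eq: "psi_deg n m a b = incl m n (psi_component K V V' U n m a b)"
  by (simp add: psi_deg_def psi_component_def C.block_def)

lemma psi_deg_linear_left:
  "b \<in> tensors (Vs m) \<Longrightarrow> linear_map K (tensor K (Ws n)) TT (\<lambda>a. psi_deg n m a b)"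
  unfolding psi_deg_def
  by (rule linear_map_compose[OF linear_map_compose[OF tcat_linear_left C.block_linear] incl_linear]) simp_all

lemma psi_deg_linear_right:
  "a \<in> tensors (Ws n) \<Longrightarrow> linear_map K (tensor K (Vs m)) TT (\<lambda>b. psi_deg n m a b)"
  unfolding psi_deg_def
  by (rule linear_map_compose[OF linear_map_compose[OF tcat_linear_right C.block_linear] incl_linear]) simp_all

lemma psi_deg_0_right:
  assumes a: "a \<in> tensors (Ws n)"
  shows "psi_deg n 0 a (pure K [] []) = pure K [TV, TV'] [tensor_one K V, sW n a]"
  using incl_tcat[of "pure K [] []" 0 a n] a unit_closed
  by (simp add: psi_deg_def C.block_0 tcat_Nil_left tcat_Nil_right tensor_one_def)

lemma psi_deg_0_left:
  assumes b: "b \<in> tensors (Vs m)"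
  shows "psi_deg 0 m (pure K [] []) b = pure K [TV, TV'] [sV m b, tensor_one K V']"
  using incl_tcat[of b m "pure K [] []" 0] b unit_closed
  by (simp add: psi_deg_def C.block_0 tcat_Nil_left tcat_Nil_right tensor_one_def)

text \<open>The predicate under the definite description in \<open>psi\<close>, repeated here so
  that \<open>theI'\<close> can be applied to it.\<close>

abbreviation (input) psi_spec where "psi_spec \<psi> \<equiv>
  \<psi> \<in> extensional (tensors [TV', TV]) \<and>
  linear_map K (tensor K [TV', TV]) TT \<psi> \<and>
  (\<forall>n\<ge>1. \<forall>m\<ge>1. \<forall>x\<in>carrier (tpower K V' n). \<forall>y\<in>carrier (tpower K V m).
    \<psi> (pure K [TV', TV] [sW n x, sV m y]) = incl m n (psi_component K V V' U n m x y)) \<and>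
  (\<forall>x\<in>carrier TV'. \<psi> (pure K [TV', TV] [x, tensor_one K V]) = pure K [TV, TV'] [tensor_one K V, x]) \<and>
  (\<forall>y\<in>carrier TV. \<psi> (pure K [TV', TV] [tensor_one K V', y]) = pure K [TV, TV'] [y, tensor_one K V'])"

text \<open>The maps \<open>psi_deg\<close> are bilinear in every bidegree and extend to the direct
  sums. The two unit clauses compare linear maps, so they are checked on summands, where they are
  the formulas for \<open>psi_deg\<close> in degree zero.\<close>

lemma psi_exists: "\<exists>\<psi>. psi_spec \<psi>"
proof -
  have lin: "linear_map K (tpower K V' n) TT (\<lambda>a. psi_deg n m a b)" if "b \<in> carrier (tpower K V m)" for n m b
    using psi_deg_linear_left that by (simp add: tpower_def)
  have lin': "linear_map K (tpower K V m) TT (\<lambda>b. psi_deg n m a b)" if "a \<in> carrier (tpower K V' n)" for n m a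
    using psi_deg_linear_right that by (simp add: tpower_def)
  obtain h where h1: "\<And>y. y \<in> carrier TV \<Longrightarrow> linear_map K TV' TT (\<lambda>x. h x y)"
    and h2: "\<And>x. x \<in> carrier TV' \<Longrightarrow> linear_map K TV TT (\<lambda>y. h x y)"
    and h3: "\<And>n m a b. a \<in> carrier (tpower K V' n) \<Longrightarrow> b \<in> carrier (tpower K V m) \<Longrightarrow> h (sW n a) (sV m b) = psi_deg n m a b"
    using direct_sum_bilinear_lift[of "tpower K V'" "tpower K V" TT psi_deg,
        OF B.tpower_module A.tpower_module TT_module lin lin'] unfolding tensor_space_def by blast
  define \<phi> where "\<phi> = lift K [TV', TV] TT (\<lambda>zs. h (zs ! 0) (zs ! 1))"
  have l: "modules [TV', TV]" by simp
  have ml: "multilinear [TV', TV] TT (\<lambda>zs. h (zs ! 0) (zs ! 1))"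
    by (rule multilinear_pair) (simp_all add: h1 h2)
  have p: "\<phi> (pure K [TV', TV] [x, y]) = h x y" if "x \<in> carrier TV'" "y \<in> carrier TV" for x y
    unfolding \<phi>_def using lift_pure[OF l TT_module ml, of "[x, y]"] that by simp
  have "psi_spec \<phi>"
  proof (intro conjI ballI allI impI)
    show "\<phi> \<in> extensional (tensors [TV', TV])" unfolding \<phi>_def by (rule lift_extensional[OF l TT_module ml])
    show "linear_map K (tensor K [TV', TV]) TT \<phi>" unfolding \<phi>_def by (rule lift_linear[OF l TT_module ml])
    show "\<phi> (pure K [TV', TV] [sW n x, sV m y]) = incl m n (psi_component K V V' U n m x y)"
      if "x \<in> carrier (tpower K V' n)" "y \<in> carrier (tpower K V m)" for n m x y
      using that by (simp add: p A.tsummand_closed B.tsummand_closed h3 psi_deg_eq)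
    show "\<phi> (pure K [TV', TV] [x, tensor_one K V]) = pure K [TV, TV'] [tensor_one K V, x]" if x: "x \<in> carrier TV'" for x
      unfolding p[OF x A.tensor_one_closed]
    proof (rule B.TV_eqI[OF h1[OF A.tensor_one_closed] pure_pair_linear(2)[OF spaces A.tensor_one_closed] _ x])
      fix n a assume a: "a \<in> carrier (tpower K V' n)"
      show "h (sW n a) (tensor_one K V) = pure K [TV, TV'] [tensor_one K V, sW n a]"
        using h3[OF a A.tpower_one_closed] psi_deg_0_right[of a n] a by (simp add: tensor_one_def tpower_def)
    qed
    show "\<phi> (pure K [TV', TV] [tensor_one K V', y]) = pure K [TV, TV'] [y, tensor_one K V']" if y: "y \<in> carrier TV" for y
      unfolding p[OF B.tensor_one_closed y]
    proof (rule A.TV_eqI[OF h2[OF B.tensor_one_closed] pure_pair_linear(1)[OF spaces B.tensor_one_closed] _ y])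
      fix n a assume a: "a \<in> carrier (tpower K V n)"
      show "h (tensor_one K V') (sV n a) = pure K [TV, TV'] [sV n a, tensor_one K V']"
        using h3[OF B.tpower_one_closed a] psi_deg_0_left[of a n] a by (simp add: tensor_one_def tpower_def)
    qed
  qed
  then show ?thesis by blast
qed

text \<open>In degree zero the specification prescribes only the value at the unit
  \<open>pure K [] []\<close>. This spans the whole of degree zero, so linearity forces the rest;
  any two solutions thus agree in every bidegree.\<close>

lemma psi_spec_deg:
  assumes s: "psi_spec \<psi>" and a: "a \<in> tensors (Ws n)" and b: "b \<in> tensors (Vs m)"
  shows "\<psi> (pure K [TV', TV] [sW n a, sV m b]) = psi_deg n m a b"
proof -
  have lin: "linear_map K (tensor K [TV', TV]) TT \<psi>" using s by blast
  note sa = sW_closed[OF a] and sb = sV_closed[OF b]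
  have Nil: "modules []" by simp
  consider "n = 0" | "m = 0" | "n \<ge> 1" "m \<ge> 1" by linarith
  then show ?thesis
  proof cases
    case 1
    have a': "a \<in> tensors []" using a 1 by simp
    have "\<psi> (pure K [TV', TV] [sW 0 a, sV m b]) = psi_deg 0 m a b"
    proof (rule tensor_eqI[OF Nil TT_module _ _ _ a'])
      show "linear_map K (tensor K []) TT (\<lambda>a. \<psi> (pure K [TV', TV] [sW 0 a, sV m b]))"
        using linear_map_compose[OF sW_linear[of 0] linear_map_compose[OF pure_pair_linear(1)[OF _ _ sb] lin]] by simp
      show "linear_map K (tensor K []) TT (\<lambda>a. psi_deg 0 m a b)"
        using psi_deg_linear_left[OF b, of 0] by simp
      fix xs :: "'v list" assume "xs \<in> tuples []"
      then show "\<psi> (pure K [TV', TV] [sW 0 (pure K [] xs), sV m b]) = psi_deg 0 m (pure K [] xs) b"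
        using s sb psi_deg_0_left[OF b] by (simp add: tensor_one_def)
    qed
    then show ?thesis using 1 by simp
  next
    case 2
    have b': "b \<in> tensors []" using b 2 by simp
    have "\<psi> (pure K [TV', TV] [sW n a, sV 0 b]) = psi_deg n 0 a b"
    proof (rule tensor_eqI[OF Nil TT_module _ _ _ b'])
      show "linear_map K (tensor K []) TT (\<lambda>b. \<psi> (pure K [TV', TV] [sW n a, sV 0 b]))"
        using linear_map_compose[OF sV_linear[of 0] linear_map_compose[OF pure_pair_linear(2)[OF _ _ sa] lin]] by simp
      show "linear_map K (tensor K []) TT (\<lambda>b. psi_deg n 0 a b)"
        using psi_deg_linear_right[OF a, of 0] by simp
      fix xs :: "'v list" assume "xs \<in> tuples []"
      then show "\<psi> (pure K [TV', TV] [sW n a, sV 0 (pure K [] xs)]) = psi_deg n 0 a (pure K [] xs)"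
        using s sa psi_deg_0_right[OF a] by (simp add: tensor_one_def)
    qed
    then show ?thesis using 2 by simp
  next
    case 3
    then show ?thesis using s a b by (simp add: tpower_def psi_deg_eq)
  qed
qed

abbreviation (input) Psi where "Psi \<equiv> psi K V V' U"

lemma psi_spec_psi: "psi_spec Psi"
proof -
  obtain \<psi> where \<psi>: "psi_spec \<psi>" using psi_exists by blast
  have "\<exists>!\<psi>. psi_spec \<psi>"
  proof (rule ex1I[of psi_spec, OF \<psi>])
    fix \<phi> assume \<phi>: "psi_spec \<phi>"
    show "\<phi> = \<psi>"
    proof (rule extensionalityI[where A = "tensors [TV', TV]"])
      fix t assume t: "t \<in> tensors [TV', TV]"
      have "linear_map K (tensor K [TV', TV]) TT \<phi>" "linear_map K (tensor K [TV', TV]) TT \<psi>"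
        using \<phi> \<psi> by blast+
      then show "\<phi> t = \<psi> t"
        using tensor2_direct_sum_eqI[of "tpower K V'" "tpower K V" TT \<phi> \<psi>, OF B.tpower_module A.tpower_module TT_module]
          psi_spec_deg[OF \<phi>] psi_spec_deg[OF \<psi>] t
        unfolding tensor_space_def tpower_def by blast
    qed (use \<phi> \<psi> in blast)+
  qed
  from theI'[OF this] show ?thesis unfolding psi_def Let_def .
qed

lemma psi_linear: "linear_map K (tensor K [TV', TV]) TT Psi"
  using psi_spec_psi by blast

lemma psi_one_right: "x \<in> carrier TV' \<Longrightarrow> Psi (pure K [TV', TV] [x, tensor_one K V]) = pure K [TV, TV'] [tensor_one K V, x]"
  using psi_spec_psi by blast

lemma psi_one_left: "y \<in> carrier TV \<Longrightarrow> Psi (pure K [TV', TV] [tensor_one K V', y]) = pure K [TV, TV'] [y, tensor_one K V']"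
  using psi_spec_psi by blast

lemma psi_pure:
  "a \<in> tensors (Ws n) \<Longrightarrow> b \<in> tensors (Vs m) \<Longrightarrow>
    Psi (pure K [TV', TV] [sW n a, sV m b]) = incl m n (C.block n m (tcat K (Ws n) (Vs m) a b))"
  using psi_spec_deg[OF psi_spec_psi] by (simp add: psi_deg_def)

end

section \<open>Multiplication and unit of a braid algebra as maps of tensor products\<close>

context braided_space
begin

lemma braid_algebra_same: "same_space A TV"
  by (simp add: same_space_def)

lemma TV_lists: "modules [TV]" "modules [TV, TV]"
  by (simp_all add: tensor_space_module)

lemma mult_map_properties:
  shows mult_map_linear: "tlinear [TV, TV] [TV] (mult_map K A)"
    and mult_map_pure: "x \<in> carrier TV \<Longrightarrow> y \<in> carrier TV \<Longrightarrow>
      mult_map K A (pure K [TV, TV] [x, y]) = pure K [TV] [x \<otimes>\<^bsub>A\<^esub> y]"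
proof -
  let ?h = "\<lambda>xs. pure K [TV] [xs ! 0 \<otimes>\<^bsub>A\<^esub> xs ! 1]"
  have T: "module K (tensor K [TV])" by (rule tensor_module[OF TV_lists(1)])
  \<comment> \<open>\<open>mult_map\<close> is formed over the algebra record; rewritten over the
    tensor space it meets the lemmas on \<open>TV\<close>.\<close>
  have e: "mult_map K A = lift K [TV, TV] (tensor K [TV]) ?h"
    using braid_algebra_same
    by (simp add: mult_map_def lift_same[of "[A, A]" "[TV, TV]"] tensor_same[of "[A]" "[TV]"] pure_same[of "[A]" "[TV]"])
  have p: "linear_map K TV (tensor K [TV]) (\<lambda>x. pure K [TV] [x])"
    using multilinear_linear[OF pure_multilinear[OF TV_lists(1)], of "[\<zero>\<^bsub>TV\<^esub>]" 0]
      module_zero_closed[OF tensor_space_module] by simp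
  have h: "multilinear [TV, TV] (tensor K [TV]) ?h"
    by (rule multilinear_pair)
      (simp_all add: linear_map_compose[OF mult_linear_left p] linear_map_compose[OF mult_linear_right p])
  show "tlinear [TV, TV] [TV] (mult_map K A)"
    unfolding e by (rule lift_linear[OF TV_lists(2) T h])
  show "mult_map K A (pure K [TV, TV] [x, y]) = pure K [TV] [x \<otimes>\<^bsub>A\<^esub> y]" if "x \<in> carrier TV" "y \<in> carrier TV"
    unfolding e using lift_pure[OF TV_lists(2) T h, of "[x, y]"] that by simp
qed

lemma unit_map_properties:
  shows unit_map_linear: "tlinear [] [TV] (unit_map K A)"
    and unit_map_pure: "unit_map K A (pure K [] []) = pure K [TV] [tensor_one K V]"
proof -
  let ?h = "\<lambda>xs::(nat \<Rightarrow> ('v list \<Rightarrow> 'a) set) list. pure K [TV] [tensor_one K V]"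
  have T: "module K (tensor K [TV])" by (rule tensor_module[OF TV_lists(1)])
  have Nil: "modules []" by simp
  have e: "unit_map K A = lift K [] (tensor K [TV]) ?h"
    using braid_algebra_same
    by (simp add: unit_map_def tensor_same[of "[A]" "[TV]"] pure_same[of "[A]" "[TV]"])
  have h: "multilinear [] (tensor K [TV]) ?h"
    by (rule multilinear_Nil) (rule pure_single_closed[OF tensor_space_module tensor_one_closed])
  show "tlinear [] [TV] (unit_map K A)"
    unfolding e by (rule lift_linear[OF Nil T h])
  show "unit_map K A (pure K [] []) = pure K [TV] [tensor_one K V]"
    unfolding e using lift_pure[OF Nil T h, of "[]"] by simp
qed

end

section \<open>The four factorisation identities\<close>

context mixed_braiding
begin

interpretation A: braided_space K V R by (rule V_braided)
interpretation B: braided_space K V' R' by (rule V'_braided)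
interpretation C: crossing K V' V U
  by (intro crossing.intro crossing_axioms.intro scalar_ring_axioms A.V B.V U)

abbreviation (input) mu where "mu \<equiv> mult_map K (braid_algebra K V R)"
abbreviation (input) mu' where "mu' \<equiv> mult_map K (braid_algebra K V' R')"
abbreviation (input) mu_I where "mu_I \<equiv> leg K [] [TV'] [TV, TV] [TV] mu"
abbreviation (input) I_mu where "I_mu \<equiv> leg K [TV'] [] [TV, TV] [TV] mu"
abbreviation (input) I_mu' where "I_mu' \<equiv> leg K [TV] [] [TV', TV'] [TV'] mu'"
abbreviation (input) mu'_I where "mu'_I \<equiv> leg K [] [TV] [TV', TV'] [TV'] mu'"
abbreviation (input) Psi_A where "Psi_A \<equiv> leg K [] [TV] [TV', TV] [TV, TV'] Psi"
abbreviation (input) Psi_B where "Psi_B \<equiv> leg K [] [TV'] [TV', TV] [TV, TV'] Psi"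
abbreviation (input) A_Psi where "A_Psi \<equiv> leg K [TV] [] [TV', TV] [TV, TV'] Psi"
abbreviation (input) B_Psi where "B_Psi \<equiv> leg K [TV'] [] [TV', TV] [TV, TV'] Psi"

lemma lists: "set Ms \<subseteq> {TV, TV'} \<Longrightarrow> modules Ms"
  by (auto simp: list_all_iff)

lemma pure_sV_closed: "a \<in> tensors (Vs m) \<Longrightarrow> pure K [TV] [sV m a] \<in> tensors [TV]"
  by (rule pure_single_closed[OF spaces(1) sV_closed])

lemma pure_sW_closed: "a \<in> tensors (Ws m) \<Longrightarrow> pure K [TV'] [sW m a] \<in> tensors [TV']"
  by (rule pure_single_closed[OF spaces(2) sW_closed])

lemma Vs_add: "Vs (m + p) = Vs p @ Vs m"
  using A.replicate_commute by metis

lemma Ws_add: "Ws (m + p) = Ws p @ Ws m"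
  using A.replicate_commute by metis

lemma A_block_linear: "tlinear (Vs m @ Vs p) (Vs (m + p)) (A.block m p)"
  unfolding Vs_add by (rule A.block_linear)

lemma B_block_linear: "tlinear (Ws m @ Ws p) (Ws (m + p)) (B.block m p)"
  unfolding Ws_add by (rule B.block_linear)

text \<open>Multiplication in the nested product becomes \<open>A.block\<close> on flat tensors. The
  tensor \<open>u\<close> is general because it will be a value of \<open>C.block\<close>, which
  need not have the form \<open>c \<otimes> d\<close>.\<close>

lemma mult_after_incl_right:
  assumes a: "a \<in> tensors (Vs m)" and u: "u \<in> tensors (Vs p @ Ws n)"
  shows "mu_I (tcat K [TV] [TV, TV'] (pure K [TV] [sV m a]) (incl p n u))
    = incl (m + p) n (leg K [] (Ws n) (Vs m @ Vs p) (Vs (m + p)) (A.block m p) (tcat K (Vs m) (Vs p @ Ws n) a u))"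
proof -
  have l: "modules (Vs m)" "modules (Vs p)" "modules (Ws n)"
    "modules (Vs p @ Ws n)" "modules (Vs m @ Vs p)" "modules (Vs (m + p))"
    "modules []"
    by simp_all
  have l1: "linear_map K (tensor K [TV, TV, TV']) TT mu_I"
    using leg_linear[OF l(7) _ _ _ A.mult_map_linear, of "[TV']"] by simp
  have l2: "tlinear (Vs m @ Vs p @ Ws n) (Vs (m + p) @ Ws n)
      (leg K [] (Ws n) (Vs m @ Vs p) (Vs (m + p)) (A.block m p))"
    using leg_linear[OF l(7,3,5,6) A_block_linear] by simp
  show ?thesis
  proof (rule tcat_eqI[OF l(2,3) TT_module _ _ _ u])
    show "linear_map K (tensor K (Vs p @ Ws n)) TT
        (\<lambda>u. mu_I (tcat K [TV] [TV, TV'] (pure K [TV] [sV m a]) (incl p n u)))"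
      using linear_map_compose[OF linear_map_compose[OF incl_linear
          tcat_linear_right[OF lists lists pure_sV_closed[OF a]]]] l1 by simp
    show "linear_map K (tensor K (Vs p @ Ws n)) TT (\<lambda>u. incl (m + p) n
        (leg K [] (Ws n) (Vs m @ Vs p) (Vs (m + p)) (A.block m p) (tcat K (Vs m) (Vs p @ Ws n) a u)))"
      by (rule linear_map_compose[OF tcat_linear_right[OF l(1,4) a] linear_map_compose[OF l2 incl_linear]])
    fix c d assume c: "c \<in> tensors (Vs p)" and d: "d \<in> tensors (Ws n)"
    note sa = sV_closed[OF a] and sc = sV_closed[OF c] and sd = sW_closed[OF d]
    have ac: "tcat K (Vs m) (Vs p) a c \<in> tensors (Vs m @ Vs p)" by (rule tcat_closed[OF l(1,2) a c])
    have "mu_I (pure K [TV, TV, TV'] [sV m a, sV p c, sW n d])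
        = tcat K [TV] [TV'] (pure K [TV] [sV m a \<otimes>\<^bsub>braid_algebra K V R\<^esub> sV p c]) (pure K [TV'] [sW n d])"
      using leg_pure_left[OF spaces(1,1,2) _ A.mult_map_linear sa sc sd] sa sc by (simp add: A.mult_map_pure)
    also have "\<dots> = pure K [TV, TV'] [sV (m + p) (A.block m p (tcat K (Vs m) (Vs p) a c)), sW n d]"
      using tcat_pure[of "[TV]" "[TV']" "[sV m a \<otimes>\<^bsub>braid_algebra K V R\<^esub> sV p c]" "[sW n d]"] sa sc sd
        A.mult_closed[OF sa sc] A.mult_summand[of a m c p] a c by (simp add: tpower_def A.comp_eq)
    also have "\<dots> = incl (m + p) n (tcat K (Vs (m + p)) (Ws n) (A.block m p (tcat K (Vs m) (Vs p) a c)) d)"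
      by (rule incl_tcat[OF linear_map_closed[OF A_block_linear ac] d, symmetric])
    finally show "mu_I
          (tcat K [TV] [TV, TV'] (pure K [TV] [sV m a]) (incl p n (tcat K (Vs p) (Ws n) c d)))
        = incl (m + p) n (leg K [] (Ws n) (Vs m @ Vs p) (Vs (m + p)) (A.block m p)
            (tcat K (Vs m) (Vs p @ Ws n) a (tcat K (Vs p) (Ws n) c d)))"
      using tcat_pure[of "[TV]" "[TV, TV']" "[sV m a]" "[sV p c, sW n d]"] sa sc sd incl_tcat[OF c d]
        tcat_assoc[OF l(1,2,3) a c d] leg_left[OF l(3,5,6) A_block_linear ac d] by simp
  qed
qed

text \<open>The last two maps in the first factorisation identity, expressed on flat tensors;
  \<open>s\<close> is what the first crossing leaves, again a general tensor.\<close>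

lemma mult_psi_after_incl:
  assumes s: "s \<in> tensors (Vs m @ Ws n)" and c: "c \<in> tensors (Vs p)"
  shows "mu_I (A_Psi
      (tcat K [TV, TV'] [TV] (incl m n s) (pure K [TV] [sV p c])))
    = incl (m + p) n (leg K [] (Ws n) (Vs m @ Vs p) (Vs (m + p)) (A.block m p)
        (leg K (Vs m) [] (Ws n @ Vs p) (Vs p @ Ws n) (C.block n p) (tcat K (Vs m @ Ws n) (Vs p) s c)))"
proof -
  have l: "modules (Vs m)" "modules (Vs p)" "modules (Ws n)"
    "modules (Vs m @ Ws n)" "modules (Vs m @ Vs p)" "modules (Vs (m + p))"
    "modules []" "modules (Ws n @ Vs p)" "modules (Vs p @ Ws n)"
    by simp_all
  have l1: "linear_map K (tensor K [TV, TV, TV']) TT mu_I"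
    using leg_linear[OF l(7) _ _ _ A.mult_map_linear, of "[TV']"] by simp
  have l2: "tlinear (Vs m @ Vs p @ Ws n) (Vs (m + p) @ Ws n)
      (leg K [] (Ws n) (Vs m @ Vs p) (Vs (m + p)) (A.block m p))"
    using leg_linear[OF l(7,3,5,6) A_block_linear] by simp
  have l3: "tlinear [TV, TV', TV] [TV, TV, TV'] A_Psi"
    using leg_linear[OF _ l(7) _ _ psi_linear, of "[TV]"] by simp
  have l4: "tlinear ((Vs m @ Ws n) @ Vs p) (Vs m @ Vs p @ Ws n)
      (leg K (Vs m) [] (Ws n @ Vs p) (Vs p @ Ws n) (C.block n p))"
    using leg_linear[OF l(1,7,8,9) C.block_linear] by simp
  have l5: "linear_map K TT (tensor K [TV, TV', TV]) (\<lambda>s. tcat K [TV, TV'] [TV] s (pure K [TV] [sV p c]))"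
    using tcat_linear_left[OF lists lists pure_sV_closed[OF c], of "[TV, TV']"] by simp
  show ?thesis
  proof (rule tcat_eqI[OF l(1,3) TT_module
        linear_map_compose[OF incl_linear linear_map_compose[OF l5 linear_map_compose[OF l3 l1]]]
        linear_map_compose[OF tcat_linear_left[OF l(4,2) c] linear_map_compose[OF l4 linear_map_compose[OF l2 incl_linear]]]
        _ s])
    fix a b assume a: "a \<in> tensors (Vs m)" and b: "b \<in> tensors (Ws n)"
    note sa = sV_closed[OF a] and sb = sW_closed[OF b] and sc = sV_closed[OF c]
    have bc: "tcat K (Ws n) (Vs p) b c \<in> tensors (Ws n @ Vs p)" by (rule tcat_closed[OF l(3,2) b c])
    have "A_Psi (pure K [TV, TV', TV] [sV m a, sW n b, sV p c])
        = tcat K [TV] [TV, TV'] (pure K [TV] [sV m a]) (incl p n (C.block n p (tcat K (Ws n) (Vs p) b c)))"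
      using leg_pure_right[OF spaces(1,2,1) _ psi_linear sa sb sc] psi_pure[OF b c] by simp
    moreover have "tcat K [TV, TV'] [TV] (incl m n (tcat K (Vs m) (Ws n) a b)) (pure K [TV] [sV p c])
        = pure K [TV, TV', TV] [sV m a, sW n b, sV p c]"
      using tcat_pure[of "[TV, TV']" "[TV]" "[sV m a, sW n b]" "[sV p c]"] sa sb sc incl_tcat[OF a b] by simp
    moreover have "leg K (Vs m) [] (Ws n @ Vs p) (Vs p @ Ws n) (C.block n p)
        (tcat K (Vs m @ Ws n) (Vs p) (tcat K (Vs m) (Ws n) a b) c)
        = tcat K (Vs m) (Vs p @ Ws n) a (C.block n p (tcat K (Ws n) (Vs p) b c))"
      using leg_right[OF l(1,8,9) C.block_linear a bc] tcat_assoc[OF l(1,3,2) a b c] by simp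
    ultimately show "mu_I (A_Psi
          (tcat K [TV, TV'] [TV] (incl m n (tcat K (Vs m) (Ws n) a b)) (pure K [TV] [sV p c])))
        = incl (m + p) n (leg K [] (Ws n) (Vs m @ Vs p) (Vs (m + p)) (A.block m p)
            (leg K (Vs m) [] (Ws n @ Vs p) (Vs p @ Ws n) (C.block n p)
              (tcat K (Vs m @ Ws n) (Vs p) (tcat K (Vs m) (Ws n) a b) c)))"
      using mult_after_incl_right[OF a linear_map_closed[OF C.block_linear bc]] by simp
  qed
qed

text \<open>For homogeneous \<open>a\<close>, \<open>b\<close>, \<open>c\<close> the identity is one
  of flat tensors: naturality moves the product of \<open>b\<close> and \<open>c\<close> past
  \<open>a\<close>, and \<open>block_add_right\<close> lets \<open>a\<close> pass \<open>b\<close>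
  and \<open>c\<close> in turn.\<close>

lemma psi_mult_right:
  assumes t: "t \<in> tensors [TV', TV, TV]"
  shows "Psi (I_mu t) = mu_I
    (A_Psi (Psi_A t))"
proof -
  have l1: "linear_map K (tensor K [TV, TV, TV']) TT mu_I"
    using leg_linear[OF _ _ _ _ A.mult_map_linear, of "[]" "[TV']"] by simp
  have l2: "tlinear [TV', TV, TV] [TV', TV] I_mu"
    using leg_linear[OF _ _ _ _ A.mult_map_linear, of "[TV']" "[]"] by simp
  have l3: "tlinear [TV, TV', TV] [TV, TV, TV'] A_Psi"
    using leg_linear[OF _ _ _ _ psi_linear, of "[TV]" "[]"] by simp
  have l4: "tlinear [TV', TV, TV] [TV, TV', TV] Psi_A"
    using leg_linear[OF _ _ _ _ psi_linear, of "[]" "[TV]"] by simp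
  show ?thesis
  proof (rule tensor3_direct_sum_eqI[of "tpower K V'" "tpower K V" "tpower K V", folded tensor_space_def,
        OF B.tpower_module A.tpower_module A.tpower_module TT_module linear_map_compose[OF l2 psi_linear]
        linear_map_compose[OF l4 linear_map_compose[OF l3 l1]] _ t])
    fix n m p a b c
    assume abc: "a \<in> carrier (tpower K V' n)" "b \<in> carrier (tpower K V m)" "c \<in> carrier (tpower K V p)"
    then have a: "a \<in> tensors (Ws n)" and b: "b \<in> tensors (Vs m)"
      and c: "c \<in> tensors (Vs p)" by (simp_all add: tpower_def)
    note sa = sW_closed[OF a] and sb = sV_closed[OF b] and sc = sV_closed[OF c]
    let ?t = "tcat K (Ws n) (Vs m @ Vs p) a (tcat K (Vs m) (Vs p) b c)"
    have ab: "tcat K (Ws n) (Vs m) a b \<in> tensors (Ws n @ Vs m)"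
      and bc: "tcat K (Vs m) (Vs p) b c \<in> tensors (Vs m @ Vs p)"
      by (rule tcat_closed, simp_all add: a b c)+
    then have t: "?t \<in> tensors (Ws n @ Vs m @ Vs p)"
      using a by (simp add: tcat_closed)
    have bb: "A.block m p (tcat K (Vs m) (Vs p) b c) \<in> tensors (Vs (m + p))"
      by (rule linear_map_closed[OF A_block_linear bc])
    have "I_mu (pure K [TV', TV, TV] [sW n a, sV m b, sV p c])
        = tcat K [TV'] [TV] (pure K [TV'] [sW n a]) (pure K [TV] [sV (m + p) (A.block m p (tcat K (Vs m) (Vs p) b c))])"
      using leg_pure_right[OF spaces(2,1,1) _ A.mult_map_linear sa sb sc] sb sc A.mult_summand[OF abc(2,3)]
      by (simp add: A.mult_map_pure A.comp_eq)
    also have "\<dots> = pure K [TV', TV] [sW n a, sV (m + p) (A.block m p (tcat K (Vs m) (Vs p) b c))]"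
      using tcat_pure[of "[TV']" "[TV]" "[sW n a]" "[sV (m + p) (A.block m p (tcat K (Vs m) (Vs p) b c))]"]
        sa sV_closed[OF bb] by simp
    finally have "Psi (I_mu (pure K [TV', TV, TV] [sW n a, sV m b, sV p c]))
        = incl (m + p) n (C.block n (m + p) (tcat K (Ws n) (Vs (m + p)) a (A.block m p (tcat K (Vs m) (Vs p) b c))))"
      using psi_pure[OF a bb] by simp
    also have "tcat K (Ws n) (Vs (m + p)) a (A.block m p (tcat K (Vs m) (Vs p) b c))
        = leg K (Ws n) [] (Vs m @ Vs p) (Vs (m + p)) (A.block m p) ?t"
      using leg_right[OF _ _ _ A_block_linear a bc] by simp
    also have "C.block n (m + p) \<dots> = leg K [] (Ws n) (Vs m @ Vs p) (Vs (m + p)) (A.block m p) (C.block n (m + p) ?t)"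
      using right_natural_R[of n m p] t by (simp add: C.right_natural_def replicate_add)
    also have "C.block n (m + p) ?t = leg K (Vs m) [] (Ws n @ Vs p) (Vs p @ Ws n) (C.block n p)
        (leg K [] (Vs p) (Ws n @ Vs m) (Vs m @ Ws n) (C.block n m) ?t)"
      by (rule C.block_add_right) (use t in \<open>simp add: replicate_add\<close>)
    also have "leg K [] (Vs p) (Ws n @ Vs m) (Vs m @ Ws n) (C.block n m) ?t
        = tcat K (Vs m @ Ws n) (Vs p) (C.block n m (tcat K (Ws n) (Vs m) a b)) c"
      using leg_left[OF _ _ _ C.block_linear ab c] tcat_assoc[of "Ws n" "Vs m" "Vs p" a b c] a b c by simp
    also have "incl (m + p) n (leg K [] (Ws n) (Vs m @ Vs p) (Vs (m + p)) (A.block m p)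
        (leg K (Vs m) [] (Ws n @ Vs p) (Vs p @ Ws n) (C.block n p)
          (tcat K (Vs m @ Ws n) (Vs p) (C.block n m (tcat K (Ws n) (Vs m) a b)) c)))
        = mu_I (A_Psi
          (tcat K [TV, TV'] [TV] (incl m n (C.block n m (tcat K (Ws n) (Vs m) a b))) (pure K [TV] [sV p c])))"
      by (rule mult_psi_after_incl[OF linear_map_closed[OF C.block_linear ab] c, symmetric])
    also have "tcat K [TV, TV'] [TV] (incl m n (C.block n m (tcat K (Ws n) (Vs m) a b))) (pure K [TV] [sV p c])
        = Psi_A (pure K [TV', TV, TV] [sW n a, sV m b, sV p c])"
      using leg_pure_left[OF spaces(2,1,1) _ psi_linear sa sb sc] psi_pure[OF a b] by simp
    finally show "Psi (I_mu (pure K [TV', TV, TV] [sW n a, sV m b, sV p c]))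
        = mu_I (A_Psi
          (Psi_A (pure K [TV', TV, TV] [sW n a, sV m b, sV p c])))" .
  qed
qed

text \<open>The counterpart for multiplication in \<open>T(V')\<close>. The general tensor
  \<open>u\<close> stands on the left here, since the last crossing before the multiplication acts
  on the first two factors.\<close>

lemma mult_after_incl_left:
  assumes u: "u \<in> tensors (Vs m @ Ws n)" and b: "b \<in> tensors (Ws k)"
  shows "I_mu' (tcat K [TV, TV'] [TV'] (incl m n u) (pure K [TV'] [sW k b]))
    = incl m (n + k) (leg K (Vs m) [] (Ws n @ Ws k) (Ws (n + k)) (B.block n k) (tcat K (Vs m @ Ws n) (Ws k) u b))"
proof -
  have l: "modules (Vs m)" "modules (Ws n)" "modules (Ws k)"
    "modules (Vs m @ Ws n)" "modules (Ws n @ Ws k)" "modules (Ws (n + k))"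
    "modules []"
    by simp_all
  have l1: "linear_map K (tensor K [TV, TV', TV']) TT I_mu'"
    using leg_linear[OF _ l(7) _ _ B.mult_map_linear, of "[TV]"] by simp
  have l2: "tlinear ((Vs m @ Ws n) @ Ws k) (Vs m @ Ws (n + k))
      (leg K (Vs m) [] (Ws n @ Ws k) (Ws (n + k)) (B.block n k))"
    using leg_linear[OF l(1,7,5,6) B_block_linear] by simp
  have l3: "linear_map K TT (tensor K [TV, TV', TV']) (\<lambda>s. tcat K [TV, TV'] [TV'] s (pure K [TV'] [sW k b]))"
    using tcat_linear_left[OF lists lists pure_sW_closed[OF b], of "[TV, TV']"] by simp
  show ?thesis
  proof (rule tcat_eqI[OF l(1,2) TT_module linear_map_compose[OF incl_linear linear_map_compose[OF l3 l1]]
        linear_map_compose[OF tcat_linear_left[OF l(4,3) b] linear_map_compose[OF l2 incl_linear]] _ u])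
    fix c d assume c: "c \<in> tensors (Vs m)" and d: "d \<in> tensors (Ws n)"
    note sb = sW_closed[OF b] and sc = sV_closed[OF c] and sd = sW_closed[OF d]
    have db: "tcat K (Ws n) (Ws k) d b \<in> tensors (Ws n @ Ws k)" by (rule tcat_closed[OF l(2,3) d b])
    have "I_mu' (pure K [TV, TV', TV'] [sV m c, sW n d, sW k b])
        = tcat K [TV] [TV'] (pure K [TV] [sV m c]) (pure K [TV'] [sW n d \<otimes>\<^bsub>braid_algebra K V' R'\<^esub> sW k b])"
      using leg_pure_right[OF spaces(1,2,2) _ B.mult_map_linear sc sd sb] sd sb by (simp add: B.mult_map_pure)
    also have "\<dots> = pure K [TV, TV'] [sV m c, sW (n + k) (B.block n k (tcat K (Ws n) (Ws k) d b))]"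
      using tcat_pure[of "[TV]" "[TV']" "[sV m c]" "[sW n d \<otimes>\<^bsub>braid_algebra K V' R'\<^esub> sW k b]"] sc sd sb
        B.mult_closed[OF sd sb] B.mult_summand[of d n b k] d b by (simp add: tpower_def B.comp_eq)
    also have "\<dots> = incl m (n + k) (tcat K (Vs m) (Ws (n + k)) c (B.block n k (tcat K (Ws n) (Ws k) d b)))"
      by (rule incl_tcat[OF c linear_map_closed[OF B_block_linear db], symmetric])
    finally show "I_mu'
          (tcat K [TV, TV'] [TV'] (incl m n (tcat K (Vs m) (Ws n) c d)) (pure K [TV'] [sW k b]))
        = incl m (n + k) (leg K (Vs m) [] (Ws n @ Ws k) (Ws (n + k)) (B.block n k)
            (tcat K (Vs m @ Ws n) (Ws k) (tcat K (Vs m) (Ws n) c d) b))"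
      using tcat_pure[of "[TV, TV']" "[TV']" "[sV m c, sW n d]" "[sW k b]"] sb sc sd incl_tcat[OF c d]
        tcat_assoc[OF l(1,2,3) c d b] leg_right[OF l(1,5,6) B_block_linear c db] by simp
  qed
qed

text \<open>Now the earlier crossing has acted on the last two factors, so its result
  \<open>s\<close> stands to the right of \<open>a\<close>.\<close>

lemma mult_psi_before_incl:
  assumes a: "a \<in> tensors (Ws n)" and s: "s \<in> tensors (Vs m @ Ws k)"
  shows "I_mu' (Psi_B
      (tcat K [TV'] [TV, TV'] (pure K [TV'] [sW n a]) (incl m k s)))
    = incl m (n + k) (leg K (Vs m) [] (Ws n @ Ws k) (Ws (n + k)) (B.block n k)
        (leg K [] (Ws k) (Ws n @ Vs m) (Vs m @ Ws n) (C.block n m) (tcat K (Ws n) (Vs m @ Ws k) a s)))"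
proof -
  have l: "modules (Vs m)" "modules (Ws n)" "modules (Ws k)"
    "modules (Vs m @ Ws k)" "modules (Ws n @ Ws k)" "modules (Ws (n + k))"
    "modules []" "modules (Ws n @ Vs m)" "modules (Vs m @ Ws n)"
    by simp_all
  have l1: "linear_map K (tensor K [TV, TV', TV']) TT I_mu'"
    using leg_linear[OF _ l(7) _ _ B.mult_map_linear, of "[TV]"] by simp
  have l2: "tlinear (Vs m @ Ws n @ Ws k) (Vs m @ Ws (n + k))
      (leg K (Vs m) [] (Ws n @ Ws k) (Ws (n + k)) (B.block n k))"
    using leg_linear[OF l(1,7,5,6) B_block_linear] by simp
  have l3: "tlinear [TV', TV, TV'] [TV, TV', TV'] Psi_B"
    using leg_linear[OF l(7) _ _ _ psi_linear, of "[TV']"] by simp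
  have l4: "tlinear (Ws n @ Vs m @ Ws k) (Vs m @ Ws n @ Ws k)
      (leg K [] (Ws k) (Ws n @ Vs m) (Vs m @ Ws n) (C.block n m))"
    using leg_linear[OF l(7,3,8,9) C.block_linear] by simp
  have l5: "linear_map K TT (tensor K [TV', TV, TV']) (\<lambda>s. tcat K [TV'] [TV, TV'] (pure K [TV'] [sW n a]) s)"
    using tcat_linear_right[OF lists lists pure_sW_closed[OF a], of "[TV, TV']"] by simp
  show ?thesis
  proof (rule tcat_eqI[OF l(1,3) TT_module
        linear_map_compose[OF incl_linear linear_map_compose[OF l5 linear_map_compose[OF l3 l1]]]
        linear_map_compose[OF tcat_linear_right[OF l(2,4) a] linear_map_compose[OF l4 linear_map_compose[OF l2 incl_linear]]]
        _ s])
    fix c b assume c: "c \<in> tensors (Vs m)" and b: "b \<in> tensors (Ws k)"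
    note sa = sW_closed[OF a] and sb = sW_closed[OF b] and sc = sV_closed[OF c]
    have ac: "tcat K (Ws n) (Vs m) a c \<in> tensors (Ws n @ Vs m)" by (rule tcat_closed[OF l(2,1) a c])
    have "Psi_B (pure K [TV', TV, TV'] [sW n a, sV m c, sW k b])
        = tcat K [TV, TV'] [TV'] (incl m n (C.block n m (tcat K (Ws n) (Vs m) a c))) (pure K [TV'] [sW k b])"
      using leg_pure_left[OF spaces(2,1,2) _ psi_linear sa sc sb] psi_pure[OF a c] by simp
    moreover have "tcat K [TV'] [TV, TV'] (pure K [TV'] [sW n a]) (incl m k (tcat K (Vs m) (Ws k) c b))
        = pure K [TV', TV, TV'] [sW n a, sV m c, sW k b]"
      using tcat_pure[of "[TV']" "[TV, TV']" "[sW n a]" "[sV m c, sW k b]"] sa sb sc incl_tcat[OF c b] by simp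
    moreover have "leg K [] (Ws k) (Ws n @ Vs m) (Vs m @ Ws n) (C.block n m)
        (tcat K (Ws n) (Vs m @ Ws k) a (tcat K (Vs m) (Ws k) c b))
        = tcat K (Vs m @ Ws n) (Ws k) (C.block n m (tcat K (Ws n) (Vs m) a c)) b"
      using leg_left[OF l(3,8,9) C.block_linear ac b] tcat_assoc[OF l(2,1,3) a c b] by simp
    ultimately show "I_mu' (Psi_B
          (tcat K [TV'] [TV, TV'] (pure K [TV'] [sW n a]) (incl m k (tcat K (Vs m) (Ws k) c b))))
        = incl m (n + k) (leg K (Vs m) [] (Ws n @ Ws k) (Ws (n + k)) (B.block n k)
            (leg K [] (Ws k) (Ws n @ Vs m) (Vs m @ Ws n) (C.block n m)
              (tcat K (Ws n) (Vs m @ Ws k) a (tcat K (Vs m) (Ws k) c b))))"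
      using mult_after_incl_left[OF linear_map_closed[OF C.block_linear ac] b] by simp
  qed
qed

text \<open>Left naturality moves the product of \<open>a\<close> and \<open>b\<close> past
  \<open>c\<close>, and \<open>block_add_left\<close> lets \<open>c\<close> pass \<open>b\<close>
  and then \<open>a\<close>.\<close>

lemma psi_mult_left:
  assumes t: "t \<in> tensors [TV', TV', TV]"
  shows "Psi (mu'_I t) = I_mu'
    (Psi_B (B_Psi t))"
proof -
  have l1: "linear_map K (tensor K [TV, TV', TV']) TT I_mu'"
    using leg_linear[OF _ _ _ _ B.mult_map_linear, of "[TV]" "[]"] by simp
  have l2: "tlinear [TV', TV', TV] [TV', TV] mu'_I"
    using leg_linear[OF _ _ _ _ B.mult_map_linear, of "[]" "[TV]"] by simp
  have l3: "tlinear [TV', TV, TV'] [TV, TV', TV'] Psi_B"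
    using leg_linear[OF _ _ _ _ psi_linear, of "[]" "[TV']"] by simp
  have l4: "tlinear [TV', TV', TV] [TV', TV, TV'] B_Psi"
    using leg_linear[OF _ _ _ _ psi_linear, of "[TV']" "[]"] by simp
  show ?thesis
  proof (rule tensor3_direct_sum_eqI[of "tpower K V'" "tpower K V'" "tpower K V", folded tensor_space_def,
        OF B.tpower_module B.tpower_module A.tpower_module TT_module linear_map_compose[OF l2 psi_linear]
        linear_map_compose[OF l4 linear_map_compose[OF l3 l1]] _ t])
    fix n k m a b c
    assume abc: "a \<in> carrier (tpower K V' n)" "b \<in> carrier (tpower K V' k)" "c \<in> carrier (tpower K V m)"
    then have a: "a \<in> tensors (Ws n)" and b: "b \<in> tensors (Ws k)"
      and c: "c \<in> tensors (Vs m)" by (simp_all add: tpower_def)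
    note sa = sW_closed[OF a] and sb = sW_closed[OF b] and sc = sV_closed[OF c]
    let ?t = "tcat K (Ws n) (Ws k @ Vs m) a (tcat K (Ws k) (Vs m) b c)"
    have ab: "tcat K (Ws n) (Ws k) a b \<in> tensors (Ws n @ Ws k)"
      and bc: "tcat K (Ws k) (Vs m) b c \<in> tensors (Ws k @ Vs m)"
      by (rule tcat_closed, simp_all add: a b c)+
    then have t: "?t \<in> tensors (Ws n @ Ws k @ Vs m)"
      using a by (simp add: tcat_closed)
    have bb: "B.block n k (tcat K (Ws n) (Ws k) a b) \<in> tensors (Ws (n + k))"
      by (rule linear_map_closed[OF B_block_linear ab])
    have "mu'_I (pure K [TV', TV', TV] [sW n a, sW k b, sV m c])
        = tcat K [TV'] [TV] (pure K [TV'] [sW (n + k) (B.block n k (tcat K (Ws n) (Ws k) a b))]) (pure K [TV] [sV m c])"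
      using leg_pure_left[OF spaces(2,2,1) _ B.mult_map_linear sa sb sc] sa sb B.mult_summand[OF abc(1,2)]
      by (simp add: B.mult_map_pure B.comp_eq)
    also have "\<dots> = pure K [TV', TV] [sW (n + k) (B.block n k (tcat K (Ws n) (Ws k) a b)), sV m c]"
      using tcat_pure[of "[TV']" "[TV]" "[sW (n + k) (B.block n k (tcat K (Ws n) (Ws k) a b))]" "[sV m c]"]
        sc sW_closed[OF bb] by simp
    finally have "Psi (mu'_I (pure K [TV', TV', TV] [sW n a, sW k b, sV m c]))
        = incl m (n + k) (C.block (n + k) m (tcat K (Ws (n + k)) (Vs m) (B.block n k (tcat K (Ws n) (Ws k) a b)) c))"
      using psi_pure[OF bb c] by simp
    also have "tcat K (Ws (n + k)) (Vs m) (B.block n k (tcat K (Ws n) (Ws k) a b)) c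
        = leg K [] (Vs m) (Ws n @ Ws k) (Ws (n + k)) (B.block n k) ?t"
      using leg_left[OF _ _ _ B_block_linear ab c] tcat_assoc[of "Ws n" "Ws k" "Vs m" a b c] a b c by simp
    also have "C.block (n + k) m \<dots> = leg K (Vs m) [] (Ws n @ Ws k) (Ws (n + k)) (B.block n k) (C.block (n + k) m ?t)"
      using left_natural_R'[of n k m] t by (simp add: C.left_natural_def replicate_add)
    also have "C.block (n + k) m ?t = leg K [] (Ws k) (Ws n @ Vs m) (Vs m @ Ws n) (C.block n m)
        (leg K (Ws n) [] (Ws k @ Vs m) (Vs m @ Ws k) (C.block k m) ?t)"
      by (rule C.block_add_left) (use t in \<open>simp add: replicate_add\<close>)
    also have "leg K (Ws n) [] (Ws k @ Vs m) (Vs m @ Ws k) (C.block k m) ?t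
        = tcat K (Ws n) (Vs m @ Ws k) a (C.block k m (tcat K (Ws k) (Vs m) b c))"
      by (rule leg_right[OF _ _ _ C.block_linear a bc]) simp_all
    also have "incl m (n + k) (leg K (Vs m) [] (Ws n @ Ws k) (Ws (n + k)) (B.block n k)
        (leg K [] (Ws k) (Ws n @ Vs m) (Vs m @ Ws n) (C.block n m)
          (tcat K (Ws n) (Vs m @ Ws k) a (C.block k m (tcat K (Ws k) (Vs m) b c)))))
        = I_mu' (Psi_B
          (tcat K [TV'] [TV, TV'] (pure K [TV'] [sW n a]) (incl m k (C.block k m (tcat K (Ws k) (Vs m) b c)))))"
      by (rule mult_psi_before_incl[OF a linear_map_closed[OF C.block_linear bc], symmetric])
    also have "tcat K [TV'] [TV, TV'] (pure K [TV'] [sW n a]) (incl m k (C.block k m (tcat K (Ws k) (Vs m) b c)))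
        = B_Psi (pure K [TV', TV', TV] [sW n a, sW k b, sV m c])"
      using leg_pure_right[OF spaces(2,2,1) _ psi_linear sa sb sc] psi_pure[OF b c] by simp
    finally show "Psi (mu'_I (pure K [TV', TV', TV] [sW n a, sW k b, sV m c]))
        = I_mu' (Psi_B
          (B_Psi (pure K [TV', TV', TV] [sW n a, sW k b, sV m c])))" .
  qed
qed

text \<open>A tensor over \<open>[TV']\<close> is its own concatenation with the empty tensor on
  either side, and the unit is inserted in that empty place; what remains is the unit clause for
  \<open>psi\<close>.\<close>

lemma psi_unit_right:
  assumes t: "t \<in> tensors [TV']"
  shows "Psi (leg K [TV'] [] [] [TV] (unit_map K (braid_algebra K V R)) t)
    = leg K [] [TV'] [] [TV] (unit_map K (braid_algebra K V R)) t"
proof (rule tensor_eqI[OF _ TT_module _ _ _ t])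
  let ?u = "unit_map K (braid_algebra K V R)"
  show "modules [TV']" by simp
  show "linear_map K (tensor K [TV']) TT (\<lambda>t. Psi (leg K [TV'] [] [] [TV] ?u t))"
    using linear_map_compose[OF leg_linear[OF _ _ _ _ A.unit_map_linear, of "[TV']" "[]"]] psi_linear by simp
  show "linear_map K (tensor K [TV']) TT (leg K [] [TV'] [] [TV] ?u)"
    using leg_linear[OF _ _ _ _ A.unit_map_linear, of "[]" "[TV']"] by simp
  fix xs assume "xs \<in> tuples [TV']"
  then obtain x where xs: "xs = [x]" "x \<in> carrier TV'" by (rule tuples_singleE)
  note px = pure_single_closed[OF spaces(2) xs(2)]
  have "leg K [TV'] [] [] [TV] ?u (pure K [TV'] [x]) = pure K [TV', TV] [x, tensor_one K V]"
    using leg_right[OF _ _ _ A.unit_map_linear px unit_closed] tcat_Nil_right[OF _ px]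
      tcat_pure[of "[TV']" "[TV]" "[x]" "[tensor_one K V]"] xs A.tensor_one_closed
    by (simp add: A.unit_map_pure)
  moreover have "leg K [] [TV'] [] [TV] ?u (pure K [TV'] [x]) = pure K [TV, TV'] [tensor_one K V, x]"
    using leg_left[OF _ _ _ A.unit_map_linear unit_closed px] tcat_Nil_left[OF _ px]
      tcat_pure[of "[TV]" "[TV']" "[tensor_one K V]" "[x]"] xs A.tensor_one_closed
    by (simp add: A.unit_map_pure)
  ultimately show "Psi (leg K [TV'] [] [] [TV] ?u (pure K [TV'] xs)) = leg K [] [TV'] [] [TV] ?u (pure K [TV'] xs)"
    using psi_one_right xs by simp
qed

lemma psi_unit_left:
  assumes t: "t \<in> tensors [TV]"
  shows "Psi (leg K [] [TV] [] [TV'] (unit_map K (braid_algebra K V' R')) t)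
    = leg K [TV] [] [] [TV'] (unit_map K (braid_algebra K V' R')) t"
proof (rule tensor_eqI[OF _ TT_module _ _ _ t])
  let ?u = "unit_map K (braid_algebra K V' R')"
  show "modules [TV]" by simp
  show "linear_map K (tensor K [TV]) TT (\<lambda>t. Psi (leg K [] [TV] [] [TV'] ?u t))"
    using linear_map_compose[OF leg_linear[OF _ _ _ _ B.unit_map_linear, of "[]" "[TV]"]] psi_linear by simp
  show "linear_map K (tensor K [TV]) TT (leg K [TV] [] [] [TV'] ?u)"
    using leg_linear[OF _ _ _ _ B.unit_map_linear, of "[TV]" "[]"] by simp
  fix xs assume "xs \<in> tuples [TV]"
  then obtain x where xs: "xs = [x]" "x \<in> carrier TV" by (rule tuples_singleE)
  note px = pure_single_closed[OF spaces(1) xs(2)]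
  have "leg K [] [TV] [] [TV'] ?u (pure K [TV] [x]) = pure K [TV', TV] [tensor_one K V', x]"
    using leg_left[OF _ _ _ B.unit_map_linear unit_closed px] tcat_Nil_left[OF _ px]
      tcat_pure[of "[TV']" "[TV]" "[tensor_one K V']" "[x]"] xs B.tensor_one_closed
    by (simp add: B.unit_map_pure)
  moreover have "leg K [TV] [] [] [TV'] ?u (pure K [TV] [x]) = pure K [TV, TV'] [x, tensor_one K V']"
    using leg_right[OF _ _ _ B.unit_map_linear px unit_closed] tcat_Nil_right[OF _ px]
      tcat_pure[of "[TV]" "[TV']" "[x]" "[tensor_one K V']"] xs B.tensor_one_closed
    by (simp add: B.unit_map_pure)
  ultimately show "Psi (leg K [] [TV] [] [TV'] ?u (pure K [TV] xs)) = leg K [TV] [] [] [TV'] ?u (pure K [TV] xs)"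
    using psi_one_left xs by simp
qed

theorem psi_factorisation: "algebra_factorisation K (braid_algebra K V R) (braid_algebra K V' R') Psi"
proof -
  let ?A = "braid_algebra K V R" and ?B = "braid_algebra K V' R'"
  have s: "same_space ?A TV" "same_space ?B TV'" by (rule A.braid_algebra_same, rule B.braid_algebra_same)
  \<comment> \<open>The goal is stated over the algebra records, the identities over the tensor
    spaces; \<open>same_space\<close> makes the tensor products and the legs equal.\<close>
  have t: "tensor K [?B, ?A] = tensor K [TV', TV]" "tensor K [?A, ?B] = TT"
    "tensor K [?B, ?A, ?A] = tensor K [TV', TV, TV]" "tensor K [?B, ?B, ?A] = tensor K [TV', TV', TV]"
    "tensor K [?B] = tensor K [TV']" "tensor K [?A] = tensor K [TV]"
    by (rule tensor_same, simp add: s)+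
  have l: "leg K [?B] [] [?A, ?A] [?A] = leg K [TV'] [] [TV, TV] [TV]"
    "leg K [] [?B] [?A, ?A] [?A] = leg K [] [TV'] [TV, TV] [TV]"
    "leg K [?A] [] [?B, ?A] [?A, ?B] = leg K [TV] [] [TV', TV] [TV, TV']"
    "leg K [] [?A] [?B, ?A] [?A, ?B] = leg K [] [TV] [TV', TV] [TV, TV']"
    "leg K [] [?A] [?B, ?B] [?B] = leg K [] [TV] [TV', TV'] [TV']"
    "leg K [?A] [] [?B, ?B] [?B] = leg K [TV] [] [TV', TV'] [TV']"
    "leg K [] [?B] [?B, ?A] [?A, ?B] = leg K [] [TV'] [TV', TV] [TV, TV']"
    "leg K [?B] [] [?B, ?A] [?A, ?B] = leg K [TV'] [] [TV', TV] [TV, TV']"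
    "leg K [?B] [] [] [?A] = leg K [TV'] [] [] [TV]" "leg K [] [?B] [] [?A] = leg K [] [TV'] [] [TV]"
    "leg K [] [?A] [] [?B] = leg K [] [TV] [] [TV']" "leg K [?A] [] [] [?B] = leg K [TV] [] [] [TV']"
    by (rule ext, rule leg_same, simp_all add: s)+
  show ?thesis
    unfolding algebra_factorisation_def t l
    by (intro conjI ballI A.braid_algebra_assoc B.braid_algebra_assoc psi_linear
        psi_mult_right psi_mult_left psi_unit_right psi_unit_left)
qed

end

theorem theorem3p2:
  fixes K :: "('k, 'r) ring_scheme"
    and V V' :: "('k, 'v) module"
    and W X Z R R' U :: "('v list \<Rightarrow> 'k) set \<Rightarrow> ('v list \<Rightarrow> 'k) set"
  assumes "field K"
    and "module K V"
    and "module K V'"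
    and "WXZ_system K V V' W X Z"
    and "R = W \<circ> flip K V V"
    and "R' = Z \<circ> flip K V' V'"
    and "U = X \<circ> flip K V' V"
  shows "(assoc_algebra K (braid_algebra K V R) \<and> assoc_algebra K (braid_algebra K V' R')) \<and>
    algebra_factorisation K (braid_algebra K V R) (braid_algebra K V' R') (psi K V V' U)"
proof -
  interpret scalar_ring K using module.axioms(1)[OF assms(2)] by (rule scalar_ring.intro)
  note V = assms(2,3)
  have W: "linear_map K (tensor K [V, V]) (tensor K [V, V]) W"
    and X: "linear_map K (tensor K [V, V']) (tensor K [V, V']) X"
    and Z: "linear_map K (tensor K [V', V']) (tensor K [V', V']) Z"
    and yb: "yb_commute K V V V W W W" "yb_commute K V' V' V' Z Z Z" "yb_commute K V V V' W X X"
      "yb_commute K V V' V' X X Z"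
    using assms(4) unfolding WXZ_system_def by blast+
  have R: "linear_map K (tensor K [V, V]) (tensor K [V, V]) R"
    and R': "linear_map K (tensor K [V', V']) (tensor K [V', V']) R'"
    and U: "linear_map K (tensor K [V', V]) (tensor K [V, V']) U"
    unfolding assms(5-7) comp_def
    by (rule linear_map_compose[OF flip_linear[OF V(1,1)] W], rule linear_map_compose[OF flip_linear[OF V(2,2)] Z],
        rule linear_map_compose[OF flip_linear[OF V(2,1)] X])
  \<comment> \<open>With \<open>V' = V\<close> and \<open>X = Z = W\<close> the maps
    \<open>U\<close> and \<open>R\<close> of the mixed relation coincide.\<close>
  have RV: "braided_space K V R"
    by (intro braided_space.intro braided_space_axioms.intro scalar_ring_axioms V R)
      (unfold assms(5), rule mixed_braid_left[OF V(1,1) W W yb(1)])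
  have RV': "braided_space K V' R'"
    by (intro braided_space.intro braided_space_axioms.intro scalar_ring_axioms V R')
      (unfold assms(6), rule mixed_braid_left[OF V(2,2) Z Z yb(2)])
  have "mixed_braiding K V V' R R' U"
    by (intro mixed_braiding.intro mixed_braiding_axioms.intro scalar_ring_axioms U RV RV')
      (unfold assms(5-7), rule mixed_braid_right[OF V W X yb(3)], assumption,
        rule mixed_braid_left[OF V X Z yb(4)])
  then have "algebra_factorisation K (braid_algebra K V R) (braid_algebra K V' R') (psi K V V' U)"
    by (rule mixed_braiding.psi_factorisation)
  then show ?thesis unfolding algebra_factorisation_def by blast
qed

end
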